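(* Let $\alpha=\{\alpha_t:t\ge0\}$ be an $E_0$-semigroup on a $\mathrm{II}_1$ factor $\mathrm{M}$ acting standardly on $L^2(\mathrm{M})$. For $t>0$ let $H^\alpha_t=E^\alpha_t\cap E^{\alpha'}_t$, equipped with the inner product determined by $T^*S=\langle S,T\rangle_t1$, and let $U_{s,t}:H^\alpha_s\otimes H^\alpha_t\to H^\alpha_{s+t}$ be given by $U_{s,t}(X\otimes Y)=XY$. Then $\{H^\alpha_t,U_{s,t}\}_{s,t\in(0,\infty)}$ is a super product system.
   Context: An $E_0$-semigroup on a von Neumann algebra $\mathrm{M}$ is a semigroup $(\alpha_t)_{t\ge 0}$ of normal unital $*$-endomorphisms of $\mathrm{M}$ with $\alpha_0=\mathrm{id}$, $\alpha_t(\mathrm{M})\ne \mathrm{M}$ for all $t>0$, and $t\mapsto\rho(\alpha_t(x))$ continuous for all $x\in\mathrm{M}$, $\rho\in\mathrm{M}_*$. Let $J$ be the modular conjugation on $L^2(\mathrm{M})$ associated with the cyclic and separating trace vector $\Omega$. The complementary $E_0$-semigroup is $\alpha'_t(x')=J\alpha_t(Jx'J)J$ on $\mathrm{M}'$. Put $$E^\alpha_t=\{T\in B(L^2(\mathrm{M})):\alpha_t(m)T=Tm\ \forall m\in\mathrm{M}\},\qquad E^{\alpha'}_t=\{T\in B(L^2(\mathrm{M})):\alpha'_t(m')T=Tm'\ \forall m'\in\mathrm{M}'\}.$$ For $S,T\in E^\alpha_t\cap E^{\alpha'}_t$ the operator $T^*S$ commutes with $\mathrm{M}$ and $\mathrm{M}'$,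 hence is a scalar multiple of the identity. A super product system is a one-parameter family of separable Hilbert spaces $\{H_t\}_{t>0}$ with isometries $U_{s,t}:H_s\otimes H_t\to H_{s+t}$ ($s,t>0$) such that (i) (associativity) $U_{s_1,s_2+s_3}(1_{H_{s_1}}\otimes U_{s_2,s_3})=U_{s_1+s_2,s_3}(U_{s_1,s_2}\otimes 1_{H_{s_3}})$ for all $s_1,s_2,s_3>0$, and (ii) (measurability) the space $\{(t,\xi_t):t>0,\ \xi_t\in H_t\}$ is equipped with a structure of standard Borel space that is compatible with the projection $(t,\xi_t)\mapsto t$ onto $(0,\infty)$, with the tensor products and with the inner products, as in Arveson's definition of a product system of Hilbert spaces.
   Formalization: The Hilbert space L²(M) is assumed separable; without this the claim fails, since for Clifford flows of uncountable rank the spaces H_t are not separable. *)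

theory Defs
  imports "HOL-Analysis.Analysis"
begin

section \<open>Complex Hilbert spaces as types\<close>

text \<open>The space \<open>L\<^sup>2(M)\<close> on which the von Neumann algebra acts is a type of the following
  class. Inner products are linear in the first and conjugate-linear in the second argument;
  norm and topology are those of the underlying real inner product \<open>Re \<langle>x, y\<rangle>\<close>. Separability
  of the Hilbert space is the further sort constraint \<open>second_countable_topology\<close>.\<close>

class complex_hilbert = real_inner + complete_space +
  fixes scaleC :: "complex \<Rightarrow> 'a \<Rightarrow> 'a" (infixr "*\<^sub>C" 75)
    and cinner :: "'a \<Rightarrow> 'a \<Rightarrow> complex"
  assumes scaleC_add_right: "c *\<^sub>C (x + y) = c *\<^sub>C x + c *\<^sub>C y"
    and scaleC_add_left: "(c + d) *\<^sub>C x = c *\<^sub>C x + d *\<^sub>C x"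
    and scaleC_scaleC: "c *\<^sub>C d *\<^sub>C x = (c * d) *\<^sub>C x"
    and scaleC_of_real: "complex_of_real r *\<^sub>C x = r *\<^sub>R x"
    and cinner_add_left: "cinner (x + y) z = cinner x z + cinner y z"
    and cinner_scaleC_left: "cinner (c *\<^sub>C x) y = c * cinner x y"
    and cinner_commute: "cinner x y = cnj (cinner y x)"
    and Re_cinner: "Re (cinner x y) = inner x y"

definition bounded_clinear :: "('h::complex_hilbert \<Rightarrow> 'h) \<Rightarrow> bool" where
  "bounded_clinear T \<longleftrightarrow> bounded_linear T \<and> (\<forall>c x. T (c *\<^sub>C x) = c *\<^sub>C T x)"

definition cadj :: "('h::complex_hilbert \<Rightarrow> 'h) \<Rightarrow> 'h \<Rightarrow> 'h" where
  "cadj T = (THE S. \<forall>x y. cinner (T x) y = cinner x (S y))"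

section \<open>Von Neumann algebras and \<open>II\<^sub>1\<close> factors in standard form\<close>

definition commutant :: "('h::complex_hilbert \<Rightarrow> 'h) set \<Rightarrow> ('h \<Rightarrow> 'h) set" where
  "commutant S = {T. bounded_clinear T \<and> (\<forall>s\<in>S. T \<circ> s = s \<circ> T)}"

definition von_neumann_algebra :: "('h::complex_hilbert \<Rightarrow> 'h) set \<Rightarrow> bool" where
  "von_neumann_algebra M \<longleftrightarrow>
     M \<subseteq> Collect bounded_clinear \<and> (\<forall>m\<in>M. cadj m \<in> M) \<and> commutant (commutant M) = M"

definition factor :: "('h::complex_hilbert \<Rightarrow> 'h) set \<Rightarrow> bool" where
  "factor M \<longleftrightarrow> von_neumann_algebra M \<and> M \<inter> commutant M = range (\<lambda>c x. c *\<^sub>C x)"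

definition projection_in :: "('h::complex_hilbert \<Rightarrow> 'h) set \<Rightarrow> ('h \<Rightarrow> 'h) \<Rightarrow> bool" where
  "projection_in M p \<longleftrightarrow> p \<in> M \<and> p \<circ> p = p \<and> cadj p = p"

definition abelian_projection :: "('h::complex_hilbert \<Rightarrow> 'h) set \<Rightarrow> ('h \<Rightarrow> 'h) \<Rightarrow> bool" where
  "abelian_projection M p \<longleftrightarrow> projection_in M p \<and>
     (\<forall>x\<in>M. \<forall>y\<in>M. (p \<circ> x \<circ> p) \<circ> (p \<circ> y \<circ> p) = (p \<circ> y \<circ> p) \<circ> (p \<circ> x \<circ> p))"

text \<open>Type \<open>II\<^sub>1\<close> in the Murray--von Neumann sense: there is no nonzero abelian projection, and
  the identity is a finite projection, i.e. every isometry in \<open>M\<close> is unitary.\<close>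

definition II1_factor :: "('h::complex_hilbert \<Rightarrow> 'h) set \<Rightarrow> bool" where
  "II1_factor M \<longleftrightarrow> factor M \<and>
     (\<forall>p. abelian_projection M p \<longrightarrow> p = (\<lambda>_. 0)) \<and>
     (\<forall>v\<in>M. cadj v \<circ> v = id \<longrightarrow> v \<circ> cadj v = id)"

text \<open>\<open>M\<close> acts standardly, i.e. its Hilbert space is \<open>L\<^sup>2(M)\<close> for the trace
  \<open>m \<mapsto> \<langle>m \<Omega>, \<Omega>\<rangle>\<close>, with \<open>m \<in> M\<close> embedded as \<open>m \<Omega>\<close>.\<close>

definition standard_trace_vector :: "('h::complex_hilbert \<Rightarrow> 'h) set \<Rightarrow> 'h \<Rightarrow> bool" where
  "standard_trace_vector M \<Omega> \<longleftrightarrow>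
     norm \<Omega> = 1 \<and>
     closure ((\<lambda>m. m \<Omega>) ` M) = UNIV \<and>
     (\<forall>m\<in>M. m \<Omega> = 0 \<longrightarrow> m = (\<lambda>_. 0)) \<and>
     (\<forall>m\<in>M. \<forall>n\<in>M. cinner (m (n \<Omega>)) \<Omega> = cinner (n (m \<Omega>)) \<Omega>)"

text \<open>As \<open>\<Omega>\<close> is a trace vector, the modular operator is trivial and the modular conjugation is
  the continuous extension of \<open>m \<Omega> \<mapsto> m\<^sup>* \<Omega>\<close>.\<close>

definition modular_conj :: "('h::complex_hilbert \<Rightarrow> 'h) set \<Rightarrow> 'h \<Rightarrow> 'h \<Rightarrow> 'h" where
  "modular_conj M \<Omega> = (THE J. continuous_on UNIV J \<and> (\<forall>m\<in>M. J (m \<Omega>) = cadj m \<Omega>))"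

section \<open>\<open>E\<^sub>0\<close>-semigroups\<close>

text \<open>The predual \<open>M\<^sub>*\<close>, as the set of ultraweakly continuous linear functionals on \<open>M\<close>. Only the
  values on \<open>M\<close> matter.\<close>

definition predual ::
    "('h::complex_hilbert \<Rightarrow> 'h) set \<Rightarrow> (('h \<Rightarrow> 'h) \<Rightarrow> complex) set" where
  "predual M = {\<rho>. \<exists>\<xi> \<eta> :: nat \<Rightarrow> 'h.
     summable (\<lambda>n. (norm (\<xi> n))\<^sup>2) \<and> summable (\<lambda>n. (norm (\<eta> n))\<^sup>2) \<and>
     (\<forall>x\<in>M. \<rho> x = (\<Sum>n. cinner (x (\<xi> n)) (\<eta> n)))}"

definition normal_unital_star_endo ::
    "('h::complex_hilbert \<Rightarrow> 'h) set \<Rightarrow> (('h \<Rightarrow> 'h) \<Rightarrow> ('h \<Rightarrow> 'h)) \<Rightarrow> bool" where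
  "normal_unital_star_endo M \<theta> \<longleftrightarrow>
     \<theta> \<in> M \<rightarrow> M \<and>
     (\<forall>x\<in>M. \<forall>y\<in>M. \<theta> (\<lambda>v. x v + y v) = (\<lambda>v. \<theta> x v + \<theta> y v)) \<and>
     (\<forall>c. \<forall>x\<in>M. \<theta> (\<lambda>v. c *\<^sub>C x v) = (\<lambda>v. c *\<^sub>C \<theta> x v)) \<and>
     (\<forall>x\<in>M. \<forall>y\<in>M. \<theta> (x \<circ> y) = \<theta> x \<circ> \<theta> y) \<and>
     (\<forall>x\<in>M. \<theta> (cadj x) = cadj (\<theta> x)) \<and>
     \<theta> id = id \<and>
     (\<forall>\<rho>\<in>predual M. \<rho> \<circ> \<theta> \<in> predual M)"

definition E0_semigroup ::
    "('h::complex_hilbert \<Rightarrow> 'h) set \<Rightarrow> (real \<Rightarrow> ('h \<Rightarrow> 'h) \<Rightarrow> ('h \<Rightarrow> 'h)) \<Rightarrow> bool" where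
  "E0_semigroup M \<alpha> \<longleftrightarrow>
     (\<forall>t\<ge>0. normal_unital_star_endo M (\<alpha> t)) \<and>
     (\<forall>x\<in>M. \<alpha> 0 x = x) \<and>
     (\<forall>s\<ge>0. \<forall>t\<ge>0. \<forall>x\<in>M. \<alpha> (s + t) x = \<alpha> s (\<alpha> t x)) \<and>
     (\<forall>t>0. \<alpha> t ` M \<noteq> M) \<and>
     (\<forall>x\<in>M. \<forall>\<rho>\<in>predual M. continuous_on {0..} (\<lambda>t. \<rho> (\<alpha> t x)))"

definition complementary ::
    "('h::complex_hilbert \<Rightarrow> 'h) set \<Rightarrow> 'h \<Rightarrow> (real \<Rightarrow> ('h \<Rightarrow> 'h) \<Rightarrow> ('h \<Rightarrow> 'h)) \<Rightarrow>
      real \<Rightarrow> ('h \<Rightarrow> 'h) \<Rightarrow> ('h \<Rightarrow> 'h)" where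
  "complementary M \<Omega> \<alpha> t x' =
     (let J = modular_conj M \<Omega> in J \<circ> \<alpha> t (J \<circ> x' \<circ> J) \<circ> J)"

definition intertwiners ::
    "('h::complex_hilbert \<Rightarrow> 'h) set \<Rightarrow> (real \<Rightarrow> ('h \<Rightarrow> 'h) \<Rightarrow> ('h \<Rightarrow> 'h)) \<Rightarrow> real \<Rightarrow> ('h \<Rightarrow> 'h) set"
  where
  "intertwiners N \<beta> t = {T. bounded_clinear T \<and> (\<forall>m\<in>N. \<beta> t m \<circ> T = T \<circ> m)}"

section \<open>Complex Hilbert spaces with explicit carriers\<close>

text \<open>The fibres of a super product system vary with a real parameter, so they are not types
  but records of a carrier set and operations.\<close>

record 'a hspace =
  hcarrier :: "'a set"
  hzero :: 'a
  hadd :: "'a \<Rightarrow> 'a \<Rightarrow> 'a"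
  hscale :: "complex \<Rightarrow> 'a \<Rightarrow> 'a"
  hinner :: "'a \<Rightarrow> 'a \<Rightarrow> complex"

definition hnorm :: "'a hspace \<Rightarrow> 'a \<Rightarrow> real" where
  "hnorm H x = sqrt (Re (hinner H x x))"

definition hdist :: "'a hspace \<Rightarrow> 'a \<Rightarrow> 'a \<Rightarrow> real" where
  "hdist H x y = hnorm H (hadd H x (hscale H (- 1) y))"

locale hilbert_space =
  fixes H :: "'a hspace"
  assumes zero_closed: "hzero H \<in> hcarrier H"
    and add_closed: "\<lbrakk>x \<in> hcarrier H; y \<in> hcarrier H\<rbrakk> \<Longrightarrow> hadd H x y \<in> hcarrier H"
    and scale_closed: "x \<in> hcarrier H \<Longrightarrow> hscale H c x \<in> hcarrier H"
    and add_assoc: "\<lbrakk>x \<in> hcarrier H; y \<in> hcarrier H; z \<in> hcarrier H\<rbrakk>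
          \<Longrightarrow> hadd H (hadd H x y) z = hadd H x (hadd H y z)"
    and add_commute: "\<lbrakk>x \<in> hcarrier H; y \<in> hcarrier H\<rbrakk> \<Longrightarrow> hadd H x y = hadd H y x"
    and add_zero: "x \<in> hcarrier H \<Longrightarrow> hadd H x (hzero H) = x"
    and add_inverse: "x \<in> hcarrier H \<Longrightarrow> hadd H x (hscale H (- 1) x) = hzero H"
    and scale_add_right: "\<lbrakk>x \<in> hcarrier H; y \<in> hcarrier H\<rbrakk>
          \<Longrightarrow> hscale H c (hadd H x y) = hadd H (hscale H c x) (hscale H c y)"
    and scale_add_left: "x \<in> hcarrier H
          \<Longrightarrow> hscale H (c + d) x = hadd H (hscale H c x) (hscale H d x)"
    and scale_scale: "x \<in> hcarrier H \<Longrightarrow> hscale H c (hscale H d x) = hscale H (c * d) x"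
    and scale_one: "x \<in> hcarrier H \<Longrightarrow> hscale H 1 x = x"
    and inner_add: "\<lbrakk>x \<in> hcarrier H; y \<in> hcarrier H; z \<in> hcarrier H\<rbrakk>
          \<Longrightarrow> hinner H (hadd H x y) z = hinner H x z + hinner H y z"
    and inner_scale: "\<lbrakk>x \<in> hcarrier H; y \<in> hcarrier H\<rbrakk>
          \<Longrightarrow> hinner H (hscale H c x) y = c * hinner H x y"
    and inner_commute: "\<lbrakk>x \<in> hcarrier H; y \<in> hcarrier H\<rbrakk>
          \<Longrightarrow> hinner H x y = cnj (hinner H y x)"
    and inner_nonneg: "x \<in> hcarrier H \<Longrightarrow> 0 \<le> Re (hinner H x x)"
    and inner_eq_zero: "\<lbrakk>x \<in> hcarrier H; hinner H x x = 0\<rbrakk> \<Longrightarrow> x = hzero H"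
    and complete: "\<lbrakk>\<forall>n. X n \<in> hcarrier H;
            \<forall>e>0. \<exists>N::nat. \<forall>m\<ge>N. \<forall>n\<ge>N. hdist H (X m) (X n) < e\<rbrakk>
          \<Longrightarrow> \<exists>x\<in>hcarrier H. (\<lambda>n. hdist H (X n) x) \<longlonglongrightarrow> 0"

definition separable_hilbert_space :: "'a hspace \<Rightarrow> bool" where
  "separable_hilbert_space H \<longleftrightarrow> hilbert_space H \<and>
     (\<exists>D. countable D \<and> D \<subseteq> hcarrier H \<and> (\<forall>x\<in>hcarrier H. \<forall>e>0. \<exists>d\<in>D. hdist H x d < e))"

definition hlinear :: "'a hspace \<Rightarrow> 'b hspace \<Rightarrow> ('a \<Rightarrow> 'b) \<Rightarrow> bool" where
  "hlinear H K T \<longleftrightarrow> T \<in> hcarrier H \<rightarrow> hcarrier K \<and>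
     (\<forall>x\<in>hcarrier H. \<forall>y\<in>hcarrier H. T (hadd H x y) = hadd K (T x) (T y)) \<and>
     (\<forall>c. \<forall>x\<in>hcarrier H. T (hscale H c x) = hscale K c (T x))"

definition hbounded_linear :: "'a hspace \<Rightarrow> 'b hspace \<Rightarrow> ('a \<Rightarrow> 'b) \<Rightarrow> bool" where
  "hbounded_linear H K T \<longleftrightarrow> hlinear H K T \<and>
     (\<exists>C. \<forall>x\<in>hcarrier H. hnorm K (T x) \<le> C * hnorm H x)"

definition hisometry :: "'a hspace \<Rightarrow> 'b hspace \<Rightarrow> ('a \<Rightarrow> 'b) \<Rightarrow> bool" where
  "hisometry H K T \<longleftrightarrow> hlinear H K T \<and> (\<forall>x\<in>hcarrier H. hnorm K (T x) = hnorm H x)"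

definition orthonormal_basis :: "'a hspace \<Rightarrow> 'a set \<Rightarrow> bool" where
  "orthonormal_basis H B \<longleftrightarrow> B \<subseteq> hcarrier H \<and>
     (\<forall>a\<in>B. \<forall>b\<in>B. hinner H a b = (if a = b then 1 else 0)) \<and>
     (\<forall>x\<in>hcarrier H. (\<forall>b\<in>B. hinner H x b = 0) \<longrightarrow> x = hzero H)"

definition some_onb :: "'a hspace \<Rightarrow> 'a set" where
  "some_onb H = (SOME B. orthonormal_basis H B)"

subsection \<open>The Hilbert space tensor product\<close>

text \<open>The construction of Kadison and Ringrose: \<open>H \<otimes> K\<close> is the space of bounded Hilbert--Schmidt
  functionals on \<open>H\<^bsup>c\<^esup> \<times> K\<^bsup>c\<^esup>\<close> (\<open>c\<close> for the conjugate space), i.e. of forms on \<open>H \<times> K\<close> that are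
  conjugate-linear in both variables and square summable over a pair of orthonormal bases, and
  \<open>x \<otimes> y\<close> is the form \<open>(a, b) \<mapsto> \<langle>x, a\<rangle> \<langle>y, b\<rangle>\<close>. Neither the space nor its inner product depends on
  the bases. Forms are \<open>0\<close> off the carriers, so that equality of forms is equality of functions.\<close>

definition conj_bilinear_form :: "'a hspace \<Rightarrow> 'b hspace \<Rightarrow> ('a \<Rightarrow> 'b \<Rightarrow> complex) \<Rightarrow> bool" where
  "conj_bilinear_form H K F \<longleftrightarrow>
     (\<forall>a b. a \<notin> hcarrier H \<or> b \<notin> hcarrier K \<longrightarrow> F a b = 0) \<and>
     (\<forall>a\<in>hcarrier H. \<forall>a'\<in>hcarrier H. \<forall>b\<in>hcarrier K. F (hadd H a a') b = F a b + F a' b) \<and>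
     (\<forall>a\<in>hcarrier H. \<forall>b\<in>hcarrier K. \<forall>b'\<in>hcarrier K. F a (hadd K b b') = F a b + F a b') \<and>
     (\<forall>c. \<forall>a\<in>hcarrier H. \<forall>b\<in>hcarrier K. F (hscale H c a) b = cnj c * F a b) \<and>
     (\<forall>c. \<forall>a\<in>hcarrier H. \<forall>b\<in>hcarrier K. F a (hscale K c b) = cnj c * F a b) \<and>
     (\<exists>C. \<forall>a\<in>hcarrier H. \<forall>b\<in>hcarrier K. cmod (F a b) \<le> C * hnorm H a * hnorm K b)"

definition tensor :: "'a hspace \<Rightarrow> 'b hspace \<Rightarrow> ('a \<Rightarrow> 'b \<Rightarrow> complex) hspace" where
  "tensor H K = \<lparr>
     hcarrier = {F. conj_bilinear_form H K F \<and>
       (\<lambda>(a, b). (cmod (F a b))\<^sup>2) summable_on (some_onb H \<times> some_onb K)},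
     hzero = (\<lambda>a b. 0),
     hadd = (\<lambda>F G a b. F a b + G a b),
     hscale = (\<lambda>c F a b. c * F a b),
     hinner = (\<lambda>F G. infsum (\<lambda>(a, b). F a b * cnj (G a b)) (some_onb H \<times> some_onb K))\<rparr>"

definition tensor_elem :: "'a hspace \<Rightarrow> 'b hspace \<Rightarrow> 'a \<Rightarrow> 'b \<Rightarrow> 'a \<Rightarrow> 'b \<Rightarrow> complex" where
  "tensor_elem H K x y = (\<lambda>a b.
     if a \<in> hcarrier H \<and> b \<in> hcarrier K then hinner H x a * hinner K y b else 0)"

text \<open>The bounded linear map \<open>H \<otimes> K \<rightarrow> L\<close> determined by \<open>x \<otimes> y \<mapsto> B x y\<close>.\<close>

definition tensor_lift ::
    "'a hspace \<Rightarrow> 'b hspace \<Rightarrow> 'c hspace \<Rightarrow> ('a \<Rightarrow> 'b \<Rightarrow> 'c) \<Rightarrow> ('a \<Rightarrow> 'b \<Rightarrow> complex) \<Rightarrow> 'c" where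
  "tensor_lift H K L B = (THE T.
     T \<in> extensional (hcarrier (tensor H K)) \<and>
     hbounded_linear (tensor H K) L T \<and>
     (\<forall>x\<in>hcarrier H. \<forall>y\<in>hcarrier K. T (tensor_elem H K x y) = B x y))"

text \<open>\<open>S \<otimes> T\<close> for \<open>S\<close> from \<open>H\<close> to \<open>H'\<close> and \<open>T\<close> from \<open>K\<close> to \<open>K'\<close>.\<close>

definition tensor_map ::
    "'a hspace \<Rightarrow> 'b hspace \<Rightarrow> 'c hspace \<Rightarrow> 'd hspace \<Rightarrow> ('a \<Rightarrow> 'c) \<Rightarrow> ('b \<Rightarrow> 'd) \<Rightarrow>
      ('a \<Rightarrow> 'b \<Rightarrow> complex) \<Rightarrow> ('c \<Rightarrow> 'd \<Rightarrow> complex)" where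
  "tensor_map H K H' K' S T =
     tensor_lift H K (tensor H' K') (\<lambda>x y. tensor_elem H' K' (S x) (T y))"

text \<open>The canonical identification of \<open>(H \<otimes> K) \<otimes> L\<close> with \<open>H \<otimes> (K \<otimes> L)\<close>.\<close>

definition tensor_assoc ::
    "'a hspace \<Rightarrow> 'b hspace \<Rightarrow> 'c hspace \<Rightarrow>
      (('a \<Rightarrow> 'b \<Rightarrow> complex) \<Rightarrow> 'c \<Rightarrow> complex) \<Rightarrow> ('a \<Rightarrow> ('b \<Rightarrow> 'c \<Rightarrow> complex) \<Rightarrow> complex)" where
  "tensor_assoc H K L =
     tensor_lift (tensor H K) L (tensor H (tensor K L))
       (\<lambda>w z. tensor_lift H K (tensor H (tensor K L))
          (\<lambda>x y. tensor_elem H (tensor K L) x (tensor_elem K L y z)) w)"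

section \<open>Super product systems\<close>

text \<open>A Borel space is represented by a value of type \<open>measure\<close>, of which only \<open>space\<close> and \<open>sets\<close>
  are used.\<close>

definition standard_borel :: "'a measure \<Rightarrow> bool" where
  "standard_borel X \<longleftrightarrow> (\<exists>T. topspace T = space X \<and>
     completely_metrizable_space T \<and> second_countable T \<and>
     sets X = sigma_sets (topspace T) {V. openin T V})"

text \<open>The measurability requirement. The last clause replaces Arveson's axiom that the family is
  Borel isomorphic to a trivial one \<open>(0,\<infinity>) \<times> H\<^sub>0\<close>, which forces the fibres to be of constant
  dimension; it is the usual requirement on a measurable field of Hilbert spaces that there be
  a sequence of measurable sections which is total in every fibre.\<close>

definition compatible_borel_structure ::
    "(real \<Rightarrow> 'a hspace) \<Rightarrow> (real \<Rightarrow> real \<Rightarrow> ('a \<Rightarrow> 'a \<Rightarrow> complex) \<Rightarrow> 'a) \<Rightarrow> (real \<times> 'a) measure \<Rightarrow> bool"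
  where
  "compatible_borel_structure H U X \<longleftrightarrow>
     space X = (SIGMA t:{0<..}. hcarrier (H t)) \<and>
     standard_borel X \<and>
     fst \<in> X \<rightarrow>\<^sub>M borel \<and>
     (\<lambda>((t, x), (_, y)). (t, hadd (H t) x y))
       \<in> restrict_space (X \<Otimes>\<^sub>M X) {(v, w). fst v = fst w} \<rightarrow>\<^sub>M X \<and>
     (\<lambda>(c, (t, x)). (t, hscale (H t) c x)) \<in> borel \<Otimes>\<^sub>M X \<rightarrow>\<^sub>M X \<and>
     (\<lambda>((t, x), (_, y)). hinner (H t) x y)
       \<in> restrict_space (X \<Otimes>\<^sub>M X) {(v, w). fst v = fst w} \<rightarrow>\<^sub>M borel \<and>
     (\<lambda>((s, x), (t, y)). (s + t, U s t (tensor_elem (H s) (H t) x y))) \<in> X \<Otimes>\<^sub>M X \<rightarrow>\<^sub>M X \<and>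
     (\<exists>e :: nat \<Rightarrow> real \<Rightarrow> 'a.
        (\<forall>n. (\<lambda>t. (t, e n t)) \<in> restrict_space borel {0<..} \<rightarrow>\<^sub>M X) \<and>
        (\<forall>t>0. \<forall>x\<in>hcarrier (H t). (\<forall>n. hinner (H t) x (e n t) = 0) \<longrightarrow> x = hzero (H t)))"

locale super_product_system =
  fixes H :: "real \<Rightarrow> 'a hspace"
    and U :: "real \<Rightarrow> real \<Rightarrow> ('a \<Rightarrow> 'a \<Rightarrow> complex) \<Rightarrow> 'a"
  assumes fibres: "t > 0 \<Longrightarrow> separable_hilbert_space (H t)"
    and isometries: "\<lbrakk>s > 0; t > 0\<rbrakk> \<Longrightarrow> hisometry (tensor (H s) (H t)) (H (s + t)) (U s t)"
    and associativity:
      "\<lbrakk>r > 0; s > 0; t > 0; w \<in> hcarrier (tensor (tensor (H r) (H s)) (H t))\<rbrakk> \<Longrightarrow>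
       U r (s + t)
         (tensor_map (H r) (tensor (H s) (H t)) (H r) (H (s + t)) id (U s t)
           (tensor_assoc (H r) (H s) (H t) w)) =
       U (r + s) t
         (tensor_map (tensor (H r) (H s)) (H t) (H (r + s)) (H t) (U r s) id w)"
    and measurability: "\<exists>X. compatible_borel_structure H U X"

section \<open>The super product system of an \<open>E\<^sub>0\<close>-semigroup\<close>

definition intertwiner_space ::
    "('h::complex_hilbert \<Rightarrow> 'h) set \<Rightarrow> 'h \<Rightarrow> (real \<Rightarrow> ('h \<Rightarrow> 'h) \<Rightarrow> ('h \<Rightarrow> 'h)) \<Rightarrow>
      real \<Rightarrow> ('h \<Rightarrow> 'h) hspace" where
  "intertwiner_space M \<Omega> \<alpha> t = \<lparr>
     hcarrier = intertwiners M \<alpha> t \<inter> intertwiners (commutant M) (complementary M \<Omega> \<alpha>) t,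
     hzero = (\<lambda>v. 0),
     hadd = (\<lambda>S T v. S v + T v),
     hscale = (\<lambda>c T v. c *\<^sub>C T v),
     hinner = (\<lambda>S T. THE c. cadj T \<circ> S = (\<lambda>v. c *\<^sub>C v))\<rparr>"

definition intertwiner_mult ::
    "('h::complex_hilbert \<Rightarrow> 'h) set \<Rightarrow> 'h \<Rightarrow> (real \<Rightarrow> ('h \<Rightarrow> 'h) \<Rightarrow> ('h \<Rightarrow> 'h)) \<Rightarrow>
      real \<Rightarrow> real \<Rightarrow> (('h \<Rightarrow> 'h) \<Rightarrow> ('h \<Rightarrow> 'h) \<Rightarrow> complex) \<Rightarrow> ('h \<Rightarrow> 'h)" where
  "intertwiner_mult M \<Omega> \<alpha> s t =
     tensor_lift (intertwiner_space M \<Omega> \<alpha> s) (intertwiner_space M \<Omega> \<alpha> t)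
       (intertwiner_space M \<Omega> \<alpha> (s + t)) (\<lambda>X Y. X \<circ> Y)"

end

theory Submission
  imports Defs "HOL-Library.Diagonal_Subsequence"
begin

text \<open>If \<open>S\<close> and \<open>T\<close> lie in the fibre at \<open>t\<close>, then \<open>T\<^sup>*S = \<langle>S \<Omega>, T \<Omega>\<rangle>\<close>. Hence \<open>S \<mapsto> S \<Omega>\<close> embeds
  the fibre isometrically into \<open>L\<^sup>2(M)\<close>, every \<open>S\<close> is \<open>\<parallel>S \<Omega>\<parallel>\<close> times an isometry, and multiplication
  preserves inner products of elementary tensors. Endomorphisms are contractive, so
  \<open>(t, \<xi>) \<mapsto> \<alpha>\<^sub>t(m) \<xi>\<close> is jointly continuous, and limits of intertwiners along converging times are
  intertwiners. Therefore the pairs \<open>(t, S \<Omega>)\<close> form a closed subset of \<open>(0,\<infinity>) \<times> L\<^sup>2(M)\<close>, from which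
  the total space takes its Borel structure. The same argument for weak limits shows that the norm
  of the projection of a fixed vector to the fibre is upper semicontinuous in \<open>t\<close>; by polarisation
  these projections are measurable sections, and a dense sequence of vectors gives a total family.\<close>

section \<open>Bounded functionals and orthonormal bases\<close>

text \<open>Fibres vary with a real parameter and so are records, not types: Riesz vectors, bases
  and orthogonal series are developed for explicit carriers, with sums seen through bounded
  functionals. Tensor lifts are definite descriptions, so each use rests on existence and
  uniqueness. Existence is shown for maps of pairs that preserve inner products up to a factor
  \<open>k\<close>; values of \<open>k\<close> other than 1 come from the associator, whose inner
  lift with third factor \<open>z\<close> fixed scales inner products by the squared norm of
  \<open>z\<close>. The semigroup is only assumed weakly continuous along orbits. Strong continuity
  follows because the squared norm of an orbit vector is a matrix coefficient of the orbit of
  \<open>cadj m \<circ> m\<close>. Joint continuity rests on a bound on \<open>\<alpha> t m\<close>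
  uniform in \<open>t\<close>, obtained from normality. Strong limits of intertwiners matter beyond
  weak ones: a product is recorded by its value \<open>X (Y \<Omega>)\<close>, so measurability of
  multiplication evaluates \<open>X\<close> away from \<Omega>. Those limits exist first at vectors
  \<open>m \<Omega>\<close>, where the intertwining relation reduces them to the limit at
  \<Omega>.\<close>

definition hfunctional :: "'a hspace \<Rightarrow> ('a \<Rightarrow> complex) \<Rightarrow> bool" where
  "hfunctional H \<phi> \<longleftrightarrow>
     (\<forall>x\<in>hcarrier H. \<forall>y\<in>hcarrier H. \<phi> (hadd H x y) = \<phi> x + \<phi> y) \<and>
     (\<forall>c. \<forall>x\<in>hcarrier H. \<phi> (hscale H c x) = c * \<phi> x) \<and>
     (\<exists>C. \<forall>x\<in>hcarrier H. cmod (\<phi> x) \<le> C * hnorm H x)"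

text \<open>No finite sum of nonnegative terms exceeds the total, so a finite set within
  \<open>e\<close> of the total leaves less than \<open>e\<close> for any disjoint finite set. This
  Cauchy criterion drives \<open>orthogonal_series\<close>.\<close>

lemma nonneg_summable_on_tail:
  fixes f :: "'i \<Rightarrow> real"
  assumes "f summable_on I" and "\<And>i. i \<in> I \<Longrightarrow> 0 \<le> f i" and "e > 0"
  obtains A where "finite A" "A \<subseteq> I"
    "\<And>B. \<lbrakk>finite B; B \<subseteq> I; B \<inter> A = {}\<rbrakk> \<Longrightarrow> sum f B < e"
proof -
  from assms(1) obtain S where S: "(f has_sum S) I"
    by (auto simp: summable_on_def)
  obtain A where A: "finite A" "A \<subseteq> I" "dist (sum f A) S < e"
    using has_sum_finite_approximation[OF S, of "e/2"] assms(3)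
    by (metis half_gt_zero le_less_trans field_sum_of_halves less_add_same_cancel1)
  show thesis
  proof (rule that[OF A(1,2)])
    fix B assume B: "finite B" "B \<subseteq> I" "B \<inter> A = {}"
    have "sum f (B \<union> A) \<le> S"
      by (rule finite_sum_le_has_sum[OF S]) (use A B assms(2) in auto)
    moreover have "sum f (B \<union> A) = sum f B + sum f A"
      using A B by (simp add: sum.union_disjoint)
    moreover have "sum f A \<le> S"
      by (rule finite_sum_le_has_sum[OF S]) (use A assms(2) in auto)
    ultimately show "sum f B < e"
      using A(3) by (simp add: dist_real_def)
  qed
qed

section \<open>Inner product geometry, orthogonal series and bases on an explicit carrier\<close>

context hilbert_space
begin

abbreviation hsub :: "'a \<Rightarrow> 'a \<Rightarrow> 'a" where
  "hsub x y \<equiv> hadd H x (hscale H (- 1) y)"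

lemma sub_closed: "\<lbrakk>x \<in> hcarrier H; y \<in> hcarrier H\<rbrakk> \<Longrightarrow> hsub x y \<in> hcarrier H"
  by (simp add: add_closed scale_closed)

lemma inner_add_right:
  assumes "x \<in> hcarrier H" "y \<in> hcarrier H" "z \<in> hcarrier H"
  shows "hinner H x (hadd H y z) = hinner H x y + hinner H x z"
  using inner_commute[of x "hadd H y z"] inner_commute[of x y] inner_commute[of x z]
    inner_add[of y z x] assms add_closed by simp

lemma inner_scale_right:
  assumes "x \<in> hcarrier H" "y \<in> hcarrier H"
  shows "hinner H x (hscale H c y) = cnj c * hinner H x y"
  using inner_commute[of x "hscale H c y"] inner_commute[of x y]
    inner_scale[of y x c] assms scale_closed by simp

lemma inner_sub_left:
  assumes "x \<in> hcarrier H" "y \<in> hcarrier H" "z \<in> hcarrier H"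
  shows "hinner H (hsub x y) z = hinner H x z - hinner H y z"
  using assms by (simp add: inner_add inner_scale scale_closed)

lemma inner_sub_right:
  assumes "x \<in> hcarrier H" "y \<in> hcarrier H" "z \<in> hcarrier H"
  shows "hinner H z (hsub x y) = hinner H z x - hinner H z y"
  using assms by (simp add: inner_add_right inner_scale_right scale_closed)

lemma scale_zero: "x \<in> hcarrier H \<Longrightarrow> hscale H 0 x = hzero H"
  using scale_add_left[of x 1 "-1"] add_inverse[of x] scale_one[of x] by simp

lemma inner_zero_left: "x \<in> hcarrier H \<Longrightarrow> hinner H (hzero H) x = 0"
  using inner_scale[of x x 0] scale_zero by simp

lemma inner_zero_right: "x \<in> hcarrier H \<Longrightarrow> hinner H x (hzero H) = 0"
  using inner_scale_right[of x x 0] scale_zero by simp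

lemma inner_self: "x \<in> hcarrier H \<Longrightarrow> hinner H x x = complex_of_real ((hnorm H x)\<^sup>2)"
  using inner_commute[of x x] inner_nonneg[of x]
  by (simp add: hnorm_def complex_eq_iff)

lemma norm_nonneg: "x \<in> hcarrier H \<Longrightarrow> 0 \<le> hnorm H x"
  using inner_nonneg by (simp add: hnorm_def)

lemma norm_eq_zero: "\<lbrakk>x \<in> hcarrier H; hnorm H x = 0\<rbrakk> \<Longrightarrow> x = hzero H"
  using inner_eq_zero inner_self by simp

lemma norm_zero: "hnorm H (hzero H) = 0"
  using inner_zero_left[OF zero_closed] by (simp add: hnorm_def)

lemma norm_scale:
  assumes "x \<in> hcarrier H" shows "hnorm H (hscale H c x) = cmod c * hnorm H x"
proof -
  have "hinner H (hscale H c x) (hscale H c x) = (c * cnj c) * hinner H x x"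
    using assms by (simp add: inner_scale inner_scale_right scale_closed)
  also have "\<dots> = complex_of_real ((cmod c * hnorm H x)\<^sup>2)"
    unfolding inner_self[OF assms] complex_norm_square[symmetric]
    by (simp add: power_mult_distrib)
  finally show ?thesis
    using norm_nonneg[OF assms] by (simp add: hnorm_def real_sqrt_mult)
qed

lemma eq_of_sub_zero:
  assumes "x \<in> hcarrier H" "y \<in> hcarrier H" "hsub x y = hzero H"
  shows "x = y"
proof -
  have "hadd H (hsub x y) y = hadd H x (hadd H (hscale H (-1) y) y)"
    by (rule add_assoc) (use assms in \<open>simp_all add: scale_closed\<close>)
  also have "hadd H (hscale H (-1) y) y = hzero H"
    using add_commute[OF assms(2) scale_closed[OF assms(2)]] add_inverse[OF assms(2)] by simp
  finally show ?thesis
    using add_commute[OF assms(2) zero_closed] add_zero assms by simp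
qed

lemma inner_ext:
  assumes "x \<in> hcarrier H" "y \<in> hcarrier H"
    and "\<And>z. z \<in> hcarrier H \<Longrightarrow> hinner H x z = hinner H y z"
  shows "x = y"
  by (rule eq_of_sub_zero[OF assms(1,2)], rule inner_eq_zero)
    (use assms in \<open>simp_all add: inner_sub_left sub_closed\<close>)

lemma dist_commute:
  assumes "x \<in> hcarrier H" "y \<in> hcarrier H" shows "hdist H x y = hdist H y x"
proof -
  have "hinner H (hsub x y) (hsub x y) = hinner H (hsub y x) (hsub y x)"
    using assms by (simp add: inner_sub_left inner_sub_right sub_closed)
  then show ?thesis by (simp add: hdist_def hnorm_def)
qed

text \<open>All terms in the squared norm of the difference are one real number, and they cancel.
  Vectors can thus be identified by inner products alone, which is how linearity and values of lifts
  are checked later.\<close>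

lemma eq_of_inner_eq:
  assumes "x \<in> hcarrier H" "y \<in> hcarrier H"
    and "hinner H x y = hinner H x x" "hinner H y y = hinner H x x"
  shows "x = y"
proof (rule eq_of_sub_zero[OF assms(1,2)], rule inner_eq_zero)
  have "hinner H y x = hinner H x x"
    using inner_commute[of y x] inner_self[of x] assms by simp
  then show "hinner H (hsub x y) (hsub x y) = 0"
    using assms by (simp add: inner_sub_left inner_sub_right sub_closed)
qed (use assms sub_closed in simp)

lemma Cauchy_Schwarz:
  assumes x: "x \<in> hcarrier H" and y: "y \<in> hcarrier H"
  shows "cmod (hinner H x y) \<le> hnorm H x * hnorm H y"
proof (cases "hnorm H y = 0")
  case True
  then have "y = hzero H" by (rule norm_eq_zero[OF y])
  then show ?thesis using inner_zero_right[OF x] norm_zero by simp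
next
  case False
  then have pos: "(hnorm H y)\<^sup>2 > 0" by simp
  \<comment> \<open>The coefficient of the orthogonal projection onto \<open>y\<close>:
    \<open>?z\<close> is the component of \<open>x\<close> orthogonal to \<open>y\<close>, and
    nonnegativity of its squared norm is the inequality.\<close>
  define c where "c = hinner H x y / complex_of_real ((hnorm H y)\<^sup>2)"
  let ?z = "hadd H x (hscale H (- c) y)"
  have 1: "hinner H ?z ?z = hinner H x x - cnj c * hinner H x y - c * hinner H y x
      + c * cnj c * hinner H y y"
    using x y by (simp add: inner_add inner_add_right inner_scale inner_scale_right
        add_closed scale_closed algebra_simps)
  have "cnj c * hinner H y y = hinner H y x"
    unfolding inner_self[OF y] inner_commute[OF y x] c_def using False
    by (simp add: power2_eq_square)
  then have 2: "c * cnj c * hinner H y y = c * hinner H y x"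
    by (simp only: mult.assoc)
  have 3: "cnj c * hinner H x y = complex_of_real ((cmod (hinner H x y))\<^sup>2 / (hnorm H y)\<^sup>2)"
    unfolding c_def of_real_divide complex_norm_square by (simp add: mult.commute)
  have "hinner H ?z ?z = hinner H x x - cnj c * hinner H x y"
    unfolding 1 2 by (rule diff_add_cancel)
  then have "hinner H ?z ?z =
      complex_of_real ((hnorm H x)\<^sup>2 - (cmod (hinner H x y))\<^sup>2 / (hnorm H y)\<^sup>2)"
    unfolding 3 by (simp only: inner_self[OF x] of_real_diff)
  then have "0 \<le> (hnorm H x)\<^sup>2 - (cmod (hinner H x y))\<^sup>2 / (hnorm H y)\<^sup>2"
    using inner_nonneg[OF add_closed[OF x scale_closed[OF y]], of "- c"]
    by (simp only: Re_complex_of_real)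
  then have "(cmod (hinner H x y))\<^sup>2 \<le> (hnorm H x * hnorm H y)\<^sup>2"
    using pos by (simp add: power_mult_distrib pos_divide_le_eq)
  then show ?thesis
    by (rule power2_le_imp_le) (use norm_nonneg[OF x] norm_nonneg[OF y] in simp)
qed

lemma hfunctional_inner: "y \<in> hcarrier H \<Longrightarrow> hfunctional H (\<lambda>x. hinner H x y)"
  unfolding hfunctional_def
  by (auto simp: inner_add inner_scale mult.commute intro!: exI[of _ "hnorm H y"])
    (metis Cauchy_Schwarz mult.commute)

lemma hfunctional_sub:
  "\<lbrakk>hfunctional H \<phi>; x \<in> hcarrier H; y \<in> hcarrier H\<rbrakk> \<Longrightarrow> \<phi> (hsub x y) = \<phi> x - \<phi> y"
  by (simp add: hfunctional_def scale_closed)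

lemma hfunctional_zero: "hfunctional H \<phi> \<Longrightarrow> \<phi> (hzero H) = 0"
  using scale_zero[OF zero_closed] zero_closed unfolding hfunctional_def
  by (metis mult_zero_left)

lemma hfunctional_bound:
  assumes "hfunctional H \<phi>"
  obtains C where "C > 0" "\<And>x. x \<in> hcarrier H \<Longrightarrow> cmod (\<phi> x) \<le> C * hnorm H x"
proof -
  have "\<exists>C. \<forall>x\<in>hcarrier H. cmod (\<phi> x) \<le> C * hnorm H x"
    using assms by (simp add: hfunctional_def)
  then obtain C where C: "\<forall>x\<in>hcarrier H. cmod (\<phi> x) \<le> C * hnorm H x" ..
  show thesis
  proof (rule that[of "\<bar>C\<bar> + 1"])
    fix x assume x: "x \<in> hcarrier H"
    have "C * hnorm H x \<le> (\<bar>C\<bar> + 1) * hnorm H x"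
      by (rule mult_right_mono) (use norm_nonneg[OF x] in auto)
    then show "cmod (\<phi> x) \<le> (\<bar>C\<bar> + 1) * hnorm H x" using C x by (meson order_trans)
  qed simp
qed

text \<open>Addition in \<open>H\<close> is a record field, so a combination is described by what
  bounded functionals see of it; this determines the vector.\<close>

lemma finite_combination:
  assumes "finite A" and "\<And>i. i \<in> A \<Longrightarrow> u i \<in> hcarrier H"
  shows "\<exists>x\<in>hcarrier H. \<forall>\<phi>. hfunctional H \<phi> \<longrightarrow> \<phi> x = (\<Sum>i\<in>A. c i * \<phi> (u i))"
  using assms
proof (induction A rule: finite_induct)
  case empty
  then show ?case using hfunctional_zero zero_closed by auto
next
  case (insert i A)
  then obtain x where x: "x \<in> hcarrier H"
    "\<And>\<phi>. hfunctional H \<phi> \<Longrightarrow> \<phi> x = (\<Sum>i\<in>A. c i * \<phi> (u i))" by auto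
  have u: "u i \<in> hcarrier H" using insert by simp
  have "\<phi> (hadd H (hscale H (c i) (u i)) x) = (\<Sum>i\<in>insert i A. c i * \<phi> (u i))"
    if "hfunctional H \<phi>" for \<phi>
    using that x u insert(1,2) scale_closed[OF u] by (simp add: hfunctional_def)
  then show ?case using x u by (meson add_closed scale_closed)
qed

lemma norm_combination:
  assumes u: "\<And>i. i \<in> A \<Longrightarrow> u i \<in> hcarrier H"
    and orth: "\<And>i j. \<lbrakk>i \<in> A; j \<in> A\<rbrakk> \<Longrightarrow> hinner H (u i) (u j) = (if i = j then complex_of_real k else 0)"
    and fin: "finite A" and x: "x \<in> hcarrier H"
    and eq: "\<And>y. y \<in> hcarrier H \<Longrightarrow> hinner H x y = (\<Sum>i\<in>A. c i * hinner H (u i) y)"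
  shows "(hnorm H x)\<^sup>2 = k * (\<Sum>i\<in>A. (cmod (c i))\<^sup>2)"
proof -
  have xu: "hinner H (u i) x = cnj (c i) * k" if "i \<in> A" for i
  proof -
    have "hinner H x (u i) = (\<Sum>j\<in>A. if j = i then c i * k else 0)"
      unfolding eq[OF u[OF that]] by (rule sum.cong) (use orth that in auto)
    also have "\<dots> = c i * k" using fin that by simp
    finally show ?thesis using inner_commute[OF u[OF that] x] by simp
  qed
  have "complex_of_real ((hnorm H x)\<^sup>2) = (\<Sum>i\<in>A. c i * (cnj (c i) * k))"
    unfolding inner_self[OF x, symmetric] eq[OF x] by (rule sum.cong) (simp_all add: xu)
  also have "\<dots> = (\<Sum>i\<in>A. complex_of_real (k * (cmod (c i))\<^sup>2))"
    by (rule sum.cong) (simp_all only: of_real_mult complex_norm_square mult_ac)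
  also have "\<dots> = complex_of_real (k * (\<Sum>i\<in>A. (cmod (c i))\<^sup>2))"
    by (simp add: sum_distrib_left)
  finally show ?thesis by (simp only: of_real_eq_iff)
qed


text \<open>Riesz-Fischer: for orthogonal vectors of equal length, squared distances of nested
  partial sums are \<open>k\<close> times tails of the series of squares. Convergence is asserted
  under each bounded functional, as an unordered sum over an arbitrary index set. A general
  \<open>k\<close>, possibly 0, is kept for \<open>isometric_lift\<close>.\<close>

lemma orthogonal_series:
  assumes u: "\<And>i. i \<in> I \<Longrightarrow> u i \<in> hcarrier H"
    and orth: "\<And>i j. \<lbrakk>i \<in> I; j \<in> I\<rbrakk> \<Longrightarrow>
      hinner H (u i) (u j) = (if i = j then complex_of_real k else 0)"
    and k: "0 \<le> k" and c: "(\<lambda>i. (cmod (c i))\<^sup>2) summable_on I"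
  shows "\<exists>x\<in>hcarrier H. \<forall>\<phi>. hfunctional H \<phi> \<longrightarrow> ((\<lambda>i. c i * \<phi> (u i)) has_sum \<phi> x) I"
proof -
  have "\<exists>x. x \<in> hcarrier H \<and> (\<forall>\<phi>. hfunctional H \<phi> \<longrightarrow> \<phi> x = (\<Sum>i\<in>A. c i * \<phi> (u i)))"
    if "finite A" "A \<subseteq> I" for A
    using finite_combination[of A u c] that u by blast
  then obtain s where s: "\<And>A. \<lbrakk>finite A; A \<subseteq> I\<rbrakk> \<Longrightarrow> s A \<in> hcarrier H"
    and s_eq: "\<And>A \<phi>. \<lbrakk>finite A; A \<subseteq> I; hfunctional H \<phi>\<rbrakk> \<Longrightarrow> \<phi> (s A) = (\<Sum>i\<in>A. c i * \<phi> (u i))"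
    by metis
  have dist_s: "(hdist H (s A) (s B))\<^sup>2 = k * (\<Sum>i\<in>A - B. (cmod (c i))\<^sup>2)"
    if A: "finite A" "A \<subseteq> I" and BA: "B \<subseteq> A" for A B
    unfolding hdist_def
  proof (rule norm_combination[where u = u and c = c])
    have B: "finite B" "B \<subseteq> I" using A BA by (auto intro: finite_subset)
    show "hsub (s A) (s B) \<in> hcarrier H" by (intro sub_closed s A B)
    fix y assume y: "y \<in> hcarrier H"
    show "hinner H (hsub (s A) (s B)) y = (\<Sum>i\<in>A - B. c i * hinner H (u i) y)"
      using s_eq[OF A hfunctional_inner[OF y]] s_eq[OF B hfunctional_inner[OF y]]
        inner_sub_left[OF s[OF A] s[OF B] y] A(1) BA by (simp add: sum_diff)
  qed (use A u orth in \<open>auto simp: subset_iff\<close>)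
  have "\<exists>A. finite A \<and> A \<subseteq> I \<and>
      (\<forall>B. finite B \<and> B \<subseteq> I \<and> B \<inter> A = {} \<longrightarrow> (\<Sum>i\<in>B. (cmod (c i))\<^sup>2) < 1 / real (Suc n))" for n
    using nonneg_summable_on_tail[OF c, of "1 / real (Suc n)"]
    by (metis zero_le_power2 of_nat_0_less_iff zero_less_Suc zero_less_divide_1_iff)
  then obtain A' where A': "\<And>n. finite (A' n)" "\<And>n. A' n \<subseteq> I"
    and tail': "\<And>n B. \<lbrakk>finite B; B \<subseteq> I; B \<inter> A' n = {}\<rbrakk> \<Longrightarrow> (\<Sum>i\<in>B. (cmod (c i))\<^sup>2) < 1 / real (Suc n)"
    by metis
  \<comment> \<open>Increasing unions: two stages are nested, so \<open>near\<close> compares them,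
    and each keeps the tail bound of its last member.\<close>
  define A where "A n = (\<Union>i\<le>n. A' i)" for n
  have A: "finite (A n)" "A n \<subseteq> I" for n using A' by (auto simp: A_def)
  have tail: "(\<Sum>i\<in>B. (cmod (c i))\<^sup>2) < 1 / real (Suc n)"
    if "finite B" "B \<subseteq> I" "B \<inter> A n = {}" for n B
    using that by (intro tail') (auto simp: A_def)
  have near: "(hdist H (s B) (s (A n)))\<^sup>2 \<le> k * (1 / real (Suc n))"
    if B: "finite B" "B \<subseteq> I" "A n \<subseteq> B" for B n
  proof -
    have "(hdist H (s B) (s (A n)))\<^sup>2 = k * (\<Sum>i\<in>B - A n. (cmod (c i))\<^sup>2)"
      by (rule dist_s[OF B])
    also have "\<dots> \<le> k * (1 / real (Suc n))"
      by (intro mult_left_mono less_imp_le[OF tail] k) (use B in auto)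
    finally show ?thesis .
  qed
  have small: "\<exists>N. k * (1 / real (Suc N)) < e" if "e > 0" for e :: real
  proof -
    have "(\<lambda>n. k * (1 / real (Suc n))) \<longlonglongrightarrow> k * 0"
      by (intro tendsto_intros LIMSEQ_Suc[OF lim_1_over_n])
    then have "eventually (\<lambda>n. k * (1 / real (Suc n)) < e) sequentially"
      using that by (intro order_tendstoD) auto
    then show ?thesis by (auto simp: eventually_sequentially)
  qed
  have "\<exists>N. \<forall>m\<ge>N. \<forall>n\<ge>N. hdist H (s (A m)) (s (A n)) < e" if e: "e > 0" for e
  proof -
    obtain N where N: "k * (1 / real (Suc N)) < e\<^sup>2" using small[of "e\<^sup>2"] e by auto
    have le: "hdist H (s (A m)) (s (A n)) < e" if "N \<le> n" "n \<le> m" for m n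
    proof -
      have "k * (1 / real (Suc n)) \<le> k * (1 / real (Suc N))"
        using k that by (intro mult_left_mono frac_le) auto
      then have "(hdist H (s (A m)) (s (A n)))\<^sup>2 < e\<^sup>2"
        using near[OF A, of n m] N that by (force simp: A_def)
      then show ?thesis using e by (simp add: power2_less_imp_less)
    qed
    moreover have "hdist H (s (A m)) (s (A n)) = hdist H (s (A n)) (s (A m))" for m n
      by (rule dist_commute) (intro s A)+
    ultimately show ?thesis by (metis nle_le)
  qed
  then obtain x where x: "x \<in> hcarrier H" and lim: "(\<lambda>n. hdist H (s (A n)) x) \<longlonglongrightarrow> 0"
    using complete[of "\<lambda>n. s (A n)"] s[OF A] by blast
  have "((\<lambda>i. c i * \<phi> (u i)) has_sum \<phi> x) I" if \<phi>: "hfunctional H \<phi>" for \<phi>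
    unfolding has_sum_def tendsto_iff
  proof (intro allI impI)
    fix e :: real assume e: "e > 0"
    obtain C where C: "C > 0" "\<And>x. x \<in> hcarrier H \<Longrightarrow> cmod (\<phi> x) \<le> C * hnorm H x"
      using hfunctional_bound[OF \<phi>] by blast
    have Cd: "cmod (\<phi> y - \<phi> z) \<le> C * hdist H y z" if "y \<in> hcarrier H" "z \<in> hcarrier H" for y z
      using C(2)[OF sub_closed[OF that]] hfunctional_sub[OF \<phi> that] by (simp add: hdist_def)
    \<comment> \<open>\<open>\<phi>\<close> stretches distances by at most \<open>C\<close>, so the
      error from \<open>s B\<close> to \<open>s (A n)\<close> and the error from there to
      \<open>x\<close> each contribute less than e/2.\<close>
    obtain N where N: "k * (1 / real (Suc N)) < (e / (2 * C))\<^sup>2"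
      using small[of "(e / (2 * C))\<^sup>2"] e C(1) by auto
    have "eventually (\<lambda>n. hdist H (s (A n)) x < e / (2 * C)) sequentially"
      using lim e C(1) by (intro order_tendstoD) auto
    then obtain N' where N': "\<And>n. n \<ge> N' \<Longrightarrow> hdist H (s (A n)) x < e / (2 * C)"
      by (auto simp: eventually_sequentially)
    define n where "n = max N N'"
    have "dist (\<Sum>i\<in>B. c i * \<phi> (u i)) (\<phi> x) < e" if B: "finite B" "B \<subseteq> I" "A n \<subseteq> B" for B
    proof -
      have "k * (1 / real (Suc n)) \<le> k * (1 / real (Suc N))"
        using k by (intro mult_left_mono) (auto simp: n_def frac_le)
      then have "(hdist H (s B) (s (A n)))\<^sup>2 < (e / (2 * C))\<^sup>2"
        using near[OF B] N by linarith
      then have "hdist H (s B) (s (A n)) < e / (2 * C)"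
        by (rule power2_less_imp_less) (use e C(1) in auto)
      then have "C * hdist H (s B) (s (A n)) < e / 2"
        using C(1) by (simp add: field_simps)
      moreover have "C * hdist H (s (A n)) x < e / 2"
        using N'[of n] C(1) by (simp add: n_def field_simps)
      ultimately have "cmod (\<phi> (s B) - \<phi> (s (A n))) + cmod (\<phi> (s (A n)) - \<phi> x) < e"
        using Cd[OF s[OF B(1,2)] s[OF A(1,2), of n]] Cd[OF s[OF A(1,2), of n] x] by linarith
      then have "cmod (\<phi> (s B) - \<phi> x) < e"
        using norm_triangle_ineq[of "\<phi> (s B) - \<phi> (s (A n))" "\<phi> (s (A n)) - \<phi> x"] by simp
      then show ?thesis
        using s_eq[OF B(1,2) \<phi>] by (simp add: dist_norm)
    qed
    then show "eventually (\<lambda>B. dist (\<Sum>i\<in>B. c i * \<phi> (u i)) (\<phi> x) < e) (finite_subsets_at_top I)"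
      unfolding eventually_finite_subsets_at_top using A[of n] by blast
  qed
  then show ?thesis using x by blast
qed

text \<open>Test \<open>\<phi>\<close> on the combination of a finite subset with coefficients
  \<open>cnj (\<phi> b)\<close>: its value and the squared norm of the vector are the same sum S, so
  S is at most C times the root of S, hence at most the square of C. Stated for functionals because
  Riesz vectors are built from it.\<close>

lemma Bessel:
  assumes b: "B \<subseteq> hcarrier H" "\<And>a b. \<lbrakk>a \<in> B; b \<in> B\<rbrakk> \<Longrightarrow> hinner H a b = (if a = b then 1 else 0)"
    and \<phi>: "hfunctional H \<phi>"
  shows "(\<lambda>b. (cmod (\<phi> b))\<^sup>2) summable_on B"
proof -
  obtain C where C: "C > 0" "\<And>x. x \<in> hcarrier H \<Longrightarrow> cmod (\<phi> x) \<le> C * hnorm H x"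
    using hfunctional_bound[OF \<phi>] by blast
  have "(\<Sum>b\<in>A. (cmod (\<phi> b))\<^sup>2) \<le> C\<^sup>2" if A: "finite A" "A \<subseteq> B" for A
  proof -
    define S where "S = (\<Sum>b\<in>A. (cmod (\<phi> b))\<^sup>2)"
    obtain x where x: "x \<in> hcarrier H"
      "\<And>\<psi>. hfunctional H \<psi> \<Longrightarrow> \<psi> x = (\<Sum>b\<in>A. cnj (\<phi> b) * \<psi> b)"
      using finite_combination[of A "\<lambda>b. b" "\<lambda>b. cnj (\<phi> b)"] A b by blast
    have "(hnorm H x)\<^sup>2 = 1 * (\<Sum>b\<in>A. (cmod (cnj (\<phi> b)))\<^sup>2)"
    proof (rule norm_combination[where u = "\<lambda>b. b", OF _ _ A(1) x(1)])
      show "hinner H a b = (if a = b then complex_of_real 1 else 0)" if "a \<in> A" "b \<in> A" for a b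
        using that A assms(2) by (simp add: subset_iff)
    qed (use A b x(2)[OF hfunctional_inner] in blast)+
    then have nx: "(hnorm H x)\<^sup>2 = S" by (simp add: S_def)
    have "\<phi> x = complex_of_real S"
      unfolding x(2)[OF \<phi>] S_def of_real_sum complex_norm_square by (simp add: mult.commute)
    moreover have "S \<ge> 0" by (simp add: S_def sum_nonneg)
    ultimately have "S \<le> C * hnorm H x" using C(2)[OF x(1)] by simp
    then have "S\<^sup>2 \<le> C\<^sup>2 * S"
      using power_mono[of S "C * hnorm H x" 2] \<open>S \<ge> 0\<close> nx by (simp add: power_mult_distrib)
    then have "S \<le> C\<^sup>2"
      using \<open>S \<ge> 0\<close> by (cases "S = 0") (simp_all add: power2_eq_square)
    then show ?thesis by (simp add: S_def)
  qed
  then show ?thesis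
    by (intro nonneg_bdd_above_summable_on) (auto intro!: bdd_aboveI[of _ "C\<^sup>2"])
qed

text \<open>Zorn on orthonormal sets: a nonzero vector orthogonal to a maximal one could be
  normalised and adjoined.\<close>

lemma orthonormal_basis_exists: "\<exists>B. orthonormal_basis H B"
proof -
  define \<A> where "\<A> = {B. B \<subseteq> hcarrier H \<and>
    (\<forall>a\<in>B. \<forall>b\<in>B. hinner H a b = (if a = b then 1 else 0))}"
  have "\<exists>B\<in>\<A>. \<forall>B'\<in>\<A>. B \<subseteq> B' \<longrightarrow> B' = B"
  proof (rule subset_Zorn)
    fix \<C> assume "subset.chain \<A> \<C>"
    then have C: "\<C> \<subseteq> \<A>" "\<And>B B'. \<lbrakk>B \<in> \<C>; B' \<in> \<C>\<rbrakk> \<Longrightarrow> B \<subseteq> B' \<or> B' \<subseteq> B"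
      by (auto simp: subset_chain_def)
    have "\<Union>\<C> \<in> \<A>"
      unfolding \<A>_def
    proof (intro CollectI conjI ballI)
      show "\<Union>\<C> \<subseteq> hcarrier H" using C(1) by (auto simp: \<A>_def)
      fix a b assume "a \<in> \<Union>\<C>" "b \<in> \<Union>\<C>"
      then obtain B where "B \<in> \<C>" "a \<in> B" "b \<in> B" using C(2) by blast
      then show "hinner H a b = (if a = b then 1 else 0)" using C(1) unfolding \<A>_def by blast
    qed
    then show "\<exists>U\<in>\<A>. \<forall>X\<in>\<C>. X \<subseteq> U" by blast
  qed
  then obtain B where B: "B \<in> \<A>" and max: "\<And>B'. \<lbrakk>B' \<in> \<A>; B \<subseteq> B'\<rbrakk> \<Longrightarrow> B' = B" by blast
  have "x = hzero H" if x: "x \<in> hcarrier H" and orth: "\<forall>b\<in>B. hinner H x b = 0" for x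
  proof (rule ccontr)
    assume "x \<noteq> hzero H"
    then have n: "hnorm H x \<noteq> 0" using norm_eq_zero[OF x] by blast
    define y where "y = hscale H (1 / complex_of_real (hnorm H x)) x"
    have y: "y \<in> hcarrier H" using x by (simp add: y_def scale_closed)
    have "hnorm H y = 1"
      unfolding y_def norm_scale[OF x] using n norm_nonneg[OF x] by (simp add: norm_divide)
    then have yy: "hinner H y y = 1"
      by (simp add: inner_self[OF y])
    have yb: "hinner H y b = 0" "hinner H b y = 0" if "b \<in> B" for b
    proof -
      have bc: "b \<in> hcarrier H" using that B by (auto simp: \<A>_def)
      show "hinner H y b = 0" using orth that by (simp add: y_def inner_scale[OF x bc])
      then show "hinner H b y = 0" using inner_commute[OF bc y] by simp
    qed
    have "insert y B \<in> \<A>"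
      using B y yy yb by (auto simp: \<A>_def)
    then have "y \<in> B" using max by blast
    then show False using yy yb by fastforce
  qed
  then have "orthonormal_basis H B"
    using B unfolding orthonormal_basis_def \<A>_def by blast
  then show ?thesis ..
qed

lemma some_onb: "orthonormal_basis H (some_onb H)"
  unfolding some_onb_def by (rule someI_ex) (rule orthonormal_basis_exists)

lemma onb_closed: "b \<in> some_onb H \<Longrightarrow> b \<in> hcarrier H"
  using some_onb by (auto simp: orthonormal_basis_def)

lemma onb_inner:
  "\<lbrakk>a \<in> some_onb H; b \<in> some_onb H\<rbrakk> \<Longrightarrow> hinner H a b = (if a = b then 1 else 0)"
  using some_onb by (auto simp: orthonormal_basis_def)

lemma onb_total:
  "\<lbrakk>x \<in> hcarrier H; \<And>b. b \<in> some_onb H \<Longrightarrow> hinner H x b = 0\<rbrakk> \<Longrightarrow> x = hzero H"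
  using some_onb by (auto simp: orthonormal_basis_def)

lemma onb_coefficients_summable:
  assumes x: "x \<in> hcarrier H"
  shows "(\<lambda>b. (cmod (hinner H x b))\<^sup>2) summable_on some_onb H"
proof -
  have "(\<lambda>b. (cmod (hinner H b x))\<^sup>2) summable_on some_onb H"
    by (rule Bessel[OF _ _ hfunctional_inner[OF x]]) (auto simp: onb_closed onb_inner)
  then show ?thesis
    by (rule summable_on_cong[THEN iffD1, rotated])
      (use inner_commute[OF x onb_closed] in \<open>simp add: complex_mod_cnj\<close>)
qed

lemma onb_series:
  assumes "(\<lambda>b. (cmod (c b))\<^sup>2) summable_on some_onb H"
  shows "\<exists>x\<in>hcarrier H. \<forall>\<phi>. hfunctional H \<phi> \<longrightarrow> ((\<lambda>b. c b * \<phi> b) has_sum \<phi> x) (some_onb H)"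
  using assms by (intro orthogonal_series[where k = 1]) (simp_all add: onb_closed onb_inner)

text \<open>The series with the coefficients of \<open>x\<close> sums to some \<open>y\<close>
  having those same coefficients, and totality of the basis forces \<open>y\<close> to be
  \<open>x\<close>.\<close>

lemma onb_expansion:
  assumes x: "x \<in> hcarrier H" and \<phi>: "hfunctional H \<phi>"
  shows "((\<lambda>b. hinner H x b * \<phi> b) has_sum \<phi> x) (some_onb H)"
proof -
  obtain y where y: "y \<in> hcarrier H"
    and series: "\<And>\<phi>. hfunctional H \<phi> \<Longrightarrow> ((\<lambda>b. hinner H x b * \<phi> b) has_sum \<phi> y) (some_onb H)"
    using onb_series[OF onb_coefficients_summable[OF x]] by blast
  have "hsub x y = hzero H"
  proof (rule onb_total)
    fix a assume a: "a \<in> some_onb H"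
    have "((\<lambda>b. hinner H x b * hinner H b a) has_sum hinner H x a) (some_onb H)"
      by (rule has_sum_finite_neutralI[of "{a}"]) (use a onb_inner in auto)
    then have "hinner H y a = hinner H x a"
      using series[OF hfunctional_inner[OF onb_closed[OF a]]] has_sum_unique by blast
    then show "hinner H (hsub x y) a = 0" using x y onb_closed[OF a] by (simp add: inner_sub_left)
  qed (use x y sub_closed in simp)
  then have "x = y" by (rule eq_of_sub_zero[OF x y])
  then show ?thesis using series[OF \<phi>] by simp
qed

text \<open>The representing vector is the basis series with coefficients
  \<open>cnj (\<phi> b)\<close>, square summable by \<open>Bessel\<close>; expanding
  \<open>x\<close> under \<open>\<phi>\<close> shows that it represents.\<close>

theorem Riesz_representation:
  assumes \<phi>: "hfunctional H \<phi>"
  shows "\<exists>y\<in>hcarrier H. \<forall>x\<in>hcarrier H. \<phi> x = hinner H x y"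
proof -
  have "(\<lambda>b. (cmod (cnj (\<phi> b)))\<^sup>2) summable_on some_onb H"
    using Bessel[OF _ _ \<phi>, of "some_onb H"] onb_closed onb_inner by auto
  then obtain y where y: "y \<in> hcarrier H"
    and series: "\<And>\<psi>. hfunctional H \<psi> \<Longrightarrow> ((\<lambda>b. cnj (\<phi> b) * \<psi> b) has_sum \<psi> y) (some_onb H)"
    using onb_series[of "\<lambda>b. cnj (\<phi> b)"] by blast
  have "\<phi> x = hinner H x y" if x: "x \<in> hcarrier H" for x
  proof -
    have "((\<lambda>b. cnj (cnj (\<phi> b) * hinner H b x)) has_sum cnj (hinner H y x)) (some_onb H)"
      using series[OF hfunctional_inner[OF x]] by (simp only: has_sum_cnj_iff)
    then have "((\<lambda>b. hinner H x b * \<phi> b) has_sum hinner H x y) (some_onb H)"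
      using inner_commute[OF x y]
      by (subst has_sum_cong[where g = "\<lambda>b. cnj (cnj (\<phi> b) * hinner H b x)"])
        (use inner_commute[OF x onb_closed] in simp_all)
    then show ?thesis using onb_expansion[OF x \<phi>] has_sum_unique by blast
  qed
  then show ?thesis using y by blast
qed

lemma hfunctional_eqI:
  assumes "hfunctional H \<phi>" "hfunctional H \<psi>" and x: "x \<in> hcarrier H"
    and eq: "\<And>b. b \<in> some_onb H \<Longrightarrow> \<phi> b = \<psi> b"
  shows "\<phi> x = \<psi> x"
proof -
  have "((\<lambda>b. hinner H x b * \<phi> b) has_sum \<psi> x) (some_onb H)"
    using onb_expansion[OF x assms(2)] eq by (simp cong: has_sum_cong)
  then show ?thesis using onb_expansion[OF x assms(1)] has_sum_unique by blast
qed

end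

text \<open>Transport of structure along an injective map that preserves inner products.
  \<open>limits\<close> says that the image is closed, which gives completeness of the domain. It
  serves for forms inside \<open>l2space\<close> and for fibres inside the ambient Hilbert
  space.\<close>

lemma hilbert_space_embedding:
  assumes L: "hilbert_space L"
    and closed: "hzero H \<in> hcarrier H"
      "\<And>x y. \<lbrakk>x \<in> hcarrier H; y \<in> hcarrier H\<rbrakk> \<Longrightarrow> hadd H x y \<in> hcarrier H"
      "\<And>c x. x \<in> hcarrier H \<Longrightarrow> hscale H c x \<in> hcarrier H"
    and into: "\<And>x. x \<in> hcarrier H \<Longrightarrow> \<psi> x \<in> hcarrier L"
    and inj: "\<And>x y. \<lbrakk>x \<in> hcarrier H; y \<in> hcarrier H; \<psi> x = \<psi> y\<rbrakk> \<Longrightarrow> x = y"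
    and zero: "\<psi> (hzero H) = hzero L"
    and add: "\<And>x y. \<lbrakk>x \<in> hcarrier H; y \<in> hcarrier H\<rbrakk> \<Longrightarrow> \<psi> (hadd H x y) = hadd L (\<psi> x) (\<psi> y)"
    and scale: "\<And>c x. x \<in> hcarrier H \<Longrightarrow> \<psi> (hscale H c x) = hscale L c (\<psi> x)"
    and inner: "\<And>x y. \<lbrakk>x \<in> hcarrier H; y \<in> hcarrier H\<rbrakk> \<Longrightarrow> hinner H x y = hinner L (\<psi> x) (\<psi> y)"
    and limits: "\<And>X y. \<lbrakk>\<And>n. X n \<in> hcarrier H; y \<in> hcarrier L; (\<lambda>n. hdist L (\<psi> (X n)) y) \<longlonglongrightarrow> 0\<rbrakk>
      \<Longrightarrow> y \<in> \<psi> ` hcarrier H"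
  shows "hilbert_space H"
proof -
  interpret L: hilbert_space L by fact
  have dist: "hdist H x y = hdist L (\<psi> x) (\<psi> y)" if "x \<in> hcarrier H" "y \<in> hcarrier H" for x y
    using that closed by (simp add: hdist_def hnorm_def inner add scale)
  show ?thesis
  proof
    fix x y z c d
    assume x: "x \<in> hcarrier H"
    show "hadd H x (hzero H) = x"
      by (rule inj) (use x closed in \<open>simp_all add: add zero L.add_zero into\<close>)
    show "hadd H x (hscale H (- 1) x) = hzero H"
      by (rule inj) (use x closed in \<open>simp_all add: add scale zero L.add_inverse into\<close>)
    show "hscale H (c + d) x = hadd H (hscale H c x) (hscale H d x)"
      by (rule inj) (use x closed in \<open>simp_all add: add scale L.scale_add_left into\<close>)
    show "hscale H c (hscale H d x) = hscale H (c * d) x"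
      by (rule inj) (use x closed in \<open>simp_all add: scale L.scale_scale into\<close>)
    show "hscale H 1 x = x"
      by (rule inj) (use x closed in \<open>simp_all add: scale L.scale_one into\<close>)
    show "0 \<le> Re (hinner H x x)"
      using x by (simp add: inner L.inner_nonneg into)
    show "x = hzero H" if "hinner H x x = 0"
      by (rule inj[OF x closed(1)]) (use that x zero L.inner_eq_zero into inner in simp)
    assume y: "y \<in> hcarrier H"
    show "hadd H x y = hadd H y x"
      by (rule inj) (use x y closed L.add_commute in \<open>simp_all add: add into\<close>)
    show "hscale H c (hadd H x y) = hadd H (hscale H c x) (hscale H c y)"
      by (rule inj) (use x y closed in \<open>simp_all add: add scale L.scale_add_right into\<close>)
    show "hinner H (hscale H c x) y = c * hinner H x y"
      using x y closed by (simp add: inner scale L.inner_scale into)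
    show "hinner H x y = cnj (hinner H y x)"
      using x y L.inner_commute[of "\<psi> x" "\<psi> y"] by (simp add: inner into)
    assume z: "z \<in> hcarrier H"
    show "hadd H (hadd H x y) z = hadd H x (hadd H y z)"
      by (rule inj) (use x y z closed in \<open>simp_all add: add L.add_assoc into\<close>)
    show "hinner H (hadd H x y) z = hinner H x z + hinner H y z"
      using x y z closed by (simp add: inner add L.inner_add into)
  next
    fix X :: "nat \<Rightarrow> 'b"
    assume X: "\<forall>n. X n \<in> hcarrier H"
      and Cauchy: "\<forall>e>0. \<exists>N. \<forall>m\<ge>N. \<forall>n\<ge>N. hdist H (X m) (X n) < e"
    have "\<exists>y\<in>hcarrier L. (\<lambda>n. hdist L (\<psi> (X n)) y) \<longlonglongrightarrow> 0"
      using Cauchy X by (intro L.complete) (simp_all add: into dist)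
    then obtain y where y: "y \<in> hcarrier L" "(\<lambda>n. hdist L (\<psi> (X n)) y) \<longlonglongrightarrow> 0" by blast
    then obtain x where "x \<in> hcarrier H" "y = \<psi> x"
      using limits[of X y] X by blast
    then show "\<exists>x\<in>hcarrier H. (\<lambda>n. hdist H (X n) x) \<longlonglongrightarrow> 0"
      using y(2) X dist by (intro bexI[of _ x]) simp_all
  qed (use closed in auto)
qed

section \<open>Square summable families\<close>

text \<open>Families vanish off \<open>I\<close>, so that equal vectors are equal functions and
  injectivity can be stated by equality.\<close>

definition l2space :: "'i set \<Rightarrow> ('i \<Rightarrow> complex) hspace" where
  "l2space I = \<lparr>
     hcarrier = {f. (\<forall>i. i \<notin> I \<longrightarrow> f i = 0) \<and> (\<lambda>i. (cmod (f i))\<^sup>2) summable_on I},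
     hzero = (\<lambda>i. 0),
     hadd = (\<lambda>f g i. f i + g i),
     hscale = (\<lambda>c f i. c * f i),
     hinner = (\<lambda>f g. infsum (\<lambda>i. f i * cnj (g i)) I)\<rparr>"

lemma l2space_simps:
  "hzero (l2space I) = (\<lambda>i. 0)" "hadd (l2space I) f g = (\<lambda>i. f i + g i)"
  "hscale (l2space I) c f = (\<lambda>i. c * f i)"
  "hinner (l2space I) f g = infsum (\<lambda>i. f i * cnj (g i)) I"
  by (simp_all add: l2space_def)

lemma in_l2space:
  "f \<in> hcarrier (l2space I) \<longleftrightarrow> (\<forall>i. i \<notin> I \<longrightarrow> f i = 0) \<and> (\<lambda>i. (cmod (f i))\<^sup>2) summable_on I"
  by (simp add: l2space_def)

lemma l2_product_summable:
  fixes f g :: "'i \<Rightarrow> complex"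
  assumes "(\<lambda>i. (cmod (f i))\<^sup>2) summable_on I" "(\<lambda>i. (cmod (g i))\<^sup>2) summable_on I"
  shows "(\<lambda>i. f i * cnj (g i)) summable_on I"
  by (rule abs_summable_summable, rule abs_summable_product)
    (use assms in \<open>simp_all add: norm_mult power2_eq_square\<close>)

lemma l2_add_summable:
  fixes f g :: "'i \<Rightarrow> complex"
  assumes "(\<lambda>i. (cmod (f i))\<^sup>2) summable_on I" "(\<lambda>i. (cmod (g i))\<^sup>2) summable_on I"
  shows "(\<lambda>i. (cmod (f i + g i))\<^sup>2) summable_on I"
proof (rule summable_on_comparison_test)
  show "(\<lambda>i. 2 * (cmod (f i))\<^sup>2 + 2 * (cmod (g i))\<^sup>2) summable_on I"
    using assms by (intro summable_on_add summable_on_cmult_right)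
  fix i
  have "(cmod (f i + g i))\<^sup>2 \<le> (cmod (f i) + cmod (g i))\<^sup>2"
    by (intro power_mono norm_triangle_ineq norm_ge_zero)
  also have "\<dots> \<le> 2 * (cmod (f i))\<^sup>2 + 2 * (cmod (g i))\<^sup>2"
    using zero_le_power2[of "cmod (f i) - cmod (g i)"] by (simp add: power2_sum power2_diff)
  finally show "(cmod (f i + g i))\<^sup>2 \<le> 2 * (cmod (f i))\<^sup>2 + 2 * (cmod (g i))\<^sup>2" .
qed simp

lemma l2_norm:
  assumes "(\<lambda>i. (cmod (f i))\<^sup>2) summable_on I"
  shows "hinner (l2space I) f f = complex_of_real (infsum (\<lambda>i. (cmod (f i))\<^sup>2) I)"
    and "(hnorm (l2space I) f)\<^sup>2 = infsum (\<lambda>i. (cmod (f i))\<^sup>2) I"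
proof -
  have "((\<lambda>i. complex_of_real ((cmod (f i))\<^sup>2)) has_sum complex_of_real (infsum (\<lambda>i. (cmod (f i))\<^sup>2) I)) I"
    using assms by (intro has_sum_of_real has_sum_infsum)
  then show eq: "hinner (l2space I) f f = complex_of_real (infsum (\<lambda>i. (cmod (f i))\<^sup>2) I)"
    unfolding complex_norm_square l2space_simps by (rule infsumI)
  show "(hnorm (l2space I) f)\<^sup>2 = infsum (\<lambda>i. (cmod (f i))\<^sup>2) I"
    unfolding hnorm_def eq by (simp add: infsum_nonneg)
qed

lemma l2_complete:
  assumes X: "\<And>n. X n \<in> hcarrier (l2space I)"
    and Cauchy: "\<forall>e>0. \<exists>N::nat. \<forall>m\<ge>N. \<forall>n\<ge>N. hdist (l2space I) (X m) (X n) < e"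
  shows "\<exists>f\<in>hcarrier (l2space I). (\<lambda>n. hdist (l2space I) (X n) f) \<longlonglongrightarrow> 0"
proof -
  have sub: "hadd (l2space I) f (hscale (l2space I) (- 1) g) = (\<lambda>i. f i - g i)" for f g
    by (simp add: l2space_simps)
  have X2: "(\<lambda>i. (cmod (X n i))\<^sup>2) summable_on I" for n using X by (simp add: in_l2space)
  have sub_summable: "(\<lambda>i. (cmod (X m i - X n i))\<^sup>2) summable_on I" for m n
    using l2_add_summable[OF X2[of m], of "\<lambda>i. - X n i"] X2[of n] by simp
  have fin: "(\<Sum>i\<in>A. (cmod (X m i - X n i))\<^sup>2) \<le> (hdist (l2space I) (X m) (X n))\<^sup>2"
    if "finite A" "A \<subseteq> I" for A m n
    unfolding hdist_def sub l2_norm(2)[OF sub_summable]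
    by (rule finite_sum_le_infsum[OF sub_summable that]) simp
  have "convergent (\<lambda>n. X n i)" for i
  proof (cases "i \<in> I")
    case True
    have "cmod (X m i - X n i) \<le> hdist (l2space I) (X m) (X n)" for m n
      by (rule power2_le_imp_le)
        (use fin[of "{i}" m n] True in \<open>simp_all add: hdist_def sub hnorm_def l2_norm(1)[OF sub_summable] infsum_nonneg\<close>)
    then have "Cauchy (\<lambda>n. X n i)"
      using Cauchy unfolding Cauchy_def dist_norm by (meson le_less_trans)
    then show ?thesis by (simp add: Cauchy_convergent_iff)
  next
    case False
    then have "X n i = 0" for n using X by (simp add: in_l2space)
    then show ?thesis by (simp add: convergent_const)
  qed
  then obtain f where f: "\<And>i. (\<lambda>n. X n i) \<longlonglongrightarrow> f i"
    unfolding convergent_def by metis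
  have off: "f i = 0" if "i \<notin> I" for i
  proof -
    have "(\<lambda>n. X n i) = (\<lambda>n. 0)" using X that by (auto simp: in_l2space)
    then show ?thesis using f[of i] LIMSEQ_unique tendsto_const by metis
  qed
  \<comment> \<open>Cauchy bounds pass to the limit on finite sets, where limits may be taken
    termwise; as \<open>N\<close> does not depend on \<open>A\<close>, they then bound the infinite
    sum.\<close>
  have close: "\<exists>N. \<forall>m\<ge>N. \<forall>A. finite A \<and> A \<subseteq> I \<longrightarrow> (\<Sum>i\<in>A. (cmod (X m i - f i))\<^sup>2) \<le> e\<^sup>2"
    if e: "e > 0" for e
  proof -
    obtain N where N: "\<And>m n. \<lbrakk>m \<ge> N; n \<ge> N\<rbrakk> \<Longrightarrow> hdist (l2space I) (X m) (X n) < e"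
      using Cauchy[rule_format, OF e] by blast
    have "(\<Sum>i\<in>A. (cmod (X m i - f i))\<^sup>2) \<le> e\<^sup>2" if A: "finite A" "A \<subseteq> I" and m: "m \<ge> N" for A m
    proof (rule tendsto_upperbound)
      show "(\<lambda>n. \<Sum>i\<in>A. (cmod (X m i - X n i))\<^sup>2) \<longlonglongrightarrow> (\<Sum>i\<in>A. (cmod (X m i - f i))\<^sup>2)"
        by (intro tendsto_intros f)
      have "(\<Sum>i\<in>A. (cmod (X m i - X n i))\<^sup>2) \<le> e\<^sup>2" if "n \<ge> N" for n
      proof -
        have "0 \<le> hdist (l2space I) (X m) (X n)"
          by (simp add: hdist_def sub hnorm_def l2_norm(1)[OF sub_summable] infsum_nonneg)
        then have "(hdist (l2space I) (X m) (X n))\<^sup>2 \<le> e\<^sup>2"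
          using N[OF m that] by (intro power_mono) auto
        then show ?thesis using fin[OF A, of m n] by linarith
      qed
      then show "\<forall>\<^sub>F n in sequentially. (\<Sum>i\<in>A. (cmod (X m i - X n i))\<^sup>2) \<le> e\<^sup>2"
        by (auto simp: eventually_sequentially)
    qed simp
    then show ?thesis by blast
  qed
  have diff_summable: "(\<lambda>i. (cmod (X m i - f i))\<^sup>2) summable_on I"
    if "\<forall>A. finite A \<and> A \<subseteq> I \<longrightarrow> (\<Sum>i\<in>A. (cmod (X m i - f i))\<^sup>2) \<le> e\<^sup>2" for m e
    using that by (intro nonneg_bdd_above_summable_on) (auto intro!: bdd_aboveI[of _ "e\<^sup>2"])
  have dist_le: "hdist (l2space I) (X m) f \<le> e"
    if "\<forall>A. finite A \<and> A \<subseteq> I \<longrightarrow> (\<Sum>i\<in>A. (cmod (X m i - f i))\<^sup>2) \<le> e\<^sup>2" "e > 0" for m e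
  proof -
    have "(hdist (l2space I) (X m) f)\<^sup>2 \<le> e\<^sup>2"
      unfolding hdist_def sub l2_norm(2)[OF diff_summable[OF that(1)]]
      using that(1) by (intro infsum_le_finite_sums diff_summable[OF that(1)]) auto
    then show ?thesis by (rule power2_le_imp_le) (use that(2) in auto)
  qed
  obtain N where N: "\<forall>A. finite A \<and> A \<subseteq> I \<longrightarrow> (\<Sum>i\<in>A. (cmod (X N i - f i))\<^sup>2) \<le> 1\<^sup>2"
    using close[of 1] by auto
  \<comment> \<open>\<open>f\<close> is \<open>X N\<close> minus a square summable difference, hence
    square summable.\<close>
  have "(\<lambda>i. (cmod (X N i + - (X N i - f i)))\<^sup>2) summable_on I"
    using diff_summable[OF N] by (intro l2_add_summable X2) (simp add: norm_minus_commute)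
  then have mem: "f \<in> hcarrier (l2space I)"
    using off by (simp add: in_l2space)
  have "(\<lambda>n. hdist (l2space I) (X n) f) \<longlonglongrightarrow> 0"
  proof (rule LIMSEQ_I)
    fix r :: real assume r: "r > 0"
    obtain N where N: "\<forall>m\<ge>N. \<forall>A. finite A \<and> A \<subseteq> I \<longrightarrow> (\<Sum>i\<in>A. (cmod (X m i - f i))\<^sup>2) \<le> (r/2)\<^sup>2"
      using close[of "r/2"] r by auto
    have "norm (hdist (l2space I) (X m) f - 0) < r" if "m \<ge> N" for m
    proof -
      have 1: "\<forall>A. finite A \<and> A \<subseteq> I \<longrightarrow> (\<Sum>i\<in>A. (cmod (X m i - f i))\<^sup>2) \<le> (r/2)\<^sup>2"
        using N that by blast
      have "0 \<le> hdist (l2space I) (X m) f"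
        by (simp add: hdist_def sub hnorm_def l2_norm(1)[OF diff_summable[OF 1]] infsum_nonneg)
      then show ?thesis using dist_le[OF 1] r by simp
    qed
    then show "\<exists>N. \<forall>m\<ge>N. norm (hdist (l2space I) (X m) f - 0) < r" by blast
  qed
  then show ?thesis using mem by blast
qed

lemma hilbert_space_l2space: "hilbert_space (l2space I)"
proof
  fix f g h :: "'a \<Rightarrow> complex" and c d :: complex
  assume f: "f \<in> hcarrier (l2space I)"
  then have f2: "(\<lambda>i. (cmod (f i))\<^sup>2) summable_on I" by (simp add: in_l2space)
  show "hscale (l2space I) c f \<in> hcarrier (l2space I)"
    using f summable_on_cmult_right[OF f2, of "(cmod c)\<^sup>2"]
    by (simp add: in_l2space l2space_simps norm_mult power_mult_distrib)
  show "0 \<le> Re (hinner (l2space I) f f)"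
    by (simp add: l2_norm(1)[OF f2] infsum_nonneg)
  show "f = hzero (l2space I)" if "hinner (l2space I) f f = 0"
  proof
    fix i
    have "infsum (\<lambda>i. (cmod (f i))\<^sup>2) I \<le> 0"
      using that by (simp add: l2_norm(1)[OF f2])
    then have "(cmod (f i))\<^sup>2 = 0" if "i \<in> I"
      using that by (intro nonneg_infsum_le_0D[OF _ f2]) auto
    then show "f i = hzero (l2space I) i"
      using f by (cases "i \<in> I") (auto simp: in_l2space l2space_simps)
  qed
  assume g: "g \<in> hcarrier (l2space I)"
  then have g2: "(\<lambda>i. (cmod (g i))\<^sup>2) summable_on I" by (simp add: in_l2space)
  show "hadd (l2space I) f g \<in> hcarrier (l2space I)"
    using f g l2_add_summable[OF f2 g2] by (simp add: in_l2space l2space_simps)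
  show "hinner (l2space I) (hscale (l2space I) c f) g = c * hinner (l2space I) f g"
    using l2_product_summable[OF f2 g2] by (simp add: l2space_simps mult.assoc infsum_cmult_right)
  show "hinner (l2space I) f g = cnj (hinner (l2space I) g f)"
    by (simp add: l2space_simps infsum_cnj[symmetric] mult.commute del: infsum_cnj)
  assume h: "h \<in> hcarrier (l2space I)"
  then have h2: "(\<lambda>i. (cmod (h i))\<^sup>2) summable_on I" by (simp add: in_l2space)
  show "hinner (l2space I) (hadd (l2space I) f g) h = hinner (l2space I) f h + hinner (l2space I) g h"
    using infsum_add[OF l2_product_summable[OF f2 h2] l2_product_summable[OF g2 h2]]
    by (simp add: l2space_simps distrib_right)
next
  fix X :: "nat \<Rightarrow> 'a \<Rightarrow> complex"
  assume "\<forall>n. X n \<in> hcarrier (l2space I)"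
    "\<forall>e>0. \<exists>N. \<forall>m\<ge>N. \<forall>n\<ge>N. hdist (l2space I) (X m) (X n) < e"
  then show "\<exists>f\<in>hcarrier (l2space I). (\<lambda>n. hdist (l2space I) (X n) f) \<longlonglongrightarrow> 0"
    using l2_complete by blast
qed (auto simp: in_l2space l2space_simps algebra_simps)

text \<open>Iterated summation gives the product once the double family is summable. Summable
  complex families are absolutely summable, and products of absolutely summable families are again
  so.\<close>

lemma has_sum_product:
  fixes f :: "'i \<Rightarrow> complex" and g :: "'j \<Rightarrow> complex"
  assumes f: "(f has_sum s) I" and g: "(g has_sum t) J"
  shows "((\<lambda>(i, j). f i * g j) has_sum (s * t)) (I \<times> J)"
proof (rule has_sum_SigmaI)
  show "((\<lambda>j. case (i, j) of (i, j) \<Rightarrow> f i * g j) has_sum (f i * t)) J" for i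
    using has_sum_cmult_right[OF g, of "f i"] by simp
  show "((\<lambda>i. f i * t) has_sum (s * t)) I"
    by (rule has_sum_cmult_left[OF f])
  have "(\<lambda>i. norm (f i)) summable_on I" "(\<lambda>j. norm (g j)) summable_on J"
    using f g by (auto simp flip: summable_on_iff_abs_summable_on_complex simp: summable_on_def)
  then have "(\<lambda>p. norm (case p of (i, j) \<Rightarrow> f i * g j)) summable_on I \<times> J"
    unfolding Infinite_Sum.abs_summable_on_Sigma_iff
    by (auto simp: norm_mult infsum_cmult_right' abs_mult infsum_nonneg
        intro!: summable_on_cmult_right summable_on_cmult_left)
  then show "(\<lambda>(i, j). f i * g j) summable_on I \<times> J"
    by (rule abs_summable_summable)
qed

section \<open>The tensor product of Hilbert spaces\<close>

lemma (in hilbert_space) Parseval: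
  assumes x: "x \<in> hcarrier H" and y: "y \<in> hcarrier H"
  shows "((\<lambda>b. hinner H x b * cnj (hinner H y b)) has_sum hinner H x y) (some_onb H)"
  using onb_expansion[OF x hfunctional_inner[OF y]]
  by (rule has_sum_cong[THEN iffD1, rotated]) (use inner_commute[OF y onb_closed] in simp)

lemma tensor_simps:
  "hzero (tensor H K) = (\<lambda>a b. 0)" "hadd (tensor H K) F G = (\<lambda>a b. F a b + G a b)"
  "hscale (tensor H K) c F = (\<lambda>a b. c * F a b)"
  "hinner (tensor H K) F G = infsum (\<lambda>(a, b). F a b * cnj (G a b)) (some_onb H \<times> some_onb K)"
  by (simp_all add: tensor_def)

lemma in_tensor:
  "F \<in> hcarrier (tensor H K) \<longleftrightarrow> conj_bilinear_form H K F \<and>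
     (\<lambda>(a, b). (cmod (F a b))\<^sup>2) summable_on (some_onb H \<times> some_onb K)"
  by (simp add: tensor_def)

section \<open>Hilbert-Schmidt forms and their coefficients\<close>

locale hilbert_pair = H: hilbert_space H + K: hilbert_space K
  for H :: "'a hspace" and K :: "'b hspace"
begin

abbreviation HK :: "('a \<Rightarrow> 'b \<Rightarrow> complex) hspace" where
  "HK \<equiv> tensor H K"

abbreviation onbs :: "('a \<times> 'b) set" where
  "onbs \<equiv> some_onb H \<times> some_onb K"

text \<open>The coefficients of the elementary tensor of \<open>a\<close> and \<open>b\<close> in
  the product basis, introduced ahead of the form itself because every form is recovered by pairing
  with these families.\<close>

definition elem_coeffs :: "'a \<Rightarrow> 'b \<Rightarrow> 'a \<times> 'b \<Rightarrow> complex" where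
  "elem_coeffs a b = (\<lambda>(e, f). if (e, f) \<in> onbs then hinner H a e * hinner K b f else 0)"

definition form_coeffs :: "('a \<Rightarrow> 'b \<Rightarrow> complex) \<Rightarrow> 'a \<times> 'b \<Rightarrow> complex" where
  "form_coeffs F = (\<lambda>(e, f). if (e, f) \<in> onbs then F e f else 0)"

lemma elem_coeffs_has_sum:
  assumes "a \<in> hcarrier H" "a' \<in> hcarrier H" "b \<in> hcarrier K" "b' \<in> hcarrier K"
  shows "((\<lambda>i. elem_coeffs a b i * cnj (elem_coeffs a' b' i)) has_sum
    (hinner H a a' * hinner K b b')) onbs"
  using has_sum_product[OF H.Parseval[OF assms(1,2)] K.Parseval[OF assms(3,4)]]
  by (rule has_sum_cong[THEN iffD1, rotated]) (auto simp: elem_coeffs_def)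

lemma elem_coeffs_in_l2:
  assumes "a \<in> hcarrier H" "b \<in> hcarrier K"
  shows "elem_coeffs a b \<in> hcarrier (l2space onbs)"
proof -
  have "(\<lambda>i. Re (elem_coeffs a b i * cnj (elem_coeffs a b i))) summable_on onbs"
    by (rule summable_on_Re) (use elem_coeffs_has_sum[OF assms(1,1) assms(2,2)] in \<open>auto simp: summable_on_def\<close>)
  then have "(\<lambda>i. (cmod (elem_coeffs a b i))\<^sup>2) summable_on onbs"
    unfolding complex_norm_square[symmetric] by simp
  then show ?thesis by (auto simp: in_l2space elem_coeffs_def)
qed

lemma elem_coeffs_inner:
  assumes "a \<in> hcarrier H" "a' \<in> hcarrier H" "b \<in> hcarrier K" "b' \<in> hcarrier K"
  shows "hinner (l2space onbs) (elem_coeffs a b) (elem_coeffs a' b') = hinner H a a' * hinner K b b'"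
  unfolding l2space_simps by (rule infsumI[OF elem_coeffs_has_sum[OF assms]])

lemma elem_coeffs_norm:
  assumes "a \<in> hcarrier H" "b \<in> hcarrier K"
  shows "hnorm (l2space onbs) (elem_coeffs a b) = hnorm H a * hnorm K b"
proof -
  have "hinner (l2space onbs) (elem_coeffs a b) (elem_coeffs a b) =
      complex_of_real ((hnorm H a * hnorm K b)\<^sup>2)"
    using assms by (simp add: elem_coeffs_inner H.inner_self K.inner_self power_mult_distrib)
  then show ?thesis
    unfolding hnorm_def[of "l2space onbs"]
    using H.norm_nonneg[OF assms(1)] K.norm_nonneg[OF assms(2)] by simp
qed

lemma elem_coeffs_linear:
  assumes "a \<in> hcarrier H" "a' \<in> hcarrier H" "b \<in> hcarrier K" "b' \<in> hcarrier K"
  shows "elem_coeffs (hadd H a a') b = hadd (l2space onbs) (elem_coeffs a b) (elem_coeffs a' b)"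
    and "elem_coeffs a (hadd K b b') = hadd (l2space onbs) (elem_coeffs a b) (elem_coeffs a b')"
    and "elem_coeffs (hscale H c a) b = hscale (l2space onbs) c (elem_coeffs a b)"
    and "elem_coeffs a (hscale K c b) = hscale (l2space onbs) c (elem_coeffs a b)"
  using assms
  by (auto simp: elem_coeffs_def l2space_simps H.inner_add K.inner_add H.inner_scale K.inner_scale
      H.onb_closed K.onb_closed algebra_simps)

text \<open>Forms are conjugate-linear in each slot; conjugation makes each slot linear, so that
  basis expansions of functionals apply.\<close>

lemma form_functionals:
  assumes F: "conj_bilinear_form H K F"
  shows "a \<in> hcarrier H \<Longrightarrow> hfunctional K (\<lambda>b. cnj (F a b))"
    and "b \<in> hcarrier K \<Longrightarrow> hfunctional H (\<lambda>a. cnj (F a b))"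
proof -
  have "\<exists>C. \<forall>a\<in>hcarrier H. \<forall>b\<in>hcarrier K. cmod (F a b) \<le> C * hnorm H a * hnorm K b"
    using F by (simp add: conj_bilinear_form_def)
  then obtain C where C: "\<And>a b. \<lbrakk>a \<in> hcarrier H; b \<in> hcarrier K\<rbrakk> \<Longrightarrow> cmod (F a b) \<le> C * hnorm H a * hnorm K b"
    by blast
  show "hfunctional K (\<lambda>b. cnj (F a b))" if a: "a \<in> hcarrier H"
    unfolding hfunctional_def
  proof (intro conjI exI ballI)
    fix b assume "b \<in> hcarrier K"
    then show "cmod (cnj (F a b)) \<le> (C * hnorm H a) * hnorm K b"
      using C[OF a] by simp
  qed (use F a in \<open>auto simp: conj_bilinear_form_def\<close>)
  show "hfunctional H (\<lambda>a. cnj (F a b))" if b: "b \<in> hcarrier K"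
    unfolding hfunctional_def
  proof (intro conjI exI ballI)
    fix a assume "a \<in> hcarrier H"
    then show "cmod (cnj (F a b)) \<le> (C * hnorm K b) * hnorm H a"
      using C[OF _ b] by (simp add: mult_ac)
  qed (use F b in \<open>auto simp: conj_bilinear_form_def\<close>)
qed

lemma form_off: "conj_bilinear_form H K F \<Longrightarrow> a \<notin> hcarrier H \<or> b \<notin> hcarrier K \<Longrightarrow> F a b = 0"
  by (simp add: conj_bilinear_form_def)

text \<open>One slot at a time: with a basis vector in the first slot, expansion frees the second;
  then the first is freed for arbitrary second entry.\<close>

lemma form_eqI:
  assumes F: "conj_bilinear_form H K F" and G: "conj_bilinear_form H K G"
    and eq: "form_coeffs F = form_coeffs G"
  shows "F = G"
proof (intro ext)
  fix a b
  have ef: "F e f = G e f" if "e \<in> some_onb H" "f \<in> some_onb K" for e f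
    using fun_cong[OF eq, of "(e, f)"] that by (simp add: form_coeffs_def)
  have ea: "F e b = G e b" if e: "e \<in> some_onb H" and b: "b \<in> hcarrier K" for e
    using K.hfunctional_eqI[OF form_functionals(1)[OF F H.onb_closed[OF e]]
        form_functionals(1)[OF G H.onb_closed[OF e]] b] ef[OF e] by simp
  show "F a b = G a b"
  proof (cases "a \<in> hcarrier H \<and> b \<in> hcarrier K")
    case True
    then show ?thesis
      using H.hfunctional_eqI[OF form_functionals(2)[OF F] form_functionals(2)[OF G], of b b a] ea by simp
  next
    case False
    then show ?thesis using form_off[OF F] form_off[OF G] by auto
  qed
qed

text \<open>The inverse of \<open>form_coeffs\<close>. Pairing in \<open>l2space\<close> makes
  boundedness of the form an instance of Cauchy-Schwarz.\<close>

definition form_of :: "('a \<times> 'b \<Rightarrow> complex) \<Rightarrow> 'a \<Rightarrow> 'b \<Rightarrow> complex" where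
  "form_of c = (\<lambda>a b. if a \<in> hcarrier H \<and> b \<in> hcarrier K
     then hinner (l2space onbs) c (elem_coeffs a b) else 0)"

lemma form_of_coeffs:
  assumes "c \<in> hcarrier (l2space onbs)"
  shows "form_coeffs (form_of c) = c"
proof
  fix i
  show "form_coeffs (form_of c) i = c i"
  proof (cases "i \<in> onbs")
    case True
    obtain e f where i: "i = (e, f)" by (cases i)
    have "((\<lambda>j. c j * cnj (elem_coeffs e f j)) has_sum c i) onbs"
      by (rule has_sum_finite_neutralI[of "{i}"])
        (use True i in \<open>auto simp: elem_coeffs_def H.onb_inner K.onb_inner split: if_splits\<close>)
    then have "hinner (l2space onbs) c (elem_coeffs e f) = c i"
      unfolding l2space_simps by (rule infsumI)
    then show ?thesis
      using True i H.onb_closed K.onb_closed by (simp add: form_coeffs_def form_of_def)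
  next
    case False
    then show ?thesis using assms by (auto simp: form_coeffs_def in_l2space split: prod.splits)
  qed
qed

lemma form_of_form:
  assumes c: "c \<in> hcarrier (l2space onbs)"
  shows "conj_bilinear_form H K (form_of c)"
proof -
  interpret L: hilbert_space "l2space onbs" by (rule hilbert_space_l2space)
  note mem = elem_coeffs_in_l2
  have "cmod (form_of c a b) \<le> hnorm (l2space onbs) c * hnorm H a * hnorm K b"
    if "a \<in> hcarrier H" "b \<in> hcarrier K" for a b
    using L.Cauchy_Schwarz[OF c mem[OF that]] that by (simp add: form_of_def elem_coeffs_norm mult.assoc)
  then show ?thesis
    unfolding conj_bilinear_form_def
    using c mem
    by (auto simp: form_of_def elem_coeffs_linear L.inner_add_right L.inner_scale_right
        H.add_closed K.add_closed H.scale_closed K.scale_closed)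
qed

lemma form_coeffs_in_l2:
  assumes "F \<in> hcarrier HK"
  shows "form_coeffs F \<in> hcarrier (l2space onbs)"
proof -
  have "(\<lambda>i. (cmod (form_coeffs F i))\<^sup>2) summable_on onbs
      \<longleftrightarrow> (\<lambda>(a, b). (cmod (F a b))\<^sup>2) summable_on onbs"
    by (rule summable_on_cong) (auto simp: form_coeffs_def)
  then show ?thesis using assms by (auto simp: in_tensor in_l2space form_coeffs_def)
qed

lemma form_of_in_tensor:
  assumes c: "c \<in> hcarrier (l2space onbs)"
  shows "form_of c \<in> hcarrier HK"
proof -
  have "(\<lambda>i. (cmod (form_coeffs (form_of c) i))\<^sup>2) summable_on onbs
      \<longleftrightarrow> (\<lambda>(a, b). (cmod (form_of c a b))\<^sup>2) summable_on onbs"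
    by (rule summable_on_cong) (auto simp: form_coeffs_def)
  then show ?thesis
    using c form_of_form[OF c] by (simp add: in_tensor form_of_coeffs in_l2space)
qed

lemma tensor_inner:
  "hinner HK F G = hinner (l2space onbs) (form_coeffs F) (form_coeffs G)"
  unfolding tensor_simps l2space_simps by (rule infsum_cong) (auto simp: form_coeffs_def)

text \<open>\<open>form_coeffs\<close> maps onto all of \<open>l2space\<close>, so closedness of its
  image is immediate.\<close>

lemma hilbert_space_tensor: "hilbert_space HK"
proof (rule hilbert_space_embedding[OF hilbert_space_l2space, where \<psi> = form_coeffs])
  note summ = form_coeffs_in_l2
  interpret L: hilbert_space "l2space onbs" by (rule hilbert_space_l2space)
  have coeffs: "form_coeffs (hadd HK F G) = hadd (l2space onbs) (form_coeffs F) (form_coeffs G)"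
    "form_coeffs (hscale HK c F) = hscale (l2space onbs) c (form_coeffs F)" for F G c
    by (auto simp: form_coeffs_def tensor_simps l2space_simps)
  have form_of_eq: "form_of (form_coeffs F) = F" if "F \<in> hcarrier HK" for F
    by (rule form_eqI)
      (use form_of_coeffs[OF summ[OF that]] that form_of_form[OF summ[OF that]] in \<open>auto simp: in_tensor\<close>)
  show "hzero HK \<in> hcarrier HK"
    by (auto simp: in_tensor tensor_simps conj_bilinear_form_def case_prod_unfold intro!: exI[of _ 0])
  show "hadd HK F G \<in> hcarrier HK"
    if F: "F \<in> hcarrier HK" and G: "G \<in> hcarrier HK" for F G
  proof -
    \<comment> \<open>Closure under addition, and likewise under scaling, is inherited from
      \<open>l2space\<close> by writing forms as \<open>form_of\<close> of their
      coefficients.\<close>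
    have "hadd HK (form_of (form_coeffs F)) (form_of (form_coeffs G)) =
        form_of (hadd (l2space onbs) (form_coeffs F) (form_coeffs G))"
      using summ[OF F] summ[OF G] elem_coeffs_in_l2
      by (auto simp: form_of_def tensor_simps(2) L.inner_add intro!: ext)
    then show ?thesis
      using form_of_in_tensor[OF L.add_closed[OF summ[OF F] summ[OF G]]] form_of_eq[OF F] form_of_eq[OF G] by simp
  qed
  show "hscale HK c F \<in> hcarrier HK" if F: "F \<in> hcarrier HK" for F c
  proof -
    have "hscale HK c (form_of (form_coeffs F)) =
        form_of (hscale (l2space onbs) c (form_coeffs F))"
      using summ[OF F] elem_coeffs_in_l2
      by (auto simp: form_of_def tensor_simps(3) L.inner_scale intro!: ext)
    then show ?thesis
      using form_of_in_tensor[OF L.scale_closed[OF summ[OF F]]] form_of_eq[OF F] by simp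
  qed
  show "F = G" if "F \<in> hcarrier HK" "G \<in> hcarrier HK"
    "form_coeffs F = form_coeffs G" for F G
    using that form_eqI by (auto simp: in_tensor)
  show "form_coeffs (hzero HK) = hzero (l2space onbs)"
    by (auto simp: form_coeffs_def tensor_simps l2space_simps)
  show "form_coeffs (hadd HK F G) = hadd (l2space onbs) (form_coeffs F) (form_coeffs G)" for F G
    by (rule coeffs(1))
  show "form_coeffs (hscale HK c F) = hscale (l2space onbs) c (form_coeffs F)" for c F
    by (rule coeffs(2))
  show "y \<in> form_coeffs ` hcarrier HK" if "y \<in> hcarrier (l2space onbs)" for y
    using form_of_coeffs[OF that] form_of_in_tensor[OF that] by (metis imageI)
qed (auto simp: form_coeffs_in_l2 tensor_inner)

lemma tensor_elem_coeffs:
  assumes "x \<in> hcarrier H" "y \<in> hcarrier K"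
  shows "form_coeffs (tensor_elem H K x y) = elem_coeffs x y"
    and "tensor_elem H K x y = form_of (elem_coeffs x y)"
proof -
  show "form_coeffs (tensor_elem H K x y) = elem_coeffs x y"
    by (auto simp: form_coeffs_def elem_coeffs_def tensor_elem_def H.onb_closed K.onb_closed)
  show "tensor_elem H K x y = form_of (elem_coeffs x y)"
    using assms by (auto simp: tensor_elem_def form_of_def elem_coeffs_inner intro!: ext)
qed

lemma tensor_elem_closed:
  "\<lbrakk>x \<in> hcarrier H; y \<in> hcarrier K\<rbrakk> \<Longrightarrow> tensor_elem H K x y \<in> hcarrier HK"
  by (simp add: tensor_elem_coeffs(2) form_of_in_tensor elem_coeffs_in_l2)

lemma tensor_elem_inner:
  assumes "x \<in> hcarrier H" "x' \<in> hcarrier H" "y \<in> hcarrier K" "y' \<in> hcarrier K"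
  shows "hinner HK (tensor_elem H K x y) (tensor_elem H K x' y') = hinner H x x' * hinner K y y'"
  using assms by (simp add: tensor_inner tensor_elem_coeffs(1) elem_coeffs_inner)

text \<open>Elementary tensors are the reproducing kernel of this space of forms. Hence a form
  orthogonal to all of them is zero, which is their totality.\<close>

lemma tensor_reproducing:
  assumes F: "F \<in> hcarrier HK" and "x \<in> hcarrier H" "y \<in> hcarrier K"
  shows "hinner HK F (tensor_elem H K x y) = F x y"
proof -
  have form_of_eq: "form_of (form_coeffs F) = F"
    by (rule form_eqI) (use form_of_coeffs[OF form_coeffs_in_l2[OF F]] F
        form_of_form[OF form_coeffs_in_l2[OF F]] in \<open>auto simp: in_tensor\<close>)
  have "F x y = form_of (form_coeffs F) x y"
    by (simp only: form_of_eq)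
  also have "\<dots> = hinner (l2space onbs) (form_coeffs F) (elem_coeffs x y)"
    using assms(2,3) by (simp add: form_of_def)
  finally show ?thesis using assms by (simp add: tensor_inner tensor_elem_coeffs(1))
qed

sublocale T: hilbert_space "tensor H K"
  by (rule hilbert_space_tensor)

text \<open>The Riesz vectors of the two functionals are forms, and the reproducing property turns
  agreement on elementary tensors into equality of their values.\<close>

lemma tensor_functional_eqI:
  assumes \<phi>: "hfunctional HK \<phi>" and \<psi>: "hfunctional HK \<psi>"
    and eq: "\<And>x y. \<lbrakk>x \<in> hcarrier H; y \<in> hcarrier K\<rbrakk> \<Longrightarrow>
      \<phi> (tensor_elem H K x y) = \<psi> (tensor_elem H K x y)"
    and F: "F \<in> hcarrier HK"
  shows "\<phi> F = \<psi> F"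
proof -
  obtain A B where A: "A \<in> hcarrier HK" "\<And>F. F \<in> hcarrier HK \<Longrightarrow> \<phi> F = hinner HK F A"
    and B: "B \<in> hcarrier HK" "\<And>F. F \<in> hcarrier HK \<Longrightarrow> \<psi> F = hinner HK F B"
    using T.Riesz_representation[OF \<phi>] T.Riesz_representation[OF \<psi>] by blast
  have "A x y = B x y" for x y
  proof (cases "x \<in> hcarrier H \<and> y \<in> hcarrier K")
    case True
    then have "cnj (hinner HK A (tensor_elem H K x y)) = cnj (hinner HK B (tensor_elem H K x y))"
      using eq[of x y] A B tensor_elem_closed[of x y] T.inner_commute by metis
    then show ?thesis using True tensor_reproducing A(1) B(1) by simp
  next
    case False
    then show ?thesis using A(1) B(1) form_off by (metis in_tensor)
  qed
  then have "A = B" by blast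
  then show ?thesis using A B F by simp
qed

end

subsection \<open>Maps out of a tensor product\<close>

text \<open>\<open>k\<close> multiplies inner products, so lengths scale by its square root.
  \<open>k = 1\<close> is the isometric case; tensoring with a fixed vector gives its squared norm,
  which may be 0.\<close>

definition scaled_isometry :: "real \<Rightarrow> 'a hspace \<Rightarrow> 'b hspace \<Rightarrow> ('a \<Rightarrow> 'b) \<Rightarrow> bool" where
  "scaled_isometry k H L T \<longleftrightarrow> (\<forall>x\<in>hcarrier H. T x \<in> hcarrier L) \<and>
     (\<forall>x\<in>hcarrier H. \<forall>y\<in>hcarrier H. hinner L (T x) (T y) = complex_of_real k * hinner H x y)"

lemma scaled_isometryD:
  assumes "scaled_isometry k H L T"
  shows "x \<in> hcarrier H \<Longrightarrow> T x \<in> hcarrier L"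
    and "\<lbrakk>x \<in> hcarrier H; y \<in> hcarrier H\<rbrakk> \<Longrightarrow> hinner L (T x) (T y) = complex_of_real k * hinner H x y"
  using assms by (auto simp: scaled_isometry_def)

lemma scaled_isometry_comp:
  "\<lbrakk>scaled_isometry 1 H K S; scaled_isometry 1 K L T\<rbrakk> \<Longrightarrow> scaled_isometry 1 H L (\<lambda>x. T (S x))"
  by (simp add: scaled_isometry_def)

text \<open>Linearity is automatic: \<open>\<parallel>T (x + y) - T x - T y\<parallel>\<^sup>2\<close> is determined by the inner products.\<close>

lemma scaled_isometry_linear:
  assumes H: "hilbert_space H" and L: "hilbert_space L" and T: "scaled_isometry k H L T"
  shows "hlinear H L T"
proof -
  interpret H: hilbert_space H by fact
  interpret L: hilbert_space L by fact
  note T = scaled_isometryD[OF T]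
  have "T (hadd H x y) = hadd L (T x) (T y)" if "x \<in> hcarrier H" "y \<in> hcarrier H" for x y
    by (rule L.eq_of_inner_eq)
      (use that in \<open>simp_all add: T H.add_closed L.add_closed H.inner_add H.inner_add_right
        L.inner_add L.inner_add_right algebra_simps\<close>)
  moreover have "T (hscale H c x) = hscale L c (T x)" if "x \<in> hcarrier H" for c x
    by (rule L.eq_of_inner_eq)
      (use that in \<open>simp_all add: T H.scale_closed L.scale_closed H.inner_scale H.inner_scale_right
        L.inner_scale L.inner_scale_right\<close>)
  ultimately show ?thesis using T(1) by (auto simp: hlinear_def)
qed

lemma scaled_isometry_norm:
  assumes "scaled_isometry k H L T" "x \<in> hcarrier H"
  shows "hnorm L (T x) = sqrt k * hnorm H x"
  using scaled_isometryD(2)[OF assms(1,2,2)] by (simp add: hnorm_def real_sqrt_mult)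

lemma scaled_isometry_bounded:
  assumes "hilbert_space H" "hilbert_space L" "scaled_isometry k H L T"
  shows "hbounded_linear H L T"
  unfolding hbounded_linear_def
  using scaled_isometry_linear[OF assms] scaled_isometry_norm[OF assms(3)] by auto

lemma scaled_isometry_hisometry:
  assumes "hilbert_space H" "hilbert_space L" "scaled_isometry 1 H L T"
  shows "hisometry H L T"
  unfolding hisometry_def
  using scaled_isometry_linear[OF assms] scaled_isometry_norm[OF assms(3)] by auto

lemma hfunctional_comp:
  assumes L: "hilbert_space L" and T: "hbounded_linear H L T" and \<psi>: "hfunctional L \<psi>"
  shows "hfunctional H (\<lambda>x. \<psi> (T x))"
proof -
  interpret L: hilbert_space L by fact
  obtain D where D: "D > 0" "\<And>x. x \<in> hcarrier L \<Longrightarrow> cmod (\<psi> x) \<le> D * hnorm L x"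
    using L.hfunctional_bound[OF \<psi>] by blast
  have lin: "hlinear H L T" and "\<exists>C. \<forall>x\<in>hcarrier H. hnorm L (T x) \<le> C * hnorm H x"
    using T by (auto simp: hbounded_linear_def)
  then obtain C where C: "\<And>x. x \<in> hcarrier H \<Longrightarrow> hnorm L (T x) \<le> C * hnorm H x" by blast
  have "cmod (\<psi> (T x)) \<le> (D * C) * hnorm H x" if x: "x \<in> hcarrier H" for x
  proof -
    have "cmod (\<psi> (T x)) \<le> D * hnorm L (T x)"
      using D(2) lin x by (auto simp: hlinear_def)
    also have "\<dots> \<le> D * (C * hnorm H x)"
      using C[OF x] D(1) by (intro mult_left_mono) auto
    finally show ?thesis by (simp add: mult.assoc)
  qed
  then show ?thesis
    using lin \<psi> unfolding hfunctional_def hlinear_def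
    by (intro conjI exI[of _ "D * C"]) (auto simp: Pi_iff)
qed

section \<open>Existence and uniqueness of lifts\<close>

context hilbert_pair
begin

text \<open>The uniqueness half of the description in \<open>tensor_lift\<close>. Functionals
  separate the points of \<open>L\<close>; composed with \<open>S\<close> and \<open>T\<close> they
  fall under \<open>tensor_functional_eqI\<close>.\<close>

lemma tensor_map_eqI:
  assumes L: "hilbert_space L" and S: "hbounded_linear HK L S" and T: "hbounded_linear HK L T"
    and eq: "\<And>x y. \<lbrakk>x \<in> hcarrier H; y \<in> hcarrier K\<rbrakk> \<Longrightarrow>
      S (tensor_elem H K x y) = T (tensor_elem H K x y)"
    and F: "F \<in> hcarrier HK"
  shows "S F = T F"
proof -
  interpret L: hilbert_space L by fact
  have "S F \<in> hcarrier L" "T F \<in> hcarrier L"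
    using S T F by (auto simp: hbounded_linear_def hlinear_def)
  then show ?thesis
  proof (rule L.inner_ext)
    fix z assume "z \<in> hcarrier L"
    note z = L.hfunctional_inner[OF this]
    show "hinner L (S F) z = hinner L (T F) z"
      by (rule tensor_functional_eqI[OF hfunctional_comp[OF L S z] hfunctional_comp[OF L T z] _ F])
        (simp add: eq)
  qed
qed

text \<open>Images of basis pairs are orthogonal of squared length \<open>k\<close>, so the square
  summable coefficients of \<open>F\<close> give an orthogonal series, which defines the lift. The
  inner product condition on \<open>B\<close> then carries its values from basis pairs to all
  pairs.\<close>

lemma isometric_lift:
  assumes L: "hilbert_space L" and k: "0 \<le> k"
    and B: "\<And>x y. \<lbrakk>x \<in> hcarrier H; y \<in> hcarrier K\<rbrakk> \<Longrightarrow> B x y \<in> hcarrier L"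
    and inner: "\<And>x x' y y'. \<lbrakk>x \<in> hcarrier H; x' \<in> hcarrier H; y \<in> hcarrier K; y' \<in> hcarrier K\<rbrakk> \<Longrightarrow>
      hinner L (B x y) (B x' y') = complex_of_real k * (hinner H x x' * hinner K y y')"
  shows "scaled_isometry k HK L (tensor_lift H K L B)"
    and "\<lbrakk>x \<in> hcarrier H; y \<in> hcarrier K\<rbrakk> \<Longrightarrow> tensor_lift H K L B (tensor_elem H K x y) = B x y"
proof -
  interpret L: hilbert_space L by fact
  have "\<exists>t\<in>hcarrier L. \<forall>\<phi>. hfunctional L \<phi> \<longrightarrow>
      ((\<lambda>i. F (fst i) (snd i) * \<phi> (B (fst i) (snd i))) has_sum \<phi> t) onbs"
    if "F \<in> hcarrier HK" for F
  proof (rule L.orthogonal_series[OF _ _ k])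
    fix i j assume "i \<in> onbs" "j \<in> onbs"
    then show "hinner L (B (fst i) (snd i)) (B (fst j) (snd j)) = (if i = j then complex_of_real k else 0)"
      by (auto simp: inner H.onb_closed K.onb_closed H.onb_inner K.onb_inner split: if_splits)
  qed (use that B H.onb_closed K.onb_closed in \<open>auto simp: in_tensor case_prod_unfold\<close>)
  then have "\<forall>F\<in>hcarrier HK. \<exists>t. t \<in> hcarrier L \<and> (\<forall>\<phi>. hfunctional L \<phi> \<longrightarrow>
      ((\<lambda>i. F (fst i) (snd i) * \<phi> (B (fst i) (snd i))) has_sum \<phi> t) onbs)"
    by blast
  from bchoice[OF this] obtain T where
    T: "\<And>F. F \<in> hcarrier HK \<Longrightarrow> T F \<in> hcarrier L"
    and series: "\<And>F \<phi>. \<lbrakk>F \<in> hcarrier HK; hfunctional L \<phi>\<rbrakk> \<Longrightarrow>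
      ((\<lambda>i. F (fst i) (snd i) * \<phi> (B (fst i) (snd i))) has_sum \<phi> (T F)) onbs"
    by blast
  \<comment> \<open>Pairing with \<open>B x y\<close> evaluates the form up to the factor
    \<open>k\<close>; with \<open>F\<close> elementary this yields the inner products from which
    \<open>eq_of_inner_eq\<close> identifies the lift.\<close>
  have T_B: "hinner L (T F) (B x y) = complex_of_real k * F x y"
    if F: "F \<in> hcarrier HK" and x: "x \<in> hcarrier H" and y: "y \<in> hcarrier K" for F x y
  proof -
    have "((\<lambda>i. k * (F (fst i) (snd i) * cnj (tensor_elem H K x y (fst i) (snd i)))) has_sum
        hinner L (T F) (B x y)) onbs"
      using series[OF F L.hfunctional_inner[OF B[OF x y]]]
    proof (rule has_sum_cong[THEN iffD1, rotated])
      fix i assume "i \<in> onbs"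
      then have i: "fst i \<in> hcarrier H" "snd i \<in> hcarrier K"
        using H.onb_closed K.onb_closed by auto
      then show "F (fst i) (snd i) * hinner L (B (fst i) (snd i)) (B x y) =
          k * (F (fst i) (snd i) * cnj (tensor_elem H K x y (fst i) (snd i)))"
        using x y H.inner_commute[of "fst i" x] K.inner_commute[of "snd i" y]
        by (simp add: inner tensor_elem_def)
    qed
    moreover have "((\<lambda>i. F (fst i) (snd i) * cnj (tensor_elem H K x y (fst i) (snd i))) has_sum F x y) onbs"
    proof -
      have "(\<lambda>i. form_coeffs F i * cnj (form_coeffs (tensor_elem H K x y) i)) summable_on onbs"
        using form_coeffs_in_l2[OF F] form_coeffs_in_l2[OF tensor_elem_closed[OF x y]]
        by (intro l2_product_summable) (auto simp: in_l2space)
      then have "(\<lambda>i. F (fst i) (snd i) * cnj (tensor_elem H K x y (fst i) (snd i))) summable_on onbs"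
        by (rule summable_on_cong[THEN iffD1, rotated]) (auto simp: form_coeffs_def)
      then show ?thesis
        using tensor_reproducing[OF F x y] by (simp add: tensor_simps case_prod_unfold has_sum_iff)
    qed
    then have "((\<lambda>i. k * (F (fst i) (snd i) * cnj (tensor_elem H K x y (fst i) (snd i)))) has_sum
        (k * F x y)) onbs"
      by (rule has_sum_cmult_right)
    ultimately show ?thesis using has_sum_unique by blast
  qed
  have T_T: "hinner L (T F) (T G) = complex_of_real k * hinner HK F G"
    if F: "F \<in> hcarrier HK" and G: "G \<in> hcarrier HK" for F G
  proof -
    have "((\<lambda>i. k * (F (fst i) (snd i) * cnj (G (fst i) (snd i)))) has_sum hinner L (T F) (T G)) onbs"
      using series[OF F L.hfunctional_inner[OF T[OF G]]]
    proof (rule has_sum_cong[THEN iffD1, rotated])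
      fix i assume "i \<in> onbs"
      then have i: "fst i \<in> hcarrier H" "snd i \<in> hcarrier K"
        using H.onb_closed K.onb_closed by auto
      then show "F (fst i) (snd i) * hinner L (B (fst i) (snd i)) (T G) =
          k * (F (fst i) (snd i) * cnj (G (fst i) (snd i)))"
        using L.inner_commute[OF B[OF i] T[OF G]] T_B[OF G i] by simp
    qed
    then have "hinner L (T F) (T G) = infsum (\<lambda>i. k * (F (fst i) (snd i) * cnj (G (fst i) (snd i)))) onbs"
      by (simp add: infsumI)
    then show ?thesis
      by (simp add: tensor_simps case_prod_unfold infsum_cmult_right')
  qed
  have TB: "T (tensor_elem H K x y) = B x y" if x: "x \<in> hcarrier H" and y: "y \<in> hcarrier K" for x y
    using tensor_elem_closed[OF x y] x y T B inner T_T T_B[of "tensor_elem H K x y" x y]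
    by (intro L.eq_of_inner_eq) (simp_all add: tensor_elem_inner, simp add: tensor_elem_def)
  let ?C = "hcarrier HK"
  let ?P = "\<lambda>T. T \<in> extensional ?C \<and> hbounded_linear HK L T \<and>
     (\<forall>x\<in>hcarrier H. \<forall>y\<in>hcarrier K. T (tensor_elem H K x y) = B x y)"
  \<comment> \<open>The description asks for an extensional map; fixing the value off the carrier is
    what makes the lift unique as a function.\<close>
  let ?T = "restrict T ?C"
  have iso: "scaled_isometry k HK L ?T"
    using T T_T by (simp add: scaled_isometry_def)
  have P: "?P ?T"
    using scaled_isometry_bounded[OF hilbert_space_tensor L iso] TB tensor_elem_closed by simp
  have "tensor_lift H K L B = ?T"
    unfolding tensor_lift_def
  proof (rule the_equality)
    show "?P ?T" by (rule P)
    fix S assume S: "?P S"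
    show "S = ?T"
    proof (rule extensionalityI[of _ ?C])
      fix F assume F: "F \<in> ?C"
      show "S F = ?T F"
        by (rule tensor_map_eqI[OF L _ scaled_isometry_bounded[OF hilbert_space_tensor L iso] _ F])
          (use S TB tensor_elem_closed in simp_all)
    qed (use S in auto)
  qed
  then show "scaled_isometry k HK L (tensor_lift H K L B)"
    and "\<lbrakk>x \<in> hcarrier H; y \<in> hcarrier K\<rbrakk> \<Longrightarrow> tensor_lift H K L B (tensor_elem H K x y) = B x y"
    using iso TB tensor_elem_closed by simp_all
qed

lemma tensor_map_isometry:
  assumes H': "hilbert_space H'" and K': "hilbert_space K'"
    and S: "scaled_isometry 1 H H' S" and T: "scaled_isometry 1 K K' T"
  shows "scaled_isometry 1 HK (tensor H' K') (tensor_map H K H' K' S T)"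
    and "\<lbrakk>x \<in> hcarrier H; y \<in> hcarrier K\<rbrakk> \<Longrightarrow>
      tensor_map H K H' K' S T (tensor_elem H K x y) = tensor_elem H' K' (S x) (T y)"
proof -
  interpret P: hilbert_pair H' K' using H' K' by (rule hilbert_pair.intro)
  note D = scaled_isometryD[OF S] scaled_isometryD[OF T]
  have lift: "scaled_isometry 1 HK (tensor H' K')
      (tensor_lift H K (tensor H' K') (\<lambda>x y. tensor_elem H' K' (S x) (T y)))"
    "\<And>x y. \<lbrakk>x \<in> hcarrier H; y \<in> hcarrier K\<rbrakk> \<Longrightarrow>
      tensor_lift H K (tensor H' K') (\<lambda>x y. tensor_elem H' K' (S x) (T y)) (tensor_elem H K x y) =
      tensor_elem H' K' (S x) (T y)"
    using D P.tensor_elem_closed P.tensor_elem_inner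
    by (intro isometric_lift[OF P.hilbert_space_tensor, where k = 1]; simp)+
  show "scaled_isometry 1 HK (tensor H' K') (tensor_map H K H' K' S T)"
    and "\<lbrakk>x \<in> hcarrier H; y \<in> hcarrier K\<rbrakk> \<Longrightarrow>
      tensor_map H K H' K' S T (tensor_elem H K x y) = tensor_elem H' K' (S x) (T y)"
    unfolding tensor_map_def by (rule lift)+
qed

text \<open>By the reproducing property the value is the conjugate of the Riesz form at
  \<open>x\<close> and \<open>y\<close>. Freezing \<open>y\<close> allows functionals on triple
  products to be compared one factor at a time.\<close>

lemma hfunctional_tensor_elem:
  assumes \<psi>: "hfunctional HK \<psi>" and y: "y \<in> hcarrier K"
  shows "hfunctional H (\<lambda>x. \<psi> (tensor_elem H K x y))"
proof -
  obtain A where A: "A \<in> hcarrier HK" "\<And>F. F \<in> hcarrier HK \<Longrightarrow> \<psi> F = hinner HK F A"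
    using T.Riesz_representation[OF \<psi>] by blast
  have eq: "\<psi> (tensor_elem H K x y) = cnj (A x y)" if "x \<in> hcarrier H" for x
    using A T.inner_commute[OF tensor_elem_closed[OF that y] A(1)] tensor_reproducing[OF A(1) that y]
      tensor_elem_closed[OF that y] by simp
  have "hfunctional H (\<lambda>x. cnj (A x y))"
    using form_functionals(2)[OF _ y] A(1) by (simp add: in_tensor)
  then show ?thesis
    unfolding hfunctional_def by (simp add: eq H.add_closed H.scale_closed cong: ball_cong)
qed

end

section \<open>Triple tensor products and the associator\<close>

locale hilbert_triple = hilbert_pair H K + L: hilbert_space L
  for H :: "'a hspace" and K :: "'b hspace" and L :: "'c hspace"
begin

sublocale KL: hilbert_pair K L
  by unfold_locales

sublocale HK_L: hilbert_pair "tensor H K" L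
  by unfold_locales

sublocale H_KL: hilbert_pair H "tensor K L"
  by unfold_locales

text \<open>With \<open>z\<close> frozen, agreement spreads from elementary tensors to all
  \<open>w\<close> in the first two factors; then it spreads to the triple product.\<close>

lemma tensor_triple_functional_eqI:
  assumes \<phi>: "hfunctional (tensor HK L) \<phi>" and \<psi>: "hfunctional (tensor HK L) \<psi>"
    and eq: "\<And>x y z. \<lbrakk>x \<in> hcarrier H; y \<in> hcarrier K; z \<in> hcarrier L\<rbrakk> \<Longrightarrow>
      \<phi> (tensor_elem HK L (tensor_elem H K x y) z) =
      \<psi> (tensor_elem HK L (tensor_elem H K x y) z)"
    and F: "F \<in> hcarrier (tensor HK L)"
  shows "\<phi> F = \<psi> F"
proof (rule HK_L.tensor_functional_eqI[OF \<phi> \<psi> _ F])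
  fix w z assume w: "w \<in> hcarrier HK" and z: "z \<in> hcarrier L"
  show "\<phi> (tensor_elem HK L w z) = \<psi> (tensor_elem HK L w z)"
    by (rule tensor_functional_eqI[OF HK_L.hfunctional_tensor_elem[OF \<phi> z]
          HK_L.hfunctional_tensor_elem[OF \<psi> z] _ w]) (use eq z in auto)
qed

lemma tensor_triple_map_eqI:
  assumes P: "hilbert_space P" and S: "scaled_isometry 1 (tensor HK L) P S"
    and T: "scaled_isometry 1 (tensor HK L) P T"
    and eq: "\<And>x y z. \<lbrakk>x \<in> hcarrier H; y \<in> hcarrier K; z \<in> hcarrier L\<rbrakk> \<Longrightarrow>
      S (tensor_elem HK L (tensor_elem H K x y) z) =
      T (tensor_elem HK L (tensor_elem H K x y) z)"
    and F: "F \<in> hcarrier (tensor HK L)"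
  shows "S F = T F"
proof -
  interpret P: hilbert_space P by fact
  note bounded = scaled_isometry_bounded[OF HK_L.hilbert_space_tensor P]
  show ?thesis
  proof (rule P.inner_ext)
    show "S F \<in> hcarrier P" "T F \<in> hcarrier P"
      using S T F by (auto dest: scaled_isometryD)
    fix z assume "z \<in> hcarrier P"
    note z = P.hfunctional_inner[OF this]
    show "hinner P (S F) z = hinner P (T F) z"
      by (rule tensor_triple_functional_eqI[OF hfunctional_comp[OF P bounded[OF S] z]
            hfunctional_comp[OF P bounded[OF T] z] _ F]) (simp add: eq)
  qed
qed

abbreviation assoc_elem :: "'a \<Rightarrow> 'b \<Rightarrow> 'c \<Rightarrow> 'a \<Rightarrow> ('b \<Rightarrow> 'c \<Rightarrow> complex) \<Rightarrow> complex" where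
  "assoc_elem x y z \<equiv> tensor_elem H (tensor K L) x (tensor_elem K L y z)"

abbreviation assoc_slice :: "('a \<Rightarrow> 'b \<Rightarrow> complex) \<Rightarrow> 'c \<Rightarrow> 'a \<Rightarrow> ('b \<Rightarrow> 'c \<Rightarrow> complex) \<Rightarrow> complex" where
  "assoc_slice w z \<equiv> tensor_lift H K (tensor H (tensor K L)) (\<lambda>x y. assoc_elem x y z) w"

text \<open>The inner lift of \<open>tensor_assoc\<close>, with \<open>z\<close> frozen. The factor
  \<open>z\<close> contributes its own inner product with itself, so this map is isometric only up
  to the squared norm of \<open>z\<close>.\<close>

lemma assoc_slice:
  assumes z: "z \<in> hcarrier L"
  shows "scaled_isometry ((hnorm L z)\<^sup>2) HK (tensor H (tensor K L)) (\<lambda>w. assoc_slice w z)"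
    and "\<lbrakk>x \<in> hcarrier H; y \<in> hcarrier K\<rbrakk> \<Longrightarrow> assoc_slice (tensor_elem H K x y) z = assoc_elem x y z"
proof -
  have "hinner (tensor H (tensor K L)) (assoc_elem x y z) (assoc_elem x' y' z) =
      complex_of_real ((hnorm L z)\<^sup>2) * (hinner H x x' * hinner K y y')"
    if "x \<in> hcarrier H" "x' \<in> hcarrier H" "y \<in> hcarrier K" "y' \<in> hcarrier K" for x x' y y'
    using that z by (simp add: H_KL.tensor_elem_inner KL.tensor_elem_inner KL.tensor_elem_closed L.inner_self)
  note lift = isometric_lift[OF H_KL.hilbert_space_tensor _ _ this]
  show "scaled_isometry ((hnorm L z)\<^sup>2) HK (tensor H (tensor K L)) (\<lambda>w. assoc_slice w z)"
    by (rule lift) (use z in \<open>simp_all add: H_KL.tensor_elem_closed KL.tensor_elem_closed\<close>)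
  show "\<lbrakk>x \<in> hcarrier H; y \<in> hcarrier K\<rbrakk> \<Longrightarrow> assoc_slice (tensor_elem H K x y) z = assoc_elem x y z"
    by (rule lift) (use z in \<open>simp_all add: H_KL.tensor_elem_closed KL.tensor_elem_closed\<close>)
qed

lemma tensor_assoc_isometry:
  shows "scaled_isometry 1 (tensor HK L) (tensor H (tensor K L)) (tensor_assoc H K L)"
    and "\<lbrakk>x \<in> hcarrier H; y \<in> hcarrier K; z \<in> hcarrier L\<rbrakk> \<Longrightarrow>
      tensor_assoc H K L (tensor_elem HK L (tensor_elem H K x y) z) = assoc_elem x y z"
proof -
  let ?R = "tensor H (tensor K L)"
  note slice_bounded = scaled_isometry_bounded[OF hilbert_space_tensor H_KL.hilbert_space_tensor assoc_slice(1)]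
  have closed: "assoc_slice w z \<in> hcarrier ?R" if "w \<in> hcarrier HK" "z \<in> hcarrier L" for w z
    using scaled_isometryD(1)[OF assoc_slice(1)[OF that(2)] that(1)] .
  have elem: "assoc_elem x y z \<in> hcarrier ?R"
    if "x \<in> hcarrier H" "y \<in> hcarrier K" "z \<in> hcarrier L" for x y z
    using that by (simp add: H_KL.tensor_elem_closed KL.tensor_elem_closed)
  \<comment> \<open>The expected inner product as a bounded functional of \<open>w\<close>; the
    scalar is absorbed into \<open>v\<close> as \<open>cnj c\<close>.\<close>
  have scaled: "hfunctional HK (\<lambda>w. hinner HK w v * c)"
    if v: "v \<in> hcarrier HK" for v c
    using T.hfunctional_inner[OF T.scale_closed[OF v, of "cnj c"]] v
    unfolding hfunctional_def by (simp add: T.inner_scale_right T.add_closed T.scale_closed mult.commute cong: ball_cong)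
  \<comment> \<open>The outer lift asks for inner products of slices at arbitrary \<open>w\<close>
    and \<open>w'\<close>. One argument is extended at a time: here the second slice still comes
    from an elementary tensor.\<close>
  have half: "hinner ?R (assoc_slice w z) (assoc_elem x y z') =
      hinner HK w (tensor_elem H K x y) * hinner L z z'"
    if w: "w \<in> hcarrier HK" and z: "z \<in> hcarrier L" "z' \<in> hcarrier L"
      and xy: "x \<in> hcarrier H" "y \<in> hcarrier K" for w z z' x y
  proof (rule tensor_functional_eqI[OF hfunctional_comp[OF H_KL.hilbert_space_tensor
        slice_bounded[OF z(1)] H_KL.T.hfunctional_inner[OF elem[OF xy z(2)]]]
        scaled[OF tensor_elem_closed[OF xy]] _ w])
    fix x' y' assume "x' \<in> hcarrier H" "y' \<in> hcarrier K"
    then show "hinner ?R (assoc_slice (tensor_elem H K x' y') z) (assoc_elem x y z') =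
        hinner HK (tensor_elem H K x' y') (tensor_elem H K x y) * hinner L z z'"
      using z xy by (simp add: assoc_slice(2) H_KL.tensor_elem_inner KL.tensor_elem_inner
          KL.tensor_elem_closed tensor_elem_inner)
  qed
  \<comment> \<open>Now \<open>w'\<close> is arbitrary and \<open>w\<close> is extended from
    elementary tensors, where conjugate symmetry leads back to \<open>half\<close>.\<close>
  have inner: "hinner ?R (assoc_slice w z) (assoc_slice w' z') =
      complex_of_real 1 * (hinner HK w w' * hinner L z z')"
    if w: "w \<in> hcarrier HK" "w' \<in> hcarrier HK"
      and z: "z \<in> hcarrier L" "z' \<in> hcarrier L" for w w' z z'
  proof -
    have "hinner ?R (assoc_slice w z) (assoc_slice w' z') = hinner HK w w' * hinner L z z'"
    proof (rule tensor_functional_eqI[OF hfunctional_comp[OF H_KL.hilbert_space_tensor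
          slice_bounded[OF z(1)] H_KL.T.hfunctional_inner[OF closed[OF w(2) z(2)]]] scaled[OF w(2)] _ w(1)])
      fix x y assume xy: "x \<in> hcarrier H" "y \<in> hcarrier K"
      have "hinner ?R (assoc_elem x y z) (assoc_slice w' z') =
          cnj (hinner ?R (assoc_slice w' z') (assoc_elem x y z))"
        using xy z w by (intro H_KL.T.inner_commute elem closed)
      also have "\<dots> = hinner HK (tensor_elem H K x y) w' * hinner L z z'"
        using half[OF w(2) z(2,1) xy] L.inner_commute[OF z]
          T.inner_commute[OF tensor_elem_closed[OF xy] w(2)] by simp
      finally show "hinner ?R (assoc_slice (tensor_elem H K x y) z) (assoc_slice w' z') =
          hinner HK (tensor_elem H K x y) w' * hinner L z z'"
        using xy z by (simp add: assoc_slice(2))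
    qed
    then show ?thesis by simp
  qed
  note lift = HK_L.isometric_lift[OF H_KL.hilbert_space_tensor _ closed inner]
  show "scaled_isometry 1 (tensor HK L) ?R (tensor_assoc H K L)"
    unfolding tensor_assoc_def by (rule lift(1)) simp_all
  show "tensor_assoc H K L (tensor_elem HK L (tensor_elem H K x y) z) = assoc_elem x y z"
    if "x \<in> hcarrier H" "y \<in> hcarrier K" "z \<in> hcarrier L"
    unfolding tensor_assoc_def
    by (subst lift(2)) (use that in \<open>simp_all add: tensor_elem_closed assoc_slice(2)\<close>)
qed

end

section \<open>Bounded operators on a complex Hilbert space\<close>

lemma scaleC_one [simp]: "1 *\<^sub>C x = x"
  using scaleC_of_real[of 1 x] by simp

lemma scaleC_zero [simp]: "0 *\<^sub>C x = 0"
  using scaleC_of_real[of 0 x] by simp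

lemma scaleC_minus_one [simp]: "(- 1) *\<^sub>C x = - x"
  using scaleC_of_real[of "-1" x] by simp

lemma scaleC_zero_right [simp]: "c *\<^sub>C (0::'h::complex_hilbert) = 0"
  using scaleC_add_right[of c 0 "0::'h"] by simp

lemma cinner_self: "cinner x x = complex_of_real ((norm x)\<^sup>2)"
  using Re_cinner[of x x] cinner_commute[of x x]
  by (simp add: complex_eq_iff power2_norm_eq_inner)

lemma cinner_add_right: "cinner x (y + z) = cinner x y + cinner x z"
  using cinner_commute[of x "y + z"] cinner_commute[of x y] cinner_commute[of x z] by (simp add: cinner_add_left)

lemma cinner_scaleC_right: "cinner x (c *\<^sub>C y) = cnj c * cinner x y"
  using cinner_commute[of x "c *\<^sub>C y"] cinner_commute[of x y] by (simp add: cinner_scaleC_left)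

lemma cinner_zero_left [simp]: "cinner 0 x = 0"
  using cinner_scaleC_left[of 0 x x] by simp

lemma cinner_zero_right [simp]: "cinner x 0 = 0"
  using cinner_scaleC_right[of x 0 x] by simp

lemma cinner_minus_left: "cinner (- x) y = - cinner x y"
  using cinner_scaleC_left[of "-1" x y] by simp

lemma cinner_minus_right: "cinner x (- y) = - cinner x y"
  using cinner_scaleC_right[of x "-1" y] by simp

lemma cinner_diff_left: "cinner (x - y) z = cinner x z - cinner y z"
  using cinner_add_left[of x "- y" z] by (simp add: cinner_minus_left)

lemma cinner_diff_right: "cinner x (y - z) = cinner x y - cinner x z"
  using cinner_add_right[of x y "- z"] by (simp add: cinner_minus_right)

lemma cinner_ext:
  assumes "\<And>z. cinner x z = cinner y z" shows "x = y"
proof -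
  have "cinner (x - y) (x - y) = 0" unfolding cinner_diff_left using assms by simp
  then show ?thesis by (simp add: cinner_self)
qed

lemma norm_scaleC: "norm (c *\<^sub>C x) = cmod c * norm x"
proof -
  have "complex_of_real ((norm (c *\<^sub>C x))\<^sup>2) = (c * cnj c) * cinner x x"
    unfolding cinner_self[symmetric] by (simp add: cinner_scaleC_left cinner_scaleC_right)
  also have "\<dots> = complex_of_real ((cmod c * norm x)\<^sup>2)"
    unfolding complex_norm_square[symmetric] cinner_self by (simp add: power_mult_distrib)
  finally have "(norm (c *\<^sub>C x))\<^sup>2 = (cmod c * norm x)\<^sup>2" by (simp only: of_real_eq_iff)
  then show ?thesis by (rule power2_eq_imp_eq) simp_all
qed

text \<open>The ambient type viewed as a record, so that Cauchy-Schwarz and Riesz representation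
  transfer to it.\<close>

definition univ_hspace :: "'h::complex_hilbert hspace" where
  "univ_hspace = \<lparr>hcarrier = UNIV, hzero = 0, hadd = (+), hscale = scaleC, hinner = cinner\<rparr>"

lemma univ_hspace_simps [simp]:
  "hcarrier univ_hspace = UNIV" "hzero univ_hspace = 0" "hadd univ_hspace = (+)"
  "hscale univ_hspace = scaleC" "hinner univ_hspace = cinner"
  by (simp_all add: univ_hspace_def)

lemma hnorm_univ [simp]: "hnorm univ_hspace x = norm x"
  by (simp add: hnorm_def cinner_self)

lemma hdist_univ [simp]: "hdist univ_hspace x y = dist x y"
  by (simp add: hdist_def dist_norm)

lemma hilbert_space_univ: "hilbert_space (univ_hspace :: 'h::complex_hilbert hspace)"
proof
  fix X :: "nat \<Rightarrow> 'h"
  assume "\<forall>e>0. \<exists>N. \<forall>m\<ge>N. \<forall>n\<ge>N. hdist univ_hspace (X m) (X n) < e"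
  then have "Cauchy X" by (simp add: Cauchy_def)
  then obtain x where "X \<longlonglongrightarrow> x" by (auto simp: Cauchy_convergent_iff convergent_def)
  then show "\<exists>x\<in>hcarrier univ_hspace. (\<lambda>n. hdist univ_hspace (X n) x) \<longlonglongrightarrow> 0"
    using tendsto_dist_iff[of X x] by auto
next
  fix x y z :: 'h
  show "hadd univ_hspace (hadd univ_hspace x y) z = hadd univ_hspace x (hadd univ_hspace y z)"
    by (simp add: add.assoc)
  show "hadd univ_hspace x y = hadd univ_hspace y x"
    by (simp add: add.commute)
  show "hinner univ_hspace x y = cnj (hinner univ_hspace y x)"
    unfolding univ_hspace_simps by (rule cinner_commute)
qed (simp_all add: cinner_self scaleC_scaleC scaleC_add_left scaleC_add_right cinner_add_left
    cinner_scaleC_left)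

interpretation univ: hilbert_space univ_hspace
  by (rule hilbert_space_univ)

lemma cinner_Cauchy_Schwarz: "cmod (cinner x y) \<le> norm x * norm y"
  using univ.Cauchy_Schwarz[of x y] by simp

lemma bounded_bilinear_cinner: "bounded_bilinear (cinner :: 'h::complex_hilbert \<Rightarrow> 'h \<Rightarrow> complex)"
proof
  show "\<exists>K. \<forall>x y. norm (cinner x y) \<le> norm x * norm (y::'h) * K"
    by (intro exI[of _ 1] allI) (simp add: cinner_Cauchy_Schwarz)
  fix x y :: 'h and r :: real
  show "cinner (r *\<^sub>R x) y = r *\<^sub>R cinner x y"
    unfolding scaleC_of_real[symmetric] cinner_scaleC_left by (simp add: scaleR_conv_of_real)
  show "cinner x (r *\<^sub>R y) = r *\<^sub>R cinner x y"
    unfolding scaleC_of_real[symmetric] cinner_scaleC_right by (simp add: scaleR_conv_of_real)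
qed (simp_all add: cinner_add_left cinner_add_right)

lemma bounded_bilinear_scaleC: "bounded_bilinear (scaleC :: complex \<Rightarrow> 'h::complex_hilbert \<Rightarrow> 'h)"
proof
  show "\<exists>K. \<forall>c x. norm (c *\<^sub>C (x::'h)) \<le> norm c * norm x * K"
    by (intro exI[of _ 1] allI) (simp add: norm_scaleC)
  fix c :: complex and x :: 'h and r :: real
  show "(r *\<^sub>R c) *\<^sub>C x = r *\<^sub>R (c *\<^sub>C x)"
    unfolding scaleC_of_real[symmetric] scaleC_scaleC by (simp add: scaleR_conv_of_real)
  show "c *\<^sub>C (r *\<^sub>R x) = r *\<^sub>R (c *\<^sub>C x)"
    unfolding scaleC_of_real[symmetric] scaleC_scaleC by (simp add: mult.commute)
qed (simp_all add: scaleC_add_left scaleC_add_right)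

lemmas tendsto_cinner = bounded_bilinear.tendsto[OF bounded_bilinear_cinner]
lemmas continuous_on_cinner = bounded_bilinear.continuous_on[OF bounded_bilinear_cinner]
lemmas continuous_on_scaleC = bounded_bilinear.continuous_on[OF bounded_bilinear_scaleC]

lemma univ_Riesz:
  fixes \<phi> :: "'h::complex_hilbert \<Rightarrow> complex"
  assumes "\<And>x y. \<phi> (x + y) = \<phi> x + \<phi> y" "\<And>c x. \<phi> (c *\<^sub>C x) = c * \<phi> x" "\<And>x. cmod (\<phi> x) \<le> C * norm x"
  shows "\<exists>y. \<forall>x. \<phi> x = cinner x y"
proof -
  have "hfunctional univ_hspace \<phi>" using assms by (auto simp: hfunctional_def)
  from univ.Riesz_representation[OF this] show ?thesis by simp
qed

lemma bounded_clinearI: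
  assumes "\<And>x y. T (x + y) = T x + T y" "\<And>c x. T (c *\<^sub>C x) = c *\<^sub>C T x" "\<And>x. norm (T x) \<le> C * norm x"
  shows "bounded_clinear T"
  unfolding bounded_clinear_def
  using assms by (auto intro!: bounded_linear_intro[of _ C] simp: scaleC_of_real[symmetric] mult.commute)

lemma bounded_clinear_add: "bounded_clinear T \<Longrightarrow> T (x + y) = T x + T y"
  by (simp add: bounded_clinear_def bounded_linear.linear linear_add)

lemma bounded_clinear_diff: "bounded_clinear T \<Longrightarrow> T (x - y) = T x - T y"
  by (simp add: bounded_clinear_def bounded_linear.linear linear_diff)

lemma bounded_clinear_scaleC: "bounded_clinear T \<Longrightarrow> T (c *\<^sub>C x) = c *\<^sub>C T x"
  by (simp add: bounded_clinear_def)

lemma bounded_clinear_bound: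
  assumes "bounded_clinear T"
  obtains C where "C > 0" "\<And>x. norm (T x) \<le> C * norm x"
  using bounded_linear.pos_bounded[of T] assms unfolding bounded_clinear_def by (metis mult.commute)

lemma bounded_clinear_continuous: "bounded_clinear T \<Longrightarrow> continuous_on UNIV T"
  by (simp add: bounded_clinear_def linear_continuous_on)

lemma bounded_clinear_id: "bounded_clinear id"
  by (rule bounded_clinearI[of _ 1]) auto

lemma bounded_clinear_comp: "\<lbrakk>bounded_clinear S; bounded_clinear T\<rbrakk> \<Longrightarrow> bounded_clinear (S \<circ> T)"
  unfolding bounded_clinear_def using bounded_linear_compose[of S T] by (auto simp: comp_def)

lemma bounded_clinear_zero: "bounded_clinear (\<lambda>x. 0)"
  by (rule bounded_clinearI[of _ 0]) auto

lemma bounded_clinear_sum: "\<lbrakk>bounded_clinear S; bounded_clinear T\<rbrakk> \<Longrightarrow> bounded_clinear (\<lambda>x. S x + T x)"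
  unfolding bounded_clinear_def using bounded_linear_add[of S T] by (auto simp: scaleC_add_right)

lemma bounded_clinear_scale:
  assumes "bounded_clinear T" shows "bounded_clinear (\<lambda>x. c *\<^sub>C T x)"
proof -
  obtain C where C: "\<And>x. norm (T x) \<le> C * norm x"
    using bounded_clinear_bound[OF assms] by blast
  show ?thesis
  proof (rule bounded_clinearI[of _ "cmod c * C"])
    show "norm (c *\<^sub>C T x) \<le> cmod c * C * norm x" for x
      using mult_left_mono[OF C, of "cmod c" x] by (simp add: norm_scaleC mult.assoc)
  qed (use assms in \<open>auto simp: bounded_clinear_add bounded_clinear_scaleC scaleC_add_right
      scaleC_scaleC mult.commute\<close>)
qed

text \<open>For fixed \<open>x\<close> the conjugated form is a bounded functional, and its Riesz
  vector is \<open>T x\<close>; testing with \<open>y = T x\<close> bounds \<open>T\<close>.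
  Adjoints and weak limits of operators both arise this way.\<close>

lemma form_representation:
  fixes B :: "'h::complex_hilbert \<Rightarrow> 'h \<Rightarrow> complex"
  assumes add_left: "\<And>x y z. B (x + y) z = B x z + B y z"
    and scale_left: "\<And>c x y. B (c *\<^sub>C x) y = c * B x y"
    and add_right: "\<And>x y z. B x (y + z) = B x y + B x z"
    and scale_right: "\<And>c x y. B x (c *\<^sub>C y) = cnj c * B x y"
    and bound: "\<And>x y. cmod (B x y) \<le> C * norm x * norm y"
  obtains T where "bounded_clinear T" "\<And>x y. B x y = cinner (T x) y"
proof -
  have "\<exists>z. \<forall>y. cnj (B x y) = cinner y z" for x
    by (rule univ_Riesz[where C = "C * norm x"]) (use bound in \<open>simp_all add: add_right scale_right\<close>)
  then obtain T where T: "\<And>x y. cnj (B x y) = cinner y (T x)" by metis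
  have B: "B x y = cinner (T x) y" for x y
    using T[of x y] cinner_commute[of "T x" y] by (metis complex_cnj_cnj)
  have "bounded_clinear T"
  proof (rule bounded_clinearI[of _ C])
    show "T (x + y) = T x + T y" for x y
      by (rule cinner_ext) (simp add: B[symmetric] cinner_add_left add_left)
    show "T (c *\<^sub>C x) = c *\<^sub>C T x" for c x
      by (rule cinner_ext) (simp add: B[symmetric] cinner_scaleC_left scale_left)
    show "norm (T x) \<le> C * norm x" for x
    proof (cases "T x = 0")
      \<comment> \<open>The sign of \<open>C\<close> is not given; nonnegativity of the right-hand
        side is extracted from the bound at \<open>x\<close>, \<open>x\<close>.\<close>
      case True
      have "0 \<le> cmod (B x x)" by simp
      also have "\<dots> \<le> C * norm x * norm x" by (rule bound)
      finally show ?thesis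
        using True by (cases "x = 0") (auto simp: zero_le_mult_iff)
    next
      case False
      have "norm (T x) * norm (T x) \<le> C * norm x * norm (T x)"
        using bound[of x "T x"] unfolding B cinner_self norm_of_real by (simp add: power2_eq_square)
      then show ?thesis using False by simp
    qed
  qed
  then show thesis using B that by blast
qed

section \<open>Adjoints\<close>

lemma cadj_eqI:
  assumes "\<And>x y. cinner (T x) y = cinner x (S y)"
  shows "cadj T = S"
  unfolding cadj_def
proof (rule the_equality)
  show "\<forall>x y. cinner (T x) y = cinner x (S y)" using assms by blast
  fix R assume R: "\<forall>x y. cinner (T x) y = cinner x (R y)"
  show "R = S"
  proof
    fix y
    have "cinner x (R y) = cinner x (S y)" for x using R assms by metis
    then have "cinner (R y) x = cinner (S y) x" for x
      using cinner_commute[of "R y" x] cinner_commute[of "S y" x] by simp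
    then show "R y = S y" by (rule cinner_ext)
  qed
qed

text \<open>Representing the form \<open>cinner x (T y)\<close> by an operator in its first slot
  produces the adjoint, after which the description in \<open>cadj\<close> resolves.\<close>

lemma
  assumes T: "bounded_clinear T"
  shows cinner_cadj: "cinner (T x) y = cinner x (cadj T y)"
    and bounded_clinear_cadj: "bounded_clinear (cadj T)"
proof -
  obtain C where C: "C > 0" "\<And>x. norm (T x) \<le> C * norm x" using bounded_clinear_bound[OF T] by blast
  obtain S where S: "bounded_clinear S" "\<And>x y. cinner x (T y) = cinner (S x) y"
  proof (rule form_representation[of "\<lambda>x y. cinner x (T y)" C])
    show "cmod (cinner x (T y)) \<le> C * norm x * norm y" for x y
      using cinner_Cauchy_Schwarz[of x "T y"] mult_left_mono[OF C(2)[of y], of "norm x"]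
      by (simp add: mult_ac)
  qed (use T in \<open>auto simp: bounded_clinear_add bounded_clinear_scaleC cinner_add_left
      cinner_add_right cinner_scaleC_left cinner_scaleC_right\<close>)
  have S': "cinner (T x) y = cinner x (S y)" for x y
    using S(2)[of y x] cinner_commute[of "T x" y] cinner_commute[of x "S y"] by simp
  then have "cadj T = S" by (rule cadj_eqI)
  then show "cinner (T x) y = cinner x (cadj T y)" "bounded_clinear (cadj T)" using S S' by auto
qed

lemma cinner_cadj_left: "bounded_clinear T \<Longrightarrow> cinner (cadj T x) y = cinner x (T y)"
  using cinner_cadj[of T y x] cinner_commute[of "cadj T x" y] cinner_commute[of x "T y"] by simp

lemma cadj_cadj: "bounded_clinear T \<Longrightarrow> cadj (cadj T) = T"
  by (rule cadj_eqI) (rule cinner_cadj_left)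

lemma cadj_comp: "\<lbrakk>bounded_clinear S; bounded_clinear T\<rbrakk> \<Longrightarrow> cadj (S \<circ> T) = cadj T \<circ> cadj S"
  by (rule cadj_eqI) (simp add: cinner_cadj)

subsection \<open>Limits of bounded sequences of operators\<close>

lemma convergent_on_dense:
  fixes f :: "nat \<Rightarrow> 'x::metric_space \<Rightarrow> 'y::complete_space"
  assumes lip: "\<And>n x y. dist (f n x) (f n y) \<le> K * dist x y"
    and dense: "closure D = UNIV" and conv: "\<And>x. x \<in> D \<Longrightarrow> convergent (\<lambda>n. f n x)"
  shows "convergent (\<lambda>n. f n x)"
proof -
  have "Cauchy (\<lambda>n. f n x)"
  proof (rule metric_CauchyI)
    fix e :: real assume e: "e > 0"
    \<comment> \<open>A three-epsilon argument: moving from \<open>x\<close> to \<open>y\<close>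
      costs less than e/3 at every index. The denominator is positive whatever the sign of
      \<open>K\<close>.\<close>
    define d where "d = e / (3 * (\<bar>K\<bar> + 1))"
    have d: "d > 0" using e by (simp add: d_def)
    obtain y where y: "y \<in> D" "dist y x < d"
      using dense d closure_approachable[of x D] by auto
    have near: "dist (f n x) (f n y) < e / 3" for n
    proof -
      have "K * dist x y \<le> (\<bar>K\<bar> + 1) * dist x y" by (rule mult_right_mono) auto
      also have "\<dots> < (\<bar>K\<bar> + 1) * d" using y(2) by (intro mult_strict_left_mono) (auto simp: dist_commute)
      also have "\<dots> = e / 3" by (simp add: d_def field_simps)
      finally show ?thesis using lip[of n x y] by linarith
    qed
    obtain N where N: "\<And>m n. \<lbrakk>m \<ge> N; n \<ge> N\<rbrakk> \<Longrightarrow> dist (f m y) (f n y) < e / 3"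
      using metric_CauchyD[OF convergent_Cauchy[OF conv[OF y(1)]], of "e/3"] e by auto
    have "dist (f m x) (f n x) < e" if "m \<ge> N" "n \<ge> N" for m n
      using near[of m] near[of n] N[OF that] dist_triangle[of "f m x" "f n x" "f m y"]
        dist_triangle[of "f m y" "f n x" "f n y"] by (simp add: dist_commute)
    then show "\<exists>N. \<forall>m\<ge>N. \<forall>n\<ge>N. dist (f m x) (f n x) < e" by blast
  qed
  then show ?thesis by (simp add: Cauchy_convergent_iff)
qed

lemma dense_sequence:
  obtains d :: "nat \<Rightarrow> 'x::{metric_space, second_countable_topology}" where "closure (range d) = UNIV"
proof -
  obtain D :: "'x set" where D: "countable D" "\<And>X. \<lbrakk>open X; X \<noteq> {}\<rbrakk> \<Longrightarrow> \<exists>d\<in>D. d \<in> X"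
    using countable_dense_exists by blast
  have "D \<noteq> {}" using D(2)[of UNIV] by auto
  then have r: "range (from_nat_into D) = D" using D(1) by (rule range_from_nat_into)
  have "x \<in> closure D" for x
    unfolding closure_approachable
  proof (intro allI impI)
    fix e :: real assume "e > 0"
    then show "\<exists>y\<in>D. dist y x < e" using D(2)[of "ball x e"] by (auto simp: dist_commute)
  qed
  then show thesis using r by (intro that[of "from_nat_into D"]) auto
qed

text \<open>Matrix coefficients are bounded sequences of numbers. A diagonal subsequence makes them
  converge for all pairs of vectors of a dense sequence, the uniform Lipschitz bound extends this to
  each slot in turn, and the limit form keeps the bound \<open>C\<close>, so it comes from an
  operator.\<close>

lemma weak_operator_compactness:
  fixes S :: "nat \<Rightarrow> 'h::{complex_hilbert, second_countable_topology} \<Rightarrow> 'h"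
  assumes S: "\<And>n. bounded_clinear (S n)" and bound: "\<And>n x. norm (S n x) \<le> C * norm x"
  obtains r T where "strict_mono r" "bounded_clinear T"
    "\<And>x y. (\<lambda>n. cinner (S (r n) x) y) \<longlonglongrightarrow> cinner (T x) y"
proof -
  obtain d :: "nat \<Rightarrow> 'h" where dense: "closure (range d) = UNIV" by (rule dense_sequence)
  have le: "cmod (cinner (S n x) y) \<le> C * norm x * norm y" for n x y
    using cinner_Cauchy_Schwarz[of "S n x" y] mult_right_mono[OF bound[of n x], of "norm y"] by simp
  \<comment> \<open>\<open>k\<close> codes a pair of indices into the dense sequence. Convergence of
    that coefficient is inherited by subsequences, as diagonal selection requires.\<close>
  define P where "P k s \<longleftrightarrow> convergent (\<lambda>n. cinner (S (s n) (d (fst (prod_decode k)))) (d (snd (prod_decode k))))"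
    for k and s :: "nat \<Rightarrow> nat"
  interpret subseqs P
  proof
    fix k and s :: "nat \<Rightarrow> nat" assume "strict_mono s"
    let ?f = "\<lambda>n. cinner (S (s n) (d (fst (prod_decode k)))) (d (snd (prod_decode k)))"
    have "bounded (range ?f)"
      unfolding bounded_iff using le by (blast intro: exI)
    then obtain l r where "strict_mono r" "(?f \<circ> r) \<longlonglongrightarrow> l"
      using bounded_imp_convergent_subsequence by blast
    then show "\<exists>r'. strict_mono r' \<and> P k (s \<circ> r')"
      unfolding P_def convergent_def by (auto simp: o_def)
  qed
  define r where "r = diagseq"
  have r: "strict_mono r" unfolding r_def by (rule subseq_diagseq)
  have conv0: "convergent (\<lambda>n. cinner (S (r n) (d i)) (d j))" for i j
  proof -
    let ?k = "prod_encode (i, j)"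
    \<comment> \<open>From index \<open>Suc ?k\<close> on, the diagonal sequence is a subsequence of
      the choice made for \<open>?k\<close>; convergence ignores the earlier terms.\<close>
    have "P ?k (diagseq \<circ> ((+) (Suc ?k)))"
    proof (rule diagseq_holds)
      fix s r and k :: nat assume "strict_mono (r :: nat \<Rightarrow> nat)" "P k s"
      then show "P k (s \<circ> r)"
        unfolding P_def using convergent_subseq_convergent by (fastforce simp: o_def)
    qed
    then have "convergent (\<lambda>n. cinner (S (r (n + Suc ?k)) (d i)) (d j))"
      by (simp add: P_def r_def add.commute)
    then show ?thesis
      using convergent_ignore_initial_segment[of "\<lambda>n. cinner (S (r n) (d i)) (d j)" "Suc ?k"] by simp
  qed
  have conv1: "convergent (\<lambda>n. cinner (S (r n) x) (d j))" for x j
  proof (rule convergent_on_dense[where D = "range d" and K = "C * norm (d j)"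
        and f = "\<lambda>n x. cinner (S (r n) x) (d j)"])
    show "dist (cinner (S (r n) x) (d j)) (cinner (S (r n) y) (d j)) \<le> C * norm (d j) * dist x y" for n x y
      using le[of "r n" "x - y" "d j"]
      by (simp add: dist_norm bounded_clinear_diff[OF S] cinner_diff_left mult_ac)
  qed (use dense conv0 in auto)
  have conv: "convergent (\<lambda>n. cinner (S (r n) x) y)" for x y
  proof (rule convergent_on_dense[where D = "range d" and K = "C * norm x"
        and f = "\<lambda>n y. cinner (S (r n) x) y"])
    show "dist (cinner (S (r n) x) y) (cinner (S (r n) x) z) \<le> C * norm x * dist y z" for n y z
      using le[of "r n" x "y - z"] by (simp add: dist_norm cinner_diff_right)
  qed (use dense conv1 in auto)
  define B where "B x y = lim (\<lambda>n. cinner (S (r n) x) y)" for x y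
  have B: "(\<lambda>n. cinner (S (r n) x) y) \<longlonglongrightarrow> B x y" for x y
    using conv by (simp add: B_def convergent_LIMSEQ_iff)
  obtain T where "bounded_clinear T" "\<And>x y. B x y = cinner (T x) y"
  proof (rule form_representation[of B C])
    fix x y z c
    show "B (x + y) z = B x z + B y z"
      using B[of "x + y" z] tendsto_add[OF B[of x z] B[of y z]]
      by (simp add: bounded_clinear_add[OF S] cinner_add_left LIMSEQ_unique)
    show "B (c *\<^sub>C x) y = c * B x y"
      using B[of "c *\<^sub>C x" y] tendsto_mult_left[OF B[of x y], of c]
      by (simp add: bounded_clinear_scaleC[OF S] cinner_scaleC_left LIMSEQ_unique)
    show "B x (y + z) = B x y + B x z"
      using B[of x "y + z"] tendsto_add[OF B[of x y] B[of x z]]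
      by (simp add: cinner_add_right LIMSEQ_unique)
    show "B x (c *\<^sub>C y) = cnj c * B x y"
      using B[of x "c *\<^sub>C y"] tendsto_mult_left[OF B[of x y], of "cnj c"]
      by (simp add: cinner_scaleC_right LIMSEQ_unique)
    show "cmod (B x y) \<le> C * norm x * norm y"
      by (rule LIMSEQ_le_const2[OF tendsto_norm[OF B]]) (use le in auto)
  qed blast
  then show thesis using that[OF r] B by simp
qed

section \<open>The modular conjugation\<close>

lemma norm_eqI_cinner: "cinner x x = cinner y y \<Longrightarrow> norm x = norm y"
  unfolding cinner_self of_real_eq_iff by (simp add: power2_eq_iff_nonneg)

lemma commutantD:
  "T \<in> commutant S \<Longrightarrow> bounded_clinear T"
  "\<lbrakk>T \<in> commutant S; s \<in> S\<rbrakk> \<Longrightarrow> T (s x) = s (T x)"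
  by (auto simp: commutant_def comp_def fun_eq_iff)

lemma commutantI:
  "\<lbrakk>bounded_clinear T; \<And>s x. s \<in> S \<Longrightarrow> T (s x) = s (T x)\<rbrakk> \<Longrightarrow> T \<in> commutant S"
  by (auto simp: commutant_def)

lemma commutant_comp: "\<lbrakk>S \<in> commutant N; T \<in> commutant N\<rbrakk> \<Longrightarrow> S \<circ> T \<in> commutant N"
  by (rule commutantI) (simp_all add: commutantD bounded_clinear_comp)

lemma commutant_id: "id \<in> commutant N"
  by (rule commutantI) (simp_all add: bounded_clinear_id)

lemma commutant_add:
  assumes "N \<subseteq> Collect bounded_clinear" "S \<in> commutant N" "T \<in> commutant N"
  shows "(\<lambda>x. S x + T x) \<in> commutant N"
  by (rule commutantI) (use assms in \<open>auto simp: commutantD bounded_clinear_sum bounded_clinear_add subset_iff\<close>)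

lemma commutant_scale:
  assumes "N \<subseteq> Collect bounded_clinear" "T \<in> commutant N"
  shows "(\<lambda>x. c *\<^sub>C T x) \<in> commutant N"
  by (rule commutantI) (use assms in \<open>auto simp: commutantD bounded_clinear_scale bounded_clinear_scaleC subset_iff\<close>)

lemma commutant_cadj:
  assumes N: "N \<subseteq> Collect bounded_clinear" "\<And>s. s \<in> N \<Longrightarrow> cadj s \<in> N" and T: "T \<in> commutant N"
  shows "cadj T \<in> commutant N"
proof (rule commutantI)
  show "bounded_clinear (cadj T)" using T by (simp add: commutantD bounded_clinear_cadj)
  fix s x assume s: "s \<in> N"
  have bs: "bounded_clinear s" and bT: "bounded_clinear T"
    using s N T by (auto simp: commutantD)
  have "cinner (cadj T (s x)) y = cinner (s (cadj T x)) y" for y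
    using commutantD(2)[OF T N(2)[OF s], of y] bs bT
    by (simp add: cinner_cadj_left cinner_cadj)
  then show "cadj T (s x) = s (cadj T x)" by (rule cinner_ext)
qed

locale standard_form =
  fixes M :: "('h::complex_hilbert \<Rightarrow> 'h) set" and \<Omega> :: 'h
  assumes vN: "von_neumann_algebra M" and trace: "standard_trace_vector M \<Omega>"
begin

lemma M_sub: "M \<subseteq> Collect bounded_clinear"
  using vN by (simp add: von_neumann_algebra_def)

lemma M_bounded: "m \<in> M \<Longrightarrow> bounded_clinear m"
  using M_sub by auto

lemma M_cadj: "m \<in> M \<Longrightarrow> cadj m \<in> M"
  using vN by (simp add: von_neumann_algebra_def)

lemma bicommutant: "commutant (commutant M) = M"
  using vN by (simp add: von_neumann_algebra_def)

lemma comm_sub: "commutant M \<subseteq> Collect bounded_clinear"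
  by (auto simp: commutantD)

lemma comm_cadj: "x \<in> commutant M \<Longrightarrow> cadj x \<in> commutant M"
  using commutant_cadj[OF M_sub M_cadj] .

lemma M_comp: "\<lbrakk>m \<in> M; n \<in> M\<rbrakk> \<Longrightarrow> m \<circ> n \<in> M"
  using commutant_comp[of m "commutant M" n] by (simp add: bicommutant)

lemma M_id: "id \<in> M"
  using commutant_id[of "commutant M"] by (simp add: bicommutant)

lemma M_add: "\<lbrakk>m \<in> M; n \<in> M\<rbrakk> \<Longrightarrow> (\<lambda>x. m x + n x) \<in> M"
  using commutant_add[OF comm_sub, of m n] by (simp add: bicommutant)

lemma M_scale: "m \<in> M \<Longrightarrow> (\<lambda>x. c *\<^sub>C m x) \<in> M"
  using commutant_scale[OF comm_sub, of m] by (simp add: bicommutant)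

lemma M_diff: "\<lbrakk>m \<in> M; n \<in> M\<rbrakk> \<Longrightarrow> (\<lambda>x. m x - n x) \<in> M"
  using M_add[OF _ M_scale, of m n "-1"] by simp

lemma cyclic: "closure ((\<lambda>m. m \<Omega>) ` M) = UNIV"
  using trace by (simp add: standard_trace_vector_def)

lemma norm_\<Omega>: "norm \<Omega> = 1"
  using trace by (simp add: standard_trace_vector_def)

lemma separating:
  assumes "m \<in> M" "n \<in> M" "m \<Omega> = n \<Omega>" shows "m = n"
proof -
  have "(\<lambda>x. m x - n x) = (\<lambda>_. 0)"
    using trace M_diff[OF assms(1,2)] assms(3) by (simp add: standard_trace_vector_def)
  then show ?thesis by (simp add: fun_eq_iff)
qed

lemma tracial: "\<lbrakk>m \<in> M; n \<in> M\<rbrakk> \<Longrightarrow> cinner (m (n \<Omega>)) \<Omega> = cinner (n (m \<Omega>)) \<Omega>"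
  using trace by (simp add: standard_trace_vector_def)

lemma dense_eqI:
  fixes f g :: "'h \<Rightarrow> 'x::t2_space"
  assumes "continuous_on UNIV f" "continuous_on UNIV g" "\<And>m. m \<in> M \<Longrightarrow> f (m \<Omega>) = g (m \<Omega>)"
  shows "f x = g x"
proof -
  have "closed {x. f x = g x}" using assms by (intro closed_Collect_eq)
  then have "closure ((\<lambda>m. m \<Omega>) ` M) \<subseteq> {x. f x = g x}"
    using assms(3) by (intro closure_minimal) auto
  then show ?thesis using cyclic by auto
qed

text \<open>The trace property exchanges \<open>n\<close> and \<open>cadj m\<close> under the vector
  state. It makes passing to adjoints an isometry on the orbit of \<Omega>, which is why the
  conjugation extends continuously.\<close>

lemma cadj_inner:
  assumes "m \<in> M" "n \<in> M"
  shows "cinner (cadj m \<Omega>) (cadj n \<Omega>) = cinner (n \<Omega>) (m \<Omega>)"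
proof -
  have "cinner (cadj m \<Omega>) (cadj n \<Omega>) = cinner (n (cadj m \<Omega>)) \<Omega>"
    using M_bounded[OF assms(2)] by (simp add: cinner_cadj)
  also have "\<dots> = cinner (cadj m (n \<Omega>)) \<Omega>"
    using assms M_cadj by (intro tracial)
  finally show ?thesis using M_bounded[OF assms(1)] by (simp add: cinner_cadj_left)
qed

lemma operator_eqI:
  assumes "bounded_clinear S" "bounded_clinear T" "\<And>m. m \<in> M \<Longrightarrow> S (m \<Omega>) = T (m \<Omega>)"
  shows "S x = T x"
  by (rule dense_eqI) (use assms bounded_clinear_continuous in auto)

abbreviation J :: "'h \<Rightarrow> 'h" where
  "J \<equiv> modular_conj M \<Omega>"

text \<open>On the orbit of \<Omega> the map is well defined because \<Omega> separates
  \<open>M\<close>, and isometric by \<open>cadj_inner\<close>; so it extends to the closure, which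
  is everything. Density also makes the extension unique, so the description in
  \<open>modular_conj\<close> resolves.\<close>

lemma
  shows J_continuous: "continuous_on UNIV J"
    and J_M: "m \<in> M \<Longrightarrow> J (m \<Omega>) = cadj m \<Omega>"
proof -
  let ?D = "(\<lambda>m. m \<Omega>) ` M"
  define f where "f v = cadj (THE m. m \<in> M \<and> m \<Omega> = v) \<Omega>" for v
  have f: "f (m \<Omega>) = cadj m \<Omega>" if "m \<in> M" for m
  proof -
    have "(THE n. n \<in> M \<and> n \<Omega> = m \<Omega>) = m"
      using that separating by blast
    then show ?thesis by (simp add: f_def)
  qed
  have "dist (f v) (f w) = dist v w" if v: "v \<in> ?D" and w: "w \<in> ?D" for v w
  proof -
    obtain m n where mn: "m \<in> M" "v = m \<Omega>" "n \<in> M" "w = n \<Omega>" using v w by auto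
    have "cinner (f v - f w) (f v - f w) = cinner (v - w) (v - w)"
      using mn by (simp add: f cinner_diff_left cinner_diff_right cadj_inner)
    then show ?thesis
      unfolding cinner_self dist_norm of_real_eq_iff by (simp add: power2_eq_iff_nonneg)
  qed
  then have "uniformly_continuous_on ?D f"
    unfolding uniformly_continuous_on_def by metis
  then obtain g where g: "uniformly_continuous_on (closure ?D) g" "\<And>x. x \<in> ?D \<Longrightarrow> f x = g x"
    by (rule uniformly_continuous_on_extension_on_closure) blast
  have gP: "continuous_on UNIV g \<and> (\<forall>m\<in>M. g (m \<Omega>) = cadj m \<Omega>)"
    using uniformly_continuous_imp_continuous[OF g(1)] g(2) f unfolding cyclic by force
  have "J = g"
    unfolding modular_conj_def
  proof (rule the_equality)
    show "continuous_on UNIV g \<and> (\<forall>m\<in>M. g (m \<Omega>) = cadj m \<Omega>)" by (rule gP)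
    fix h assume h: "continuous_on UNIV h \<and> (\<forall>m\<in>M. h (m \<Omega>) = cadj m \<Omega>)"
    have "h x = g x" for x
      by (rule dense_eqI) (use h gP in auto)
    then show "h = g" by blast
  qed
  then show "continuous_on UNIV J" "m \<in> M \<Longrightarrow> J (m \<Omega>) = cadj m \<Omega>"
    using gP by auto
qed

lemma J_comp_continuous: "continuous_on UNIV f \<Longrightarrow> continuous_on UNIV (\<lambda>x. J (f x))"
  using continuous_on_compose2[OF J_continuous] by blast

text \<open>\<open>cadj_inner\<close> extends by continuity one slot at a time.\<close>

lemma J_inner: "cinner (J x) (J y) = cinner y x"
proof -
  have 1: "cinner (J (m \<Omega>)) (J y) = cinner y (m \<Omega>)" if "m \<in> M" for m y
    by (rule dense_eqI) (use that in \<open>auto intro!: continuous_on_cinner J_continuous continuous_intros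
      simp: J_M cadj_inner\<close>)
  show ?thesis
    by (rule dense_eqI[where f = "\<lambda>x. cinner (J x) (J y)"])
      (auto intro!: continuous_on_cinner J_continuous continuous_intros simp: 1)
qed

lemma J_J [simp]: "J (J x) = x"
  by (rule dense_eqI) (auto intro!: J_comp_continuous J_continuous simp: J_M M_cadj cadj_cadj M_bounded)

lemma J_inner_left: "cinner (J x) y = cinner (J y) x"
  using J_inner[of x "J y"] by simp

lemma J_add: "J (x + y) = J x + J y"
proof (rule cinner_ext)
  fix z
  have "cinner (J (x + y)) z = cinner (J z) x + cinner (J z) y"
    unfolding J_inner_left[of "x + y"] cinner_add_right ..
  then show "cinner (J (x + y)) z = cinner (J x + J y) z"
    by (simp add: cinner_add_left J_inner_left[of z])
qed

lemma J_scaleC: "J (c *\<^sub>C x) = cnj c *\<^sub>C J x"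
  by (rule cinner_ext) (metis J_inner J_J cinner_scaleC_right cinner_scaleC_left)

lemma J_norm: "norm (J x) = norm x"
  by (rule norm_eqI_cinner) (rule J_inner)

lemma J_\<Omega>: "J \<Omega> = \<Omega>"
  using J_M[OF M_id] cadj_eqI[of "id :: 'h \<Rightarrow> 'h" id] by simp

lemma J_conj_bounded:
  assumes T: "bounded_clinear T"
  shows "bounded_clinear (J \<circ> T \<circ> J)"
proof -
  obtain C where C: "\<And>x. norm (T x) \<le> C * norm x" using bounded_clinear_bound[OF T] by blast
  show ?thesis
  proof (rule bounded_clinearI[of _ C])
    show "norm ((J \<circ> T \<circ> J) x) \<le> C * norm x" for x
      using C[of "J x"] by (simp add: J_norm)
  qed (simp_all add: J_add J_scaleC bounded_clinear_add[OF T] bounded_clinear_scaleC[OF T])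
qed

lemma J_conj_cadj:
  assumes T: "bounded_clinear T"
  shows "cadj (J \<circ> T \<circ> J) = J \<circ> cadj T \<circ> J"
proof (rule cadj_eqI)
  fix x y
  have "cinner (J (T (J x))) y = cinner (J y) (T (J x))"
    using J_inner[of "T (J x)" "J y"] by simp
  also have "\<dots> = cinner (cadj T (J y)) (J x)" using T by (simp add: cinner_cadj_left)
  also have "\<dots> = cinner x (J (cadj T (J y)))"
    using J_inner[of "J (cadj T (J y))" x] by simp
  finally show "cinner ((J \<circ> T \<circ> J) x) y = cinner x ((J \<circ> cadj T \<circ> J) y)" by simp
qed

text \<open>\<open>J \<circ> m \<circ> J\<close> acts on the orbit of \<Omega> as right
  multiplication by \<open>cadj m\<close>, and right multiplications commute with left ones.\<close>

lemma J_conj_M: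
  assumes m: "m \<in> M" shows "J \<circ> m \<circ> J \<in> commutant M"
proof (rule commutantI)
  let ?T = "J \<circ> m \<circ> J"
  show bT: "bounded_clinear ?T" by (rule J_conj_bounded[OF M_bounded[OF m]])
  have right: "?T (n \<Omega>) = n (cadj m \<Omega>)" if n: "n \<in> M" for n
  proof -
    have "?T (n \<Omega>) = J ((m \<circ> cadj n) \<Omega>)" using n by (simp add: J_M)
    also have "\<dots> = cadj (m \<circ> cadj n) \<Omega>" using m n by (intro J_M M_comp M_cadj)
    also have "\<dots> = n (cadj m \<Omega>)"
      using m n by (simp add: cadj_comp cadj_cadj M_bounded bounded_clinear_cadj)
    finally show ?thesis .
  qed
  fix s x assume s: "s \<in> M"
  have "(?T \<circ> s) x = (s \<circ> ?T) x"
  proof (rule operator_eqI[where S = "?T \<circ> s" and T = "s \<circ> ?T"])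
    show "(?T \<circ> s) (n \<Omega>) = (s \<circ> ?T) (n \<Omega>)" if "n \<in> M" for n
      using right[OF M_comp[OF s that]] right[OF that] by simp
  qed (intro bounded_clinear_comp[OF bT M_bounded[OF s]] bounded_clinear_comp[OF M_bounded[OF s] bT])+
  then show "?T (s x) = s (?T x)" by simp
qed

text \<open>Commuting past \<open>n\<close> moves \<open>x\<close> onto \<Omega> on the other side.
  The formula for the conjugation is thus the same on the commutant, so the argument of
  \<open>J_conj_M\<close> can be run with both algebras exchanged.\<close>

lemma J_comm:
  assumes x: "x \<in> commutant M" shows "J (x \<Omega>) = cadj x \<Omega>"
proof (rule cinner_ext)
  have bx: "bounded_clinear x" using x by (rule commutantD)
  fix z
  show "cinner (J (x \<Omega>)) z = cinner (cadj x \<Omega>) z"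
  proof (rule dense_eqI[where f = "cinner (J (x \<Omega>))"])
    fix n assume n: "n \<in> M"
    have "cinner (J (x \<Omega>)) (n \<Omega>) = cinner (J (n \<Omega>)) (x \<Omega>)" by (rule J_inner_left)
    also have "\<dots> = cinner \<Omega> (n (x \<Omega>))"
      using n by (simp add: J_M cinner_cadj_left M_bounded)
    also have "\<dots> = cinner \<Omega> (x (n \<Omega>))" using commutantD(2)[OF x n, of \<Omega>] by simp
    also have "\<dots> = cinner (cadj x \<Omega>) (n \<Omega>)" using bx by (simp add: cinner_cadj_left)
    finally show "cinner (J (x \<Omega>)) (n \<Omega>) = cinner (cadj x \<Omega>) (n \<Omega>)" .
  qed (auto intro!: continuous_on_cinner continuous_intros)
qed

lemma J_conj_comm:
  assumes x: "x \<in> commutant M" shows "J \<circ> x \<circ> J \<in> M"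
proof -
  let ?T = "J \<circ> x \<circ> J"
  have bT: "bounded_clinear ?T" by (rule J_conj_bounded[OF commutantD(1)[OF x]])
  have right: "?T (z \<Omega>) = z (cadj x \<Omega>)" if z: "z \<in> commutant M" for z
  proof -
    have "?T (z \<Omega>) = J ((x \<circ> cadj z) \<Omega>)" using z by (simp add: J_comm)
    also have "\<dots> = cadj (x \<circ> cadj z) \<Omega>" using x z by (intro J_comm commutant_comp comm_cadj)
    also have "\<dots> = z (cadj x \<Omega>)"
      using x z by (simp add: cadj_comp cadj_cadj commutantD bounded_clinear_cadj)
    finally show ?thesis .
  qed
  have "?T \<in> commutant (commutant M)"
  proof (rule commutantI[OF bT])
    fix y v assume y: "y \<in> commutant M"
    have "(?T \<circ> y) v = (y \<circ> ?T) v"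
    proof (rule operator_eqI[where S = "?T \<circ> y" and T = "y \<circ> ?T"])
      fix n assume n: "n \<in> M"
      \<comment> \<open>This element of the commutant sends \<Omega> to \<open>n \<Omega>\<close>,
        so the right multiplication formula, known on the commutant orbit, covers the dense set of
        all \<open>n \<Omega>\<close>.\<close>
      have z: "J \<circ> cadj n \<circ> J \<in> commutant M" by (rule J_conj_M[OF M_cadj[OF n]])
      have "(J \<circ> cadj n \<circ> J) \<Omega> = n \<Omega>"
        using n J_M[OF M_cadj[OF n]] by (simp add: J_\<Omega> cadj_cadj M_bounded)
      then show "(?T \<circ> y) (n \<Omega>) = (y \<circ> ?T) (n \<Omega>)"
        using right[OF z] right[OF commutant_comp[OF y z]] by simp
    qed (intro bounded_clinear_comp[OF bT commutantD(1)[OF y]] bounded_clinear_comp[OF commutantD(1)[OF y] bT])+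
    then show "?T (y v) = y (?T v)" by simp
  qed
  then show ?thesis by (simp add: bicommutant)
qed

end

section \<open>Normal endomorphisms\<close>

lemma vector_functional_in_predual: "(\<lambda>x. cinner (x \<xi>) \<eta>) \<in> predual M"
proof -
  define u v where "u n = (if n = 0 then \<xi> else 0)" and "v n = (if n = 0 then \<eta> else 0)" for n :: nat
  have "summable (\<lambda>n. (norm (u n))\<^sup>2)" "summable (\<lambda>n. (norm (v n))\<^sup>2)"
    by (rule summable_finite[of "{0}"]; simp add: u_def v_def)+
  moreover have "cinner (x \<xi>) \<eta> = (\<Sum>n. cinner (x (u n)) (v n))" for x
    using suminf_finite[of "{0}" "\<lambda>n. cinner (x (u n)) (v n)"] by (simp add: u_def v_def)
  ultimately show ?thesis unfolding predual_def by blast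
qed

text \<open>Cauchy-Schwarz termwise: \<open>C\<close> is the sum of the products of the norms of the
  defining vectors. \<open>K\<close> stands for any bound on \<open>x\<close>. Applied to a
  functional composed with an endomorphism, this turns normality into a norm estimate.\<close>

lemma predual_bounded:
  assumes "\<rho> \<in> predual M"
  obtains C where "\<And>x K. \<lbrakk>x \<in> M; 0 \<le> K; \<And>v. norm (x v) \<le> K * norm v\<rbrakk> \<Longrightarrow> cmod (\<rho> x) \<le> K * C"
proof -
  obtain \<xi> \<eta> :: "nat \<Rightarrow> 'a" where sm: "summable (\<lambda>n. (norm (\<xi> n))\<^sup>2)" "summable (\<lambda>n. (norm (\<eta> n))\<^sup>2)"
    and \<rho>: "\<And>x. x \<in> M \<Longrightarrow> \<rho> x = (\<Sum>n. cinner (x (\<xi> n)) (\<eta> n))"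
    using assms unfolding predual_def by blast
  have s: "summable (\<lambda>n. norm (\<xi> n) * norm (\<eta> n))"
  proof (rule summable_comparison_test'[OF summable_add[OF sm]])
    fix n
    show "norm (norm (\<xi> n) * norm (\<eta> n)) \<le> (norm (\<xi> n))\<^sup>2 + (norm (\<eta> n))\<^sup>2"
      using sum_squares_bound[of "norm (\<xi> n)" "norm (\<eta> n)"]
        mult_nonneg_nonneg[OF norm_ge_zero[of "\<xi> n"] norm_ge_zero[of "\<eta> n"]]
      unfolding real_norm_def abs_mult abs_norm_cancel by linarith
  qed
  show thesis
  proof (rule that[of "\<Sum>n. norm (\<xi> n) * norm (\<eta> n)"])
    fix x K assume x: "x \<in> M" and K: "0 \<le> K" "\<And>v. norm (x v) \<le> K * norm v"
    have "cmod (cinner (x (\<xi> n)) (\<eta> n)) \<le> K * (norm (\<xi> n) * norm (\<eta> n))" for n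
      using cinner_Cauchy_Schwarz[of "x (\<xi> n)" "\<eta> n"] mult_right_mono[OF K(2)[of "\<xi> n"], of "norm (\<eta> n)"]
      by (simp add: mult.assoc)
    then have "cmod (\<rho> x) \<le> (\<Sum>n. K * (norm (\<xi> n) * norm (\<eta> n)))"
      unfolding \<rho>[OF x] by (intro norm_suminf_le summable_mult s)
    then show "cmod (\<rho> x) \<le> K * (\<Sum>n. norm (\<xi> n) * norm (\<eta> n))"
      using suminf_mult[OF s] by simp
  qed
qed

text \<open>Roots of growing order send \<open>C\<close> to 1. Concretely, if \<open>x\<close> were
  larger, powers of x / y would outgrow \<open>C\<close>.\<close>

lemma le_of_power_le:
  fixes x y C :: real
  assumes "0 \<le> x" "0 \<le> y" and le: "\<And>n. x ^ (2 ^ n) \<le> C * y ^ (2 ^ n)"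
  shows "x \<le> y"
proof (rule ccontr)
  assume "\<not> x \<le> y"
  then have xy: "y < x" by simp
  show False
  proof (cases "y = 0")
    case True
    then show False using le[of 0] xy by simp
  next
    case False
    then have y: "y > 0" using assms by simp
    then have r: "x / y > 1" using xy by simp
    obtain k where k: "C < (x / y) ^ k" using real_arch_pow[OF r] by blast
    have "(x / y) ^ k \<le> (x / y) ^ (2 ^ k)"
      using r by (intro power_increasing) (auto simp: less_imp_le)
    also have "\<dots> \<le> C" using le[of k] y by (simp add: power_divide pos_divide_le_eq)
    finally show False using k by simp
  qed
qed

text \<open>The squared norm of \<open>cadj T x\<close> is the inner product of
  \<open>T (cadj T x)\<close> with \<open>x\<close>; one factor cancels.\<close>

lemma cadj_bound:
  assumes T: "bounded_clinear T" and K: "\<And>x. norm (T x) \<le> K * norm x"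
  shows "norm (cadj T x) \<le> K * norm x"
proof (cases "cadj T x = 0")
  case True
  then show ?thesis using K[of x] norm_ge_zero[of "T x"] by (metis norm_zero order_trans)
next
  case False
  have "complex_of_real ((norm (cadj T x))\<^sup>2) = cinner (T (cadj T x)) x"
    unfolding cinner_self[symmetric] using T by (simp add: cinner_cadj)
  then have "(norm (cadj T x))\<^sup>2 = cmod (cinner (T (cadj T x)) x)"
    by (metis norm_of_real abs_of_nonneg zero_le_power2)
  also have "\<dots> \<le> norm (T (cadj T x)) * norm x" by (rule cinner_Cauchy_Schwarz)
  also have "\<dots> \<le> (K * norm (cadj T x)) * norm x" using K by (rule mult_right_mono) simp
  finally have "norm (cadj T x) * norm (cadj T x) \<le> (K * norm x) * norm (cadj T x)"
    by (simp add: power2_eq_square mult_ac)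
  then show ?thesis using False by simp
qed

locale normal_endo = standard_form M \<Omega> for M :: "('h::complex_hilbert \<Rightarrow> 'h) set" and \<Omega> +
  fixes \<theta> :: "('h \<Rightarrow> 'h) \<Rightarrow> ('h \<Rightarrow> 'h)"
  assumes endo: "normal_unital_star_endo M \<theta>"
begin

lemma endo_into: "x \<in> M \<Longrightarrow> \<theta> x \<in> M"
  and endo_comp: "\<lbrakk>x \<in> M; y \<in> M\<rbrakk> \<Longrightarrow> \<theta> (x \<circ> y) = \<theta> x \<circ> \<theta> y"
  and endo_cadj: "x \<in> M \<Longrightarrow> \<theta> (cadj x) = cadj (\<theta> x)"
  and endo_id: "\<theta> id = id"
  and endo_normal: "\<rho> \<in> predual M \<Longrightarrow> \<rho> \<circ> \<theta> \<in> predual M"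
  using endo by (auto simp: normal_unital_star_endo_def)

lemma endo_pow: "x \<in> M \<Longrightarrow> x ^^ k \<in> M \<and> \<theta> (x ^^ k) = \<theta> x ^^ k"
  by (induction k) (simp_all add: M_id endo_id M_comp endo_comp flip: id_def)

text \<open>Iterating the Cauchy--Schwarz inequality
  \<open>\<parallel>y\<^sup>k \<xi>\<parallel>\<^sup>2 = \<langle>y\<^sup>2\<^sup>k \<xi>, \<xi>\<rangle> \<le> \<parallel>y\<^sup>2\<^sup>k \<xi>\<parallel> \<parallel>\<xi>\<parallel>\<close> for \<open>y = \<theta> x\<close> turns the bound
  \<open>\<langle>y\<^sup>n \<xi>, \<xi>\<rangle> \<le> C \<parallel>x\<parallel>\<^sup>n\<close> coming from normality, where \<open>C\<close> depends on \<open>\<xi>\<close>, into \<open>\<parallel>y \<xi>\<parallel> \<le> \<parallel>x\<parallel> \<parallel>\<xi>\<parallel>\<close>.\<close>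

lemma endo_contractive_self_adjoint:
  assumes x: "x \<in> M" "cadj x = x" and K: "0 \<le> K" "\<And>v. norm (x v) \<le> K * norm v"
  shows "norm (\<theta> x \<xi>) \<le> K * norm \<xi>"
proof (cases "\<xi> = 0")
  case True
  then show ?thesis
    using bounded_clinear_scaleC[OF M_bounded[OF endo_into[OF x(1)]], of 0 0] by simp
next
  case False
  define y where "y = \<theta> x"
  define b where "b k = norm ((y ^^ k) \<xi>)" for k
  have y: "bounded_clinear y" "cadj y = y"
    using M_bounded[OF endo_into[OF x(1)]] endo_cadj[OF x(1)] x(2) by (simp_all add: y_def)
  have move: "cinner ((y ^^ k) v) w = cinner v ((y ^^ k) w)" for k v w
    by (induction k arbitrary: v w) (simp_all add: cinner_cadj[OF y(1)] y(2) funpow_swap1)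
  have b2: "complex_of_real ((b k)\<^sup>2) = cinner ((y ^^ (2 * k)) \<xi>) \<xi>" for k
    unfolding b_def cinner_self[symmetric] mult_2 funpow_add comp_apply by (rule move[symmetric])
  have b2_norm: "(b k)\<^sup>2 = cmod (cinner ((y ^^ (2 * k)) \<xi>) \<xi>)" for k
    unfolding b2[symmetric] norm_of_real by simp
  have b_pos: "0 \<le> b k" for k by (simp add: b_def)
  have b0: "b 0 > 0" using False by (simp add: b_def)
  obtain C where C: "\<And>x K. \<lbrakk>x \<in> M; 0 \<le> K; \<And>v. norm (x v) \<le> K * norm v\<rbrakk> \<Longrightarrow>
      cmod (((\<lambda>x. cinner (x \<xi>) \<xi>) \<circ> \<theta>) x) \<le> K * C"
    using predual_bounded[OF endo_normal[OF vector_functional_in_predual]] by blast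
  have pow_bound: "norm ((x ^^ k) v) \<le> K ^ k * norm v" for k v
  proof (induction k)
    case (Suc k)
    have "norm (x ((x ^^ k) v)) \<le> K * (K ^ k * norm v)"
      using K(2)[of "(x ^^ k) v"] mult_left_mono[OF Suc K(1)] by linarith
    then show ?case by (simp add: mult.assoc)
  qed simp
  have b_upper: "(b k)\<^sup>2 \<le> C * (K\<^sup>2) ^ k" for k
  proof -
    have pow: "x ^^ (2 * k) \<in> M" "\<theta> (x ^^ (2 * k)) = y ^^ (2 * k)"
      using endo_pow[OF x(1), of "2 * k"] by (simp_all add: y_def)
    have "cmod (((\<lambda>x. cinner (x \<xi>) \<xi>) \<circ> \<theta>) (x ^^ (2 * k))) \<le> K ^ (2 * k) * C"
      by (rule C[OF pow(1)]) (use K(1) pow_bound in auto)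
    then show ?thesis
      unfolding b2_norm comp_apply pow(2) power_mult mult.commute[of C] .
  qed
  have double: "(b k)\<^sup>2 \<le> b (2 * k) * b 0" for k
    unfolding b2_norm using cinner_Cauchy_Schwarz[of "(y ^^ (2 * k)) \<xi>" \<xi>] by (simp add: b_def)
  \<comment> \<open>After division by \<open>b 0\<close>, \<open>double\<close> says that the ratio
    at twice the index dominates the squared ratio, which iterates cleanly.\<close>
  have iter: "(b 1 / b 0) ^ (2 ^ n) \<le> b (2 ^ n) / b 0" for n
  proof (induction n)
    case (Suc n)
    have "(b 1 / b 0) ^ (2 ^ Suc n) = ((b 1 / b 0) ^ (2 ^ n))\<^sup>2"
      by (simp add: power_mult[symmetric] mult.commute)
    also have "\<dots> \<le> (b (2 ^ n) / b 0)\<^sup>2"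
      using Suc b_pos b0 by (intro power_mono) auto
    also have "\<dots> \<le> b (2 ^ Suc n) / b 0"
      using double[of "2 ^ n"] b0 by (simp add: power_divide power2_eq_square field_simps)
    finally show ?case .
  qed simp
  \<comment> \<open>Squares are kept because \<open>b_upper\<close> bounds squares. The factor in
    front depends on \<open>\<xi>\<close> but not on \<open>n\<close>, so
    \<open>le_of_power_le\<close> removes it.\<close>
  have "((b 1 / b 0)\<^sup>2) ^ (2 ^ n) \<le> (C / (b 0)\<^sup>2) * (K\<^sup>2) ^ (2 ^ n)" for n
  proof -
    have "((b 1 / b 0)\<^sup>2) ^ (2 ^ n) = ((b 1 / b 0) ^ (2 ^ n))\<^sup>2"
      by (simp add: power_mult[symmetric] mult.commute)
    also have "\<dots> \<le> (b (2 ^ n) / b 0)\<^sup>2"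
      using iter[of n] b_pos b0 by (intro power_mono) auto
    also have "\<dots> \<le> (C * (K\<^sup>2) ^ (2 ^ n)) / (b 0)\<^sup>2"
      using b_upper[of "2 ^ n"] b0 by (simp add: power_divide divide_right_mono)
    finally show ?thesis by simp
  qed
  then have "(b 1 / b 0)\<^sup>2 \<le> K\<^sup>2"
    by (rule le_of_power_le[OF zero_le_power2 zero_le_power2])
  then have "b 1 / b 0 \<le> K" by (rule power2_le_imp_le) (rule K(1))
  then show ?thesis using b0 by (simp add: b_def y_def pos_divide_le_eq)
qed

lemma endo_norm_square:
  assumes "x \<in> M" shows "complex_of_real ((norm (\<theta> x \<xi>))\<^sup>2) = cinner (\<theta> (cadj x \<circ> x) \<xi>) \<xi>"
  unfolding cinner_self[symmetric]
  using assms by (simp add: endo_comp M_cadj endo_cadj cinner_cadj_left M_bounded endo_into)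

text \<open>Reduction to the self-adjoint operator \<open>cadj x \<circ> x\<close>, bounded by the
  square of \<open>K\<close>, through \<open>endo_norm_square\<close>.\<close>

lemma endo_contractive:
  assumes x: "x \<in> M" and K: "0 \<le> K" "\<And>v. norm (x v) \<le> K * norm v"
  shows "norm (\<theta> x \<xi>) \<le> K * norm \<xi>"
proof -
  let ?a = "cadj x \<circ> x"
  have bx: "bounded_clinear x" using x by (rule M_bounded)
  have "norm (?a v) \<le> K\<^sup>2 * norm v" for v
    using cadj_bound[OF bx K(2), of "x v"] mult_left_mono[OF K(2)[of v] K(1)]
    by (simp add: power2_eq_square mult.assoc)
  then have a: "norm (\<theta> ?a \<xi>) \<le> K\<^sup>2 * norm \<xi>"
    using x bx by (intro endo_contractive_self_adjoint)
      (auto simp: M_comp M_cadj cadj_comp cadj_cadj bounded_clinear_cadj)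
  have "(norm (\<theta> x \<xi>))\<^sup>2 = cmod (cinner (\<theta> ?a \<xi>) \<xi>)"
    unfolding endo_norm_square[OF x, symmetric] norm_of_real by simp
  also have "\<dots> \<le> norm (\<theta> ?a \<xi>) * norm \<xi>" by (rule cinner_Cauchy_Schwarz)
  also have "\<dots> \<le> (K\<^sup>2 * norm \<xi>) * norm \<xi>" using a by (rule mult_right_mono) simp
  also have "\<dots> = (K * norm \<xi>)\<^sup>2" by (simp add: power2_eq_square mult_ac)
  finally show ?thesis by (rule power2_le_imp_le) (use K in simp)
qed

end

section \<open>Intertwiner spaces\<close>

text \<open>Replacing \<open>w n\<close> by its limit costs at most \<open>C\<close> times a null
  sequence, and weak convergence handles the fixed vector that remains.\<close>

lemma tendsto_cinner_weak_strong:
  fixes u w :: "nat \<Rightarrow> 'h::complex_hilbert"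
  assumes weak: "\<And>y. (\<lambda>n. cinner (u n) y) \<longlonglongrightarrow> cinner x y" and bound: "\<And>n. norm (u n) \<le> C"
    and strong: "w \<longlonglongrightarrow> y"
  shows "(\<lambda>n. cinner (u n) (w n)) \<longlonglongrightarrow> cinner x y"
proof -
  have "(\<lambda>n. cinner (u n) (w n - y)) \<longlonglongrightarrow> 0"
  proof (rule Lim_null_comparison)
    show "\<forall>\<^sub>F n in sequentially. cmod (cinner (u n) (w n - y)) \<le> C * norm (w n - y)"
      using order_trans[OF cinner_Cauchy_Schwarz mult_right_mono[OF bound norm_ge_zero]] by simp
    show "(\<lambda>n. C * norm (w n - y)) \<longlonglongrightarrow> 0"
      using tendsto_mult_left[OF tendsto_norm[OF LIM_zero[OF strong]], of C] by simp
  qed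
  from tendsto_add[OF weak[of y] this] show ?thesis by (simp add: cinner_diff_right)
qed

text \<open>The common ground of the semigroup on \<open>M\<close> and its complementary semigroup
  on the commutant, so that algebra and limit arguments are carried out once.
  \<open>act_tendsto\<close> is joint continuity in time and vector, in terms of sequences.\<close>

locale star_action =
  fixes N :: "('h::complex_hilbert \<Rightarrow> 'h) set" and \<beta> :: "real \<Rightarrow> ('h \<Rightarrow> 'h) \<Rightarrow> ('h \<Rightarrow> 'h)"
  assumes op_bounded: "m \<in> N \<Longrightarrow> bounded_clinear m"
    and op_cadj: "m \<in> N \<Longrightarrow> cadj m \<in> N"
    and act_closed: "\<lbrakk>0 \<le> t; m \<in> N\<rbrakk> \<Longrightarrow> \<beta> t m \<in> N"
    and act_cadj: "\<lbrakk>0 \<le> t; m \<in> N\<rbrakk> \<Longrightarrow> \<beta> t (cadj m) = cadj (\<beta> t m)"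
    and act_add: "\<lbrakk>0 \<le> s; 0 \<le> t; m \<in> N\<rbrakk> \<Longrightarrow> \<beta> (s + t) m = \<beta> s (\<beta> t m)"
    and act_tendsto: "\<lbrakk>m \<in> N; \<And>n. 0 \<le> u n; u \<longlonglongrightarrow> t; v \<longlonglongrightarrow> x\<rbrakk> \<Longrightarrow>
      (\<lambda>n. \<beta> (u n) m (v n)) \<longlonglongrightarrow> \<beta> t m x"
begin

lemma intertwinersD:
  "T \<in> intertwiners N \<beta> t \<Longrightarrow> bounded_clinear T"
  "\<lbrakk>T \<in> intertwiners N \<beta> t; m \<in> N\<rbrakk> \<Longrightarrow> \<beta> t m (T x) = T (m x)"
  by (auto simp: intertwiners_def comp_def fun_eq_iff)

lemma intertwinersI:
  "\<lbrakk>bounded_clinear T; \<And>m x. m \<in> N \<Longrightarrow> \<beta> t m (T x) = T (m x)\<rbrakk> \<Longrightarrow> T \<in> intertwiners N \<beta> t"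
  by (auto simp: intertwiners_def)

lemma act_bounded: "\<lbrakk>0 \<le> t; m \<in> N\<rbrakk> \<Longrightarrow> bounded_clinear (\<beta> t m)"
  by (simp add: op_bounded act_closed)

lemma intertwiners_zero: "0 \<le> t \<Longrightarrow> (\<lambda>v. 0) \<in> intertwiners N \<beta> t"
  using act_bounded by (intro intertwinersI bounded_clinear_zero)
    (metis bounded_clinear_scaleC scaleC_zero)

lemma intertwiners_add:
  "\<lbrakk>0 \<le> t; S \<in> intertwiners N \<beta> t; T \<in> intertwiners N \<beta> t\<rbrakk> \<Longrightarrow> (\<lambda>v. S v + T v) \<in> intertwiners N \<beta> t"
  by (rule intertwinersI)
    (simp_all add: intertwinersD bounded_clinear_sum bounded_clinear_add[OF act_bounded])

lemma intertwiners_scale: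
  "\<lbrakk>0 \<le> t; T \<in> intertwiners N \<beta> t\<rbrakk> \<Longrightarrow> (\<lambda>v. c *\<^sub>C T v) \<in> intertwiners N \<beta> t"
  by (rule intertwinersI)
    (simp_all add: intertwinersD bounded_clinear_scale bounded_clinear_scaleC[OF act_bounded])

lemma intertwiners_comp:
  assumes "0 \<le> s" "0 \<le> t" "S \<in> intertwiners N \<beta> s" "T \<in> intertwiners N \<beta> t"
  shows "S \<circ> T \<in> intertwiners N \<beta> (s + t)"
  by (rule intertwinersI)
    (use assms in \<open>simp_all add: intertwinersD act_add act_closed bounded_clinear_comp\<close>)

lemma act_move:
  assumes "0 \<le> t" "m \<in> N"
  shows "cinner (\<beta> t m x) y = cinner x (\<beta> t (cadj m) y)"
  using assms by (simp add: cinner_cadj act_bounded act_cadj)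

text \<open>\<open>m\<close> passes through \<open>S\<close> as \<open>\<beta> t m\<close>; moved to
  the other side it becomes \<open>\<beta> t (cadj m)\<close>, which \<open>T\<close> turns back
  into \<open>cadj m\<close>.\<close>

lemma cadj_comp_commutant:
  assumes t: "0 \<le> t" and S: "S \<in> intertwiners N \<beta> t" and T: "T \<in> intertwiners N \<beta> t"
  shows "cadj T \<circ> S \<in> commutant N"
proof (rule commutantI)
  show "bounded_clinear (cadj T \<circ> S)"
    using S T by (simp add: intertwinersD bounded_clinear_comp bounded_clinear_cadj)
  fix m x assume m: "m \<in> N"
  have "cinner (cadj T (S (m x))) y = cinner (m (cadj T (S x))) y" for y
  proof -
    have "cinner (cadj T (S (m x))) y = cinner (\<beta> t m (S x)) (T y)"
      using S T m by (simp add: intertwinersD cinner_cadj_left)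
    also have "\<dots> = cinner (S x) (T (cadj m y))"
      using T m t by (simp add: act_move op_cadj intertwinersD)
    also have "\<dots> = cinner (m (cadj T (S x))) y"
      using T m by (simp add: cinner_cadj_left cinner_cadj intertwinersD op_bounded)
    finally show ?thesis .
  qed
  then show "(cadj T \<circ> S) (m x) = m ((cadj T \<circ> S) x)"
    unfolding comp_apply by (rule cinner_ext)
qed

text \<open>The vectors \<open>S n x\<close> converge only weakly, so the time-dependent operator is
  moved to the other side of the inner product, where it acts on a fixed vector and converges in
  norm.\<close>

lemma intertwiners_weak_limit:
  assumes u: "\<And>n. 0 \<le> u n" "u \<longlonglongrightarrow> t" and S: "\<And>n. S n \<in> intertwiners N \<beta> (u n)"
    and bound: "\<And>n x. norm (S n x) \<le> C * norm x" and T: "bounded_clinear T"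
    and weak: "\<And>x y. (\<lambda>n. cinner (S n x) y) \<longlonglongrightarrow> cinner (T x) y"
  shows "T \<in> intertwiners N \<beta> t"
proof (rule intertwinersI[OF T])
  have t: "0 \<le> t" using u by (meson LIMSEQ_le_const)
  fix m x assume m: "m \<in> N"
  have "cinner (\<beta> t m (T x)) y = cinner (T (m x)) y" for y
  proof -
    have "(\<lambda>n. cinner (S n x) (\<beta> (u n) (cadj m) y)) \<longlonglongrightarrow> cinner (T x) (\<beta> t (cadj m) y)"
      by (rule tendsto_cinner_weak_strong[OF weak bound])
        (rule act_tendsto[OF op_cadj[OF m] u(1,2) tendsto_const])
    moreover have "cinner (S n x) (\<beta> (u n) (cadj m) y) = cinner (S n (m x)) y" for n
      using act_move[OF u(1)[of n] m, of "S n x" y] intertwinersD(2)[OF S m] by simp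
    ultimately have "cinner (T x) (\<beta> t (cadj m) y) = cinner (T (m x)) y"
      using weak[of "m x" y] by (simp add: LIMSEQ_unique)
    then show ?thesis using act_move[OF t m] by simp
  qed
  then show "\<beta> t m (T x) = T (m x)" by (rule cinner_ext)
qed

end

text \<open>Factoriality enters as \<open>scalar\<close>: when \<open>N\<close> is the commutant of
  \<open>M\<close>, an operator commuting with both lies in the centre.\<close>

locale intertwining = A: star_action M \<beta> + B: star_action N \<gamma>
  for M N :: "('h::{complex_hilbert, second_countable_topology} \<Rightarrow> 'h) set" and \<beta> \<gamma> +
  fixes \<Omega> :: 'h
  assumes scalar: "\<lbrakk>T \<in> commutant M; T \<in> commutant N\<rbrakk> \<Longrightarrow> \<exists>c. T = (\<lambda>x. c *\<^sub>C x)"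
    and cyclic: "closure ((\<lambda>m. m \<Omega>) ` M) = UNIV"
    and norm_\<Omega>: "norm \<Omega> = 1"
begin

definition E :: "real \<Rightarrow> ('h \<Rightarrow> 'h) set" where
  "E t = intertwiners M \<beta> t \<inter> intertwiners N \<gamma> t"

text \<open>This and \<open>mult\<close> copy the given fibres and multiplication for abstract
  actions; the theorem identifies them by unfolding.\<close>

definition fibre :: "real \<Rightarrow> ('h \<Rightarrow> 'h) hspace" where
  "fibre t = \<lparr>hcarrier = E t, hzero = (\<lambda>v. 0), hadd = (\<lambda>S T v. S v + T v),
     hscale = (\<lambda>c T v. c *\<^sub>C T v), hinner = (\<lambda>S T. THE c. cadj T \<circ> S = (\<lambda>v. c *\<^sub>C v))\<rparr>"

lemma fibre_simps [simp]:
  "hcarrier (fibre t) = E t" "hzero (fibre t) = (\<lambda>v. 0)" "hadd (fibre t) S T = (\<lambda>v. S v + T v)"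
  "hscale (fibre t) c T = (\<lambda>v. c *\<^sub>C T v)"
  by (simp_all add: fibre_def)

lemma E_bounded: "T \<in> E t \<Longrightarrow> bounded_clinear T"
  by (auto simp: E_def dest: A.intertwinersD(1))

lemma E_comp: "\<lbrakk>0 \<le> s; 0 \<le> t; S \<in> E s; T \<in> E t\<rbrakk> \<Longrightarrow> S \<circ> T \<in> E (s + t)"
  by (simp add: E_def A.intertwiners_comp B.intertwiners_comp)

lemma E_scalar:
  assumes "0 \<le> t" "S \<in> E t" "T \<in> E t"
  shows "cadj T \<circ> S = (\<lambda>v. cinner (S \<Omega>) (T \<Omega>) *\<^sub>C v)"
proof -
  obtain c where c: "cadj T \<circ> S = (\<lambda>v. c *\<^sub>C v)"
    using scalar[of "cadj T \<circ> S"] A.cadj_comp_commutant[of t S T] B.cadj_comp_commutant[of t S T] assms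
    by (auto simp: E_def)
  have "cinner (S \<Omega>) (T \<Omega>) = cinner ((cadj T \<circ> S) \<Omega>) \<Omega>"
    using E_bounded[OF assms(3)] by (simp add: cinner_cadj_left)
  also have "\<dots> = c" unfolding c by (simp add: cinner_scaleC_left cinner_self norm_\<Omega>)
  finally show ?thesis using c by simp
qed

lemma E_inner:
  assumes "0 \<le> t" "S \<in> E t" "T \<in> E t"
  shows "cinner (S x) (T y) = cinner (S \<Omega>) (T \<Omega>) * cinner x y"
  using fun_cong[OF E_scalar[OF assms], of x] cinner_cadj_left[OF E_bounded[OF assms(3)], of "S x" y]
  by (simp add: cinner_scaleC_left)

lemma E_norm:
  assumes "0 \<le> t" "S \<in> E t" shows "norm (S x) = norm (S \<Omega>) * norm x"
proof -
  have "complex_of_real ((norm (S x))\<^sup>2) =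
      complex_of_real ((norm (S \<Omega>))\<^sup>2) * complex_of_real ((norm x)\<^sup>2)"
    using E_inner[OF assms(1,2,2), of x x] by (simp only: cinner_self)
  then have "(norm (S x))\<^sup>2 = (norm (S \<Omega>) * norm x)\<^sup>2"
    by (simp only: of_real_mult[symmetric] of_real_eq_iff power_mult_distrib)
  then show ?thesis by (simp add: power2_eq_iff_nonneg)
qed

lemma fibre_inner:
  assumes "0 \<le> t" "S \<in> E t" "T \<in> E t"
  shows "hinner (fibre t) S T = cinner (S \<Omega>) (T \<Omega>)"
proof -
  have "(THE c. cadj T \<circ> S = (\<lambda>v. c *\<^sub>C v)) = cinner (S \<Omega>) (T \<Omega>)"
  proof (rule the_equality)
    show "cadj T \<circ> S = (\<lambda>v. cinner (S \<Omega>) (T \<Omega>) *\<^sub>C v)" by (rule E_scalar[OF assms])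
    fix c assume "cadj T \<circ> S = (\<lambda>v. c *\<^sub>C v)"
    then have "c *\<^sub>C \<Omega> = cinner (S \<Omega>) (T \<Omega>) *\<^sub>C \<Omega>"
      using E_scalar[OF assms] by (metis (no_types))
    then have "cinner (c *\<^sub>C \<Omega>) \<Omega> = cinner (cinner (S \<Omega>) (T \<Omega>) *\<^sub>C \<Omega>) \<Omega>" by simp
    then show "c = cinner (S \<Omega>) (T \<Omega>)" by (simp add: cinner_scaleC_left cinner_self norm_\<Omega>)
  qed
  then show ?thesis by (simp add: fibre_def)
qed

lemma E_zero: "0 \<le> t \<Longrightarrow> (\<lambda>v. 0) \<in> E t"
  by (simp add: E_def A.intertwiners_zero B.intertwiners_zero)

lemma E_add: "\<lbrakk>0 \<le> t; S \<in> E t; T \<in> E t\<rbrakk> \<Longrightarrow> (\<lambda>v. S v + T v) \<in> E t"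
  by (simp add: E_def A.intertwiners_add B.intertwiners_add)

lemma E_scale: "\<lbrakk>0 \<le> t; T \<in> E t\<rbrakk> \<Longrightarrow> (\<lambda>v. c *\<^sub>C T v) \<in> E t"
  by (simp add: E_def A.intertwiners_scale B.intertwiners_scale)

text \<open>The difference is again in the fibre, and \<open>E_norm\<close> controls it by its value
  at \<Omega>.\<close>

lemma E_eqI:
  assumes t: "0 \<le> t" and S: "S \<in> E t" and T: "T \<in> E t" and eq: "S \<Omega> = T \<Omega>"
  shows "S = T"
proof
  fix x
  have D: "(\<lambda>v. S v + (- 1) *\<^sub>C T v) \<in> E t"
    using E_add[OF t S E_scale[OF t T]] .
  show "S x = T x"
    using E_norm[OF t D, of x] eq by simp
qed

text \<open>By \<open>E_norm\<close> a bound at \<Omega> is an operator bound, so weak operator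
  compactness applies; each of the two intertwining relations survives the limit.\<close>

lemma E_weakly_compact:
  assumes u: "\<And>n. 0 \<le> u n" "u \<longlonglongrightarrow> t" and S: "\<And>n. S n \<in> E (u n)" and bound: "\<And>n. norm (S n \<Omega>) \<le> C"
  obtains r T where "strict_mono (r :: nat \<Rightarrow> nat)" "T \<in> E t"
    "\<And>x y. (\<lambda>n. cinner (S (r n) x) y) \<longlonglongrightarrow> cinner (T x) y"
proof -
  have le: "norm (S n x) \<le> C * norm x" for n x
    using mult_right_mono[OF bound[of n] norm_ge_zero[of x]] E_norm[OF u(1)[of n] S[of n], of x] by simp
  obtain r T where r: "strict_mono r" and T: "bounded_clinear T"
    "\<And>x y. (\<lambda>n. cinner (S (r n) x) y) \<longlonglongrightarrow> cinner (T x) y"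
    using weak_operator_compactness[where S = S, OF E_bounded[OF S] le] by blast
  have ur: "(\<lambda>n. u (r n)) \<longlonglongrightarrow> t"
    using LIMSEQ_subseq_LIMSEQ[OF u(2) r] by (simp add: o_def)
  have "T \<in> intertwiners M \<beta> t"
    by (rule A.intertwiners_weak_limit[OF u(1) ur _ le T]) (use S in \<open>auto simp: E_def\<close>)
  moreover have "T \<in> intertwiners N \<gamma> t"
    by (rule B.intertwiners_weak_limit[OF u(1) ur _ le T]) (use S in \<open>auto simp: E_def\<close>)
  ultimately show thesis using that r T(2) by (auto simp: E_def)
qed

text \<open>Compactness gives a weak limit \<open>T\<close> of a subsequence, which is an
  intertwiner. Separately, \<open>S n (m \<Omega>)\<close> equals
  \<open>\<beta> (u n) m (S n \<Omega>)\<close>, which converges in norm; the uniform bound extends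
  norm convergence from these dense vectors to all, and the limit must be \<open>T\<close>.\<close>

lemma E_closed:
  assumes u: "\<And>n. 0 \<le> u n" "u \<longlonglongrightarrow> t" and S: "\<And>n. S n \<in> E (u n)" and lim: "(\<lambda>n. S n \<Omega>) \<longlonglongrightarrow> \<xi>"
  obtains T where "T \<in> E t" "T \<Omega> = \<xi>" "\<And>x. (\<lambda>n. S n x) \<longlonglongrightarrow> T x"
proof -
  obtain C where C: "\<And>n. norm (S n \<Omega>) \<le> C"
    using convergent_imp_Bseq[of "\<lambda>n. S n \<Omega>"] lim unfolding convergent_def Bseq_def by blast
  obtain r T where r: "strict_mono (r :: nat \<Rightarrow> nat)" and T: "T \<in> E t"
    and weak: "\<And>x y. (\<lambda>n. cinner (S (r n) x) y) \<longlonglongrightarrow> cinner (T x) y"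
    using E_weakly_compact[OF u S C] by blast
  \<comment> \<open>A norm limit of the whole sequence is also a weak limit of the subsequence, so
    it agrees with \<open>T\<close>.\<close>
  have T_eq: "T x = l" if "(\<lambda>n. S n x) \<longlonglongrightarrow> l" for x l
  proof (rule cinner_ext)
    fix y
    have "(\<lambda>n. S (r n) x) \<longlonglongrightarrow> l"
      using LIMSEQ_subseq_LIMSEQ[OF that r] by (simp add: o_def)
    then have "(\<lambda>n. cinner (S (r n) x) y) \<longlonglongrightarrow> cinner l y"
      by (intro tendsto_cinner tendsto_const)
    then show "cinner (T x) y = cinner l y" using weak LIMSEQ_unique by blast
  qed
  have "convergent (\<lambda>n. S n x)" for x
  proof (rule convergent_on_dense[where f = S and K = C, OF _ cyclic])
    show "dist (S n x) (S n y) \<le> C * dist x y" for n x y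
      using mult_right_mono[OF C[of n] norm_ge_zero[of "x - y"]]
      by (simp add: dist_norm bounded_clinear_diff[OF E_bounded[OF S], symmetric] E_norm[OF u(1)[of n] S[of n], of "x - y"])
    fix x assume "x \<in> (\<lambda>m. m \<Omega>) ` M"
    then obtain m where m: "m \<in> M" "x = m \<Omega>" by auto
    have "S n x = \<beta> (u n) m (S n \<Omega>)" for n
      using A.intertwinersD(2)[of "S n" "u n" m] S[of n] m by (simp add: E_def)
    moreover have "(\<lambda>n. \<beta> (u n) m (S n \<Omega>)) \<longlonglongrightarrow> \<beta> t m \<xi>"
      using A.act_tendsto[OF m(1) u lim] .
    ultimately show "convergent (\<lambda>n. S n x)" by (auto simp: convergent_def)
  qed
  then have "(\<lambda>n. S n x) \<longlonglongrightarrow> T x" for x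
    using T_eq by (metis convergent_def)
  then show thesis using that[OF T T_eq[OF lim]] by blast
qed

text \<open>Completeness is \<open>E_closed\<close> with constant times.\<close>

lemma hilbert_space_fibre:
  assumes t: "0 \<le> t" shows "hilbert_space (fibre t)"
proof (rule hilbert_space_embedding[OF hilbert_space_univ, where \<psi> = "\<lambda>T. T \<Omega>"])
  show "S = T" if "S \<in> hcarrier (fibre t)" "T \<in> hcarrier (fibre t)" "S \<Omega> = T \<Omega>" for S T
    using E_eqI[OF t] that by simp
  fix X y
  assume X: "\<And>n. X n \<in> hcarrier (fibre t)" and lim: "(\<lambda>n. hdist univ_hspace (X n \<Omega>) y) \<longlonglongrightarrow> 0"
  then have "(\<lambda>n. X n \<Omega>) \<longlonglongrightarrow> y"
    using tendsto_dist_iff[of "\<lambda>n. X n \<Omega>" y] by simp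
  then obtain T where "T \<in> E t" "T \<Omega> = y"
    using E_closed[of "\<lambda>n. t" t X y] X t by auto
  then show "y \<in> (\<lambda>T. T \<Omega>) ` hcarrier (fibre t)" by auto
qed (use t in \<open>auto simp: E_zero E_add E_scale fibre_inner\<close>)

lemma fibre_dist:
  assumes t: "0 \<le> t" and "S \<in> E t" "T \<in> E t"
  shows "hdist (fibre t) S T = dist (S \<Omega>) (T \<Omega>)"
proof -
  have D: "(\<lambda>v. S v + (- 1) *\<^sub>C T v) \<in> E t"
    by (intro E_add E_scale assms)
  show ?thesis
    unfolding hdist_def hnorm_def
    using fibre_inner[OF t D D] by (simp add: cinner_self dist_norm)
qed

lemma fibre_norm:
  assumes "0 \<le> t" "S \<in> E t" shows "hnorm (fibre t) S = norm (S \<Omega>)"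
  using fibre_inner[OF assms(1,2,2)] by (simp add: hnorm_def cinner_self)

lemma separable_fibre:
  assumes t: "0 \<le> t" shows "separable_hilbert_space (fibre t)"
proof -
  \<comment> \<open>\<open>D\<close> is chosen inside the image, so its points have preimages in the
    fibre.\<close>
  obtain D where D: "countable D" "D \<subseteq> (\<lambda>T. T \<Omega>) ` E t" "(\<lambda>T. T \<Omega>) ` E t \<subseteq> closure D"
    by (rule separable)
  define c where "c = inv_into (E t) (\<lambda>T. T \<Omega>)"
  have c: "c d \<in> E t" "c d \<Omega> = d" if "d \<in> D" for d
    using inv_into_into[of d "\<lambda>T. T \<Omega>" "E t"] f_inv_into_f[of d "\<lambda>T. T \<Omega>" "E t"] that D(2)
    by (auto simp: c_def)
  have "\<exists>d\<in>c ` D. hdist (fibre t) x d < e" if x: "x \<in> E t" and e: "e > 0" for x e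
  proof -
    have "x \<Omega> \<in> closure D" using D(3) x by auto
    then obtain d where d: "d \<in> D" "dist d (x \<Omega>) < e"
      using e closure_approachable[of "x \<Omega>" D] by auto
    then have "hdist (fibre t) x (c d) < e"
      using fibre_dist[OF t x c(1)[OF d(1)]] c(2)[OF d(1)] by (simp add: dist_commute)
    then show ?thesis using d(1) by blast
  qed
  then show ?thesis
    unfolding separable_hilbert_space_def
    using hilbert_space_fibre[OF t] D(1) c(1) by (intro conjI exI[of _ "c ` D"]) auto
qed

definition mult :: "real \<Rightarrow> real \<Rightarrow> (('h \<Rightarrow> 'h) \<Rightarrow> ('h \<Rightarrow> 'h) \<Rightarrow> complex) \<Rightarrow> ('h \<Rightarrow> 'h)" where
  "mult s t = tensor_lift (fibre s) (fibre t) (fibre (s + t)) (\<lambda>X Y. X \<circ> Y)"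

lemma hilbert_pair_fibre: "\<lbrakk>0 \<le> s; 0 \<le> t\<rbrakk> \<Longrightarrow> hilbert_pair (fibre s) (fibre t)"
  by (intro hilbert_pair.intro hilbert_space_fibre)

lemma mult_isometry:
  assumes "0 \<le> s" "0 \<le> t"
  shows "scaled_isometry 1 (tensor (fibre s) (fibre t)) (fibre (s + t)) (mult s t)"
    and "\<lbrakk>X \<in> E s; Y \<in> E t\<rbrakk> \<Longrightarrow> mult s t (tensor_elem (fibre s) (fibre t) X Y) = X \<circ> Y"
proof -
  interpret hilbert_pair "fibre s" "fibre t" using assms by (rule hilbert_pair_fibre)
  have inner: "hinner (fibre (s + t)) (X \<circ> Y) (X' \<circ> Y') =
      complex_of_real 1 * (hinner (fibre s) X X' * hinner (fibre t) Y Y')"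
    if "X \<in> hcarrier (fibre s)" "X' \<in> hcarrier (fibre s)" "Y \<in> hcarrier (fibre t)" "Y' \<in> hcarrier (fibre t)"
    for X X' Y Y'
    using that assms E_inner[of s X X' "Y \<Omega>" "Y' \<Omega>"] by (simp add: fibre_inner E_comp)
  note lift = isometric_lift[OF hilbert_space_fibre[of "s + t"] _ _ inner]
  show "scaled_isometry 1 (tensor (fibre s) (fibre t)) (fibre (s + t)) (mult s t)"
    unfolding mult_def by (rule lift(1)) (use assms in \<open>simp_all add: E_comp\<close>)
  show "\<lbrakk>X \<in> E s; Y \<in> E t\<rbrakk> \<Longrightarrow> mult s t (tensor_elem (fibre s) (fibre t) X Y) = X \<circ> Y"
    unfolding mult_def by (rule lift(2)) (use assms in \<open>simp_all add: E_comp\<close>)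
qed

text \<open>Both sides are isometries on the triple product, hence determined by elementary tensors,
  where the identity is associativity of composition.\<close>

lemma mult_associative:
  assumes r: "0 \<le> r" and s: "0 \<le> s" and t: "0 \<le> t"
    and w: "w \<in> hcarrier (tensor (tensor (fibre r) (fibre s)) (fibre t))"
  shows "mult r (s + t) (tensor_map (fibre r) (tensor (fibre s) (fibre t)) (fibre r) (fibre (s + t))
      id (mult s t) (tensor_assoc (fibre r) (fibre s) (fibre t) w)) =
    mult (r + s) t (tensor_map (tensor (fibre r) (fibre s)) (fibre t) (fibre (r + s)) (fibre t)
      (mult r s) id w)"
proof -
  interpret hilbert_triple "fibre r" "fibre s" "fibre t"
    using r s t by (intro hilbert_triple.intro hilbert_pair_fibre hilbert_space_fibre)
  note nonneg = r s t add_nonneg_nonneg[OF r s] add_nonneg_nonneg[OF s t]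
  have id_iso: "scaled_isometry 1 (fibre u) (fibre u) id" for u
    by (simp add: scaled_isometry_def)
  note left = H_KL.tensor_map_isometry[OF hilbert_space_fibre[OF r] hilbert_space_fibre[OF nonneg(5)]
      id_iso mult_isometry(1)[OF s t]]
  note right = HK_L.tensor_map_isometry[OF hilbert_space_fibre[OF nonneg(4)] hilbert_space_fibre[OF t]
      mult_isometry(1)[OF r s] id_iso]
  let ?L = "\<lambda>w. mult r (s + t) (tensor_map (fibre r) (tensor (fibre s) (fibre t)) (fibre r)
      (fibre (s + t)) id (mult s t) (tensor_assoc (fibre r) (fibre s) (fibre t) w))"
  let ?R = "\<lambda>w. mult (r + s) t (tensor_map (tensor (fibre r) (fibre s)) (fibre t) (fibre (r + s))
      (fibre t) (mult r s) id w)"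
  let ?w = "\<lambda>X Y Z. tensor_elem (tensor (fibre r) (fibre s)) (fibre t) (tensor_elem (fibre r) (fibre s) X Y) Z"
  show "?L w = ?R w"
  proof (rule tensor_triple_map_eqI[where S = ?L and T = ?R, OF hilbert_space_fibre[of "r + s + t"] _ _ _ w])
    show "0 \<le> r + s + t" using r s t by simp
    \<comment> \<open>This composite lands in the fibre at \<open>r + (s + t)\<close>; associativity
      of addition of times identifies it with the target.\<close>
    show "scaled_isometry 1 (tensor (tensor (fibre r) (fibre s)) (fibre t)) (fibre (r + s + t)) ?L"
      using scaled_isometry_comp[OF scaled_isometry_comp[OF tensor_assoc_isometry(1) left(1)]
          mult_isometry(1)[OF r nonneg(5)]] by (simp add: add.assoc)
    show "scaled_isometry 1 (tensor (tensor (fibre r) (fibre s)) (fibre t)) (fibre (r + s + t)) ?R"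
      using scaled_isometry_comp[OF right(1) mult_isometry(1)[OF nonneg(4) t]] .
    fix X Y Z
    assume XYZ: "X \<in> hcarrier (fibre r)" "Y \<in> hcarrier (fibre s)" "Z \<in> hcarrier (fibre t)"
    then have E: "X \<in> E r" "Y \<in> E s" "Z \<in> E t" by simp_all
    have "?L (?w X Y Z) = X \<circ> (Y \<circ> Z)"
      using XYZ E nonneg by (simp only: tensor_assoc_isometry(2) left(2) KL.tensor_elem_closed
          mult_isometry(2) E_comp id_apply)
    moreover have "?R (?w X Y Z) = (X \<circ> Y) \<circ> Z"
      using XYZ E nonneg by (simp only: right(2) tensor_elem_closed mult_isometry(2) E_comp id_apply)
    ultimately show "?L (?w X Y Z) = ?R (?w X Y Z)"
      by (simp only: comp_assoc)
  qed
qed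

end

section \<open>The measurable structure\<close>

lemma second_countable_euclidean: "second_countable (euclidean :: 'a::second_countable_topology topology)"
proof -
  obtain B :: "'a set set" where B: "countable B" "topological_basis B"
    using ex_countable_basis by blast
  show ?thesis
    unfolding second_countable_def
  proof (intro exI[of _ B] conjI allI impI ballI)
    show "openin euclidean V" if "V \<in> B" for V
      using topological_basis_open[OF B(2) that] by simp
    fix U and x :: 'a assume "openin euclidean U \<and> x \<in> U"
    then have "open U" "x \<in> U" by auto
    then obtain V where "V \<in> B" "x \<in> V" "V \<subseteq> U" by (rule topological_basisE[OF B(2)])
    then show "\<exists>V\<in>B. x \<in> V \<and> V \<subseteq> U" by blast
  qed (rule B(1))
qed

text \<open>The pulled back topology makes \<open>f\<close> a homeomorphism onto its image. That
  image is closed in an open subset of a complete space, hence completely metrizable.\<close>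

lemma standard_borel_pullback:
  fixes f :: "'a \<Rightarrow> 'b::{complete_space, second_countable_topology}"
  assumes inj: "inj_on f A" and image: "f ` A = U \<inter> C" and U: "open U" and C: "closed C"
  shows "standard_borel (vimage_algebra A f borel)"
  unfolding standard_borel_def
proof (intro exI conjI)
  let ?T = "pullback_topology A f euclidean"
  show top: "topspace ?T = space (vimage_algebra A f borel)"
    by (simp add: topspace_pullback_topology)
  have "homeomorphic_maps ?T (top_of_set (f ` A)) f (inv_into A f)"
    unfolding homeomorphic_maps_def
  proof (intro conjI ballI)
    show "continuous_map ?T (top_of_set (f ` A)) f"
      unfolding continuous_map_def
    proof (intro conjI allI impI)
      fix V assume "openin (top_of_set (f ` A)) V"
      then obtain W where W: "open W" "V = f ` A \<inter> W" by (auto simp: openin_open)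
      then have "{x \<in> topspace ?T. f x \<in> V} = f -` W \<inter> A" by (auto simp: topspace_pullback_topology)
      then show "openin ?T {x \<in> topspace ?T. f x \<in> V}"
        using W(1) by (auto simp: openin_pullback_topology)
    qed (simp add: topspace_pullback_topology)
    show "continuous_map (top_of_set (f ` A)) ?T (inv_into A f)"
      unfolding continuous_map_def
    proof (intro conjI allI impI)
      show "inv_into A f \<in> topspace (top_of_set (f ` A)) \<rightarrow> topspace ?T"
        by (auto simp: topspace_pullback_topology inv_into_f_f[OF inj])
      fix V assume "openin ?T V"
      then obtain W where W: "open W" "V = f -` W \<inter> A" by (auto simp: openin_pullback_topology)
      then have "{y \<in> topspace (top_of_set (f ` A)). inv_into A f y \<in> V} = f ` A \<inter> W"
        by (auto simp: inv_into_f_f[OF inj])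
      then show "openin (top_of_set (f ` A)) {y \<in> topspace (top_of_set (f ` A)). inv_into A f y \<in> V}"
        using W(1) by (auto simp: openin_open)
    qed
  qed (auto simp: topspace_pullback_topology inv_into_f_f[OF inj])
  then have homeo: "?T homeomorphic_space top_of_set (f ` A)"
    unfolding homeomorphic_space_def by blast
  have "closedin (top_of_set U) (U \<inter> C)"
    using C by (auto simp: closedin_closed)
  then have "completely_metrizable_space (subtopology (top_of_set U) (U \<inter> C))"
    using U by (intro completely_metrizable_space_closedin completely_metrizable_space_openin
        completely_metrizable_space_euclidean) auto
  moreover have "subtopology (top_of_set U) (U \<inter> C) = top_of_set (f ` A)"
    by (simp add: subtopology_subtopology image)
  ultimately show "completely_metrizable_space ?T"
    using homeomorphic_completely_metrizable_space[OF homeo] by simp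
  show "second_countable ?T"
    using homeomorphic_space_second_countability[OF homeo]
      second_countable_subtopology[OF second_countable_euclidean] by blast
  have "sets (vimage_algebra A f borel) = sigma_sets A {f -` B \<inter> A |B. B \<in> {S. open S}}"
    unfolding borel_def by (subst vimage_algebra_sigma) (auto intro!: sets_measure_of)
  also have "{f -` B \<inter> A |B. B \<in> {S. open S}} = {V. openin ?T V}"
    by (auto simp: openin_pullback_topology)
  finally show "sets (vimage_algebra A f borel) = sigma_sets (topspace ?T) {V. openin ?T V}"
    by (simp add: top)
qed

text \<open>Every open set is a countable union of balls around a dense sequence, so measurability
  of a vector-valued map reduces to that of distances.\<close>

lemma borel_measurable_of_dist:
  fixes f :: "'a \<Rightarrow> 'b::{metric_space, second_countable_topology}"
  assumes "\<And>z. (\<lambda>w. dist (f w) z) \<in> borel_measurable M"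
  shows "f \<in> borel_measurable M"
proof (rule borel_measurableI)
  fix S :: "'b set" assume S: "open S"
  obtain d :: "nat \<Rightarrow> 'b" where d: "closure (range d) = UNIV" by (rule dense_sequence)
  define I where "I = {(i, n :: nat). ball (d i) (1 / Suc n) \<subseteq> S}"
  have "x \<in> S \<longleftrightarrow> (\<exists>(i, n)\<in>I. dist x (d i) < 1 / Suc n)" for x
  proof
    assume "x \<in> S"
    then obtain e where e: "e > 0" "ball x e \<subseteq> S" using S open_contains_ball by blast
    \<comment> \<open>Half of \<open>e\<close>, because a ball whose centre is within its own radius
      of \<open>x\<close> must fit into \<open>ball x e\<close>.\<close>
    obtain n where n: "1 / Suc n < e / 2"
      using reals_Archimedean[of "e/2"] e by (auto simp: inverse_eq_divide)
    have "x \<in> closure (range d)" using d by simp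
    then obtain i where i: "dist (d i) x < 1 / Suc n"
      unfolding closure_approachable by (metis zero_less_divide_1_iff of_nat_0_less_iff zero_less_Suc rangeE)
    have "ball (d i) (1 / Suc n) \<subseteq> ball x e"
    proof
      fix y assume "y \<in> ball (d i) (1 / Suc n)"
      then show "y \<in> ball x e"
        using i n dist_triangle[of x y "d i"] by (simp add: dist_commute)
    qed
    then show "\<exists>(i, n)\<in>I. dist x (d i) < 1 / Suc n"
      using e(2) i by (auto simp: I_def dist_commute)
  qed (auto simp: I_def dist_commute)
  then have "f -` S \<inter> space M = (\<Union>(i, n)\<in>I. {w \<in> space M. dist (f w) (d i) < 1 / Suc n})"
    by auto
  also have "\<dots> \<in> sets M"
    using assms by (intro sets.countable_UN') (auto simp: split_beta)
  finally show "f -` S \<inter> space M \<in> sets M" .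
qed

section \<open>The total space as a Borel space\<close>

context intertwining
begin

definition total :: "(real \<times> ('h \<Rightarrow> 'h)) set" where
  "total = (SIGMA t:{0<..}. E t)"

definition ev :: "real \<times> ('h \<Rightarrow> 'h) \<Rightarrow> real \<times> 'h" where
  "ev v = (fst v, snd v \<Omega>)"

definition total_borel :: "(real \<times> ('h \<Rightarrow> 'h)) measure" where
  "total_borel = vimage_algebra total ev borel"

lemma space_total_borel: "space total_borel = total"
  by (simp add: total_borel_def)

lemma inj_ev: "inj_on ev total"
  by (rule inj_onI) (auto simp: total_def ev_def intro: E_eqI[OF less_imp_le])

text \<open>At positive times \<open>E_closed\<close> supplies the limit intertwiner. Closedness is
  relative to these: zero operators at times tending to 0 give image points whose limit has time
  0.\<close>

lemma ev_image_closed: "ev ` total = ({0<..} \<times> UNIV) \<inter> closure (ev ` total)"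
proof
  show "ev ` total \<subseteq> ({0<..} \<times> UNIV) \<inter> closure (ev ` total)"
    using closure_subset[of "ev ` total"] by (auto simp: total_def ev_def)
  show "({0<..} \<times> UNIV) \<inter> closure (ev ` total) \<subseteq> ev ` total"
  proof
    fix p assume p: "p \<in> ({0<..} \<times> UNIV) \<inter> closure (ev ` total)"
    obtain t \<xi> where t: "p = (t, \<xi>)" "0 < t" using p by (cases p) auto
    obtain q where q: "\<And>n. q n \<in> ev ` total" "q \<longlonglongrightarrow> p"
      using p by (auto simp: closure_sequential)
    then have "\<forall>n. \<exists>v. v \<in> total \<and> q n = ev v" by blast
    then obtain v where v: "\<And>n. v n \<in> total" "\<And>n. q n = ev (v n)" by metis
    have E: "0 \<le> fst (v n)" "snd (v n) \<in> E (fst (v n))" for n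
      using v(1)[of n] by (auto simp: total_def)
    have "(\<lambda>n. fst (v n)) \<longlonglongrightarrow> t" "(\<lambda>n. snd (v n) \<Omega>) \<longlonglongrightarrow> \<xi>"
      using tendsto_fst[OF q(2)] tendsto_snd[OF q(2)] t(1) v(2) by (simp_all add: ev_def)
    then obtain T where "T \<in> E t" "T \<Omega> = \<xi>"
      using E_closed[of "\<lambda>n. fst (v n)" t "\<lambda>n. snd (v n)" \<xi>] E by blast
    then show "p \<in> ev ` total"
      using t by (intro image_eqI[of _ _ "(t, T)"]) (auto simp: ev_def total_def)
  qed
qed

lemma standard_borel_total_borel: "standard_borel total_borel"
  unfolding total_borel_def
  by (rule standard_borel_pullback[OF inj_ev ev_image_closed]) (auto intro: open_Times)

lemma ev_measurable: "ev \<in> total_borel \<rightarrow>\<^sub>M borel"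
  unfolding total_borel_def by (rule measurable_vimage_algebra1) simp

lemma fst_measurable: "fst \<in> total_borel \<rightarrow>\<^sub>M borel"
proof -
  have "(\<lambda>v. fst (ev v)) \<in> total_borel \<rightarrow>\<^sub>M borel"
    by (rule measurable_compose[OF ev_measurable]) (auto intro!: borel_measurable_continuous_onI continuous_intros)
  then show ?thesis by (simp add: ev_def)
qed

lemma snd_\<Omega>_measurable: "(\<lambda>v. snd v \<Omega>) \<in> total_borel \<rightarrow>\<^sub>M borel"
proof -
  have "(\<lambda>v. snd (ev v)) \<in> total_borel \<rightarrow>\<^sub>M borel"
    by (rule measurable_compose[OF ev_measurable]) (auto intro!: borel_measurable_continuous_onI continuous_intros)
  then show ?thesis by (simp add: ev_def)
qed

lemma measurable_into_total_borel:
  assumes "\<And>w. w \<in> space W \<Longrightarrow> f w \<in> total"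
    and "(\<lambda>w. fst (f w)) \<in> W \<rightarrow>\<^sub>M borel" "(\<lambda>w. snd (f w) \<Omega>) \<in> W \<rightarrow>\<^sub>M borel"
  shows "f \<in> W \<rightarrow>\<^sub>M total_borel"
  unfolding total_borel_def
proof (rule measurable_vimage_algebra2)
  show "(\<lambda>w. ev (f w)) \<in> W \<rightarrow>\<^sub>M borel"
    using assms(2,3) unfolding ev_def by (rule borel_measurable_Pair)
qed (use assms(1) in auto)

lemma totalD: "(t, T) \<in> total \<Longrightarrow> 0 < t" "(t, T) \<in> total \<Longrightarrow> T \<in> E t"
  by (auto simp: total_def)

text \<open>\<open>inv_into\<close> recovers the intertwiner from its image point, making
  application a map between metric spaces, where sequences decide continuity. The pointwise limits
  in \<open>E_closed\<close> are what control values away from \<Omega>.\<close>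

lemma apply_continuous:
  "continuous_on (ev ` total \<times> UNIV) (\<lambda>(p, \<eta>). snd (inv_into total ev p) \<eta>)"
  unfolding continuous_on_sequentially
proof (intro allI ballI impI, elim conjE)
  fix x :: "nat \<Rightarrow> (real \<times> 'h) \<times> 'h" and a
  assume a: "a \<in> ev ` total \<times> UNIV" and x: "\<forall>n. x n \<in> ev ` total \<times> UNIV" and lim: "x \<longlonglongrightarrow> a"
  obtain t T \<eta> where tT: "(t, T) \<in> total" "a = (ev (t, T), \<eta>)" using a by auto
  have "fst (x n) \<in> ev ` total" for n using x by (auto simp: mem_Times_iff)
  then have "\<forall>n. \<exists>v. v \<in> total \<and> fst (x n) = ev v" by blast
  then obtain v where v: "\<And>n. v n \<in> total" "\<And>n. fst (x n) = ev (v n)" by metis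
  have E: "0 \<le> fst (v n)" "snd (v n) \<in> E (fst (v n))" for n
    using v(1)[of n] by (auto simp: total_def)
  have "(\<lambda>n. ev (v n)) \<longlonglongrightarrow> ev (t, T)"
    using tendsto_fst[OF lim] tT(2) v(2) by simp
  then have lims: "(\<lambda>n. fst (v n)) \<longlonglongrightarrow> t" "(\<lambda>n. snd (v n) \<Omega>) \<longlonglongrightarrow> T \<Omega>"
    using tendsto_fst[of "\<lambda>n. ev (v n)"] tendsto_snd[of "\<lambda>n. ev (v n)"] by (fastforce simp: ev_def)+
  then obtain T' where T': "T' \<in> E t" "T' \<Omega> = T \<Omega>" "\<And>y. (\<lambda>n. snd (v n) y) \<longlonglongrightarrow> T' y"
    using E_closed[of "\<lambda>n. fst (v n)" t "\<lambda>n. snd (v n)" "T \<Omega>"] E by blast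
  \<comment> \<open>The limit from \<open>E_closed\<close> is a priori another intertwiner;
    agreement at \<Omega> identifies it.\<close>
  then have "T' = T" using E_eqI[of t T' T] totalD[OF tT(1)] by simp
  then have strong: "(\<lambda>n. snd (v n) \<eta>) \<longlonglongrightarrow> T \<eta>" using T'(3) by simp
  \<comment> \<open>It remains to replace the fixed \<open>\<eta>\<close> by the moving vector:
    \<open>E_norm\<close> makes the error a convergent factor times a null sequence.\<close>
  have "(\<lambda>n. snd (x n) - \<eta>) \<longlonglongrightarrow> 0"
    using tendsto_snd[OF lim] tT(2) by (simp add: LIM_zero)
  then have "(\<lambda>n. norm (snd (v n) \<Omega>) * norm (snd (x n) - \<eta>)) \<longlonglongrightarrow> norm (T \<Omega>) * norm (0 :: 'h)"
    by (intro tendsto_mult tendsto_norm lims)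
  then have "(\<lambda>n. snd (v n) (snd (x n) - \<eta>)) \<longlonglongrightarrow> 0"
    by - (rule tendsto_norm_zero_cancel, simp add: E_norm[OF E, where x = "snd (x _) - \<eta>"])
  from tendsto_add[OF this strong] have "(\<lambda>n. snd (v n) (snd (x n))) \<longlonglongrightarrow> T \<eta>"
    by (simp add: bounded_clinear_diff[OF E_bounded[OF E(2)]])
  moreover have "(case x n of (p, \<eta>) \<Rightarrow> snd (inv_into total ev p) \<eta>) = snd (v n) (snd (x n))" for n
    using v by (simp add: split_beta inv_into_f_f[OF inj_ev])
  moreover have "(case a of (p, \<eta>) \<Rightarrow> snd (inv_into total ev p) \<eta>) = T \<eta>"
    using tT by (simp add: inv_into_f_f[OF inj_ev])
  ultimately show "((\<lambda>(p, \<eta>). snd (inv_into total ev p) \<eta>) \<circ> x) \<longlonglongrightarrow> (\<lambda>(p, \<eta>). snd (inv_into total ev p) \<eta>) a"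
    by (simp add: o_def)
qed

lemma apply_measurable: "(\<lambda>w. snd (fst w) (snd (snd w) \<Omega>)) \<in> total_borel \<Otimes>\<^sub>M total_borel \<rightarrow>\<^sub>M borel"
proof -
  let ?g = "\<lambda>w. (ev (fst w), snd (snd w) \<Omega>)"
  have "?g \<in> total_borel \<Otimes>\<^sub>M total_borel \<rightarrow>\<^sub>M borel"
    by (intro borel_measurable_Pair measurable_compose[OF measurable_fst ev_measurable]
        measurable_compose[OF measurable_snd snd_\<Omega>_measurable])
  then have g: "?g \<in> total_borel \<Otimes>\<^sub>M total_borel \<rightarrow>\<^sub>M restrict_space borel (ev ` total \<times> UNIV)"
    by (intro measurable_restrict_space2) (auto simp: space_pair_measure space_total_borel)
  have "(\<lambda>w. (\<lambda>(p, \<eta>). snd (inv_into total ev p) \<eta>) (?g w)) \<in> total_borel \<Otimes>\<^sub>M total_borel \<rightarrow>\<^sub>M borel"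
    by (rule measurable_compose[OF g borel_measurable_continuous_on_restrict[OF apply_continuous]])
  then show ?thesis
    by (rule measurable_cong[THEN iffD1, rotated])
      (auto simp: space_pair_measure space_total_borel inv_into_f_f[OF inj_ev])
qed

subsection \<open>Measurable sections\<close>

text \<open>\<open>proj x t\<close> is the element of the fibre whose value at \<open>\<Omega>\<close> is the orthogonal projection
  of \<open>x\<close> to the closed subspace of all \<open>S \<Omega>\<close>.\<close>

definition proj :: "'h \<Rightarrow> real \<Rightarrow> 'h \<Rightarrow> 'h" where
  "proj x t = (SOME T. T \<in> E t \<and> (\<forall>S\<in>E t. cinner (S \<Omega>) (T \<Omega>) = cinner (S \<Omega>) x))"

text \<open>Pairing with \<open>x\<close> at \<Omega> is a bounded functional on the fibre, and its
  Riesz vector witnesses the choice in \<open>proj\<close>.\<close>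

lemma
  assumes t: "0 \<le> t"
  shows proj_closed: "proj x t \<in> E t"
    and proj_inner: "S \<in> E t \<Longrightarrow> cinner (S \<Omega>) (proj x t \<Omega>) = cinner (S \<Omega>) x"
proof -
  interpret F: hilbert_space "fibre t" using t by (rule hilbert_space_fibre)
  have "hfunctional (fibre t) (\<lambda>S. cinner (S \<Omega>) x)"
    unfolding hfunctional_def
  proof (intro conjI exI[of _ "norm x"] ballI allI)
    fix S assume "S \<in> hcarrier (fibre t)"
    then show "cmod (cinner (S \<Omega>) x) \<le> norm x * hnorm (fibre t) S"
      using cinner_Cauchy_Schwarz[of "S \<Omega>" x] fibre_norm[OF t] by (simp add: mult.commute)
  qed (simp_all add: cinner_add_left cinner_scaleC_left)
  from F.Riesz_representation[OF this]
  obtain T where "T \<in> E t" "\<And>S. S \<in> E t \<Longrightarrow> cinner (S \<Omega>) x = hinner (fibre t) S T"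
    by auto
  then have "\<exists>T. T \<in> E t \<and> (\<forall>S\<in>E t. cinner (S \<Omega>) (T \<Omega>) = cinner (S \<Omega>) x)"
    using fibre_inner[OF t] by (intro exI[of _ T]) simp
  from someI_ex[OF this] show "proj x t \<in> E t"
    and "S \<in> E t \<Longrightarrow> cinner (S \<Omega>) (proj x t \<Omega>) = cinner (S \<Omega>) x"
    unfolding proj_def by auto
qed

lemma proj_unique:
  assumes t: "0 \<le> t" and T: "T \<in> E t" and eq: "\<And>S. S \<in> E t \<Longrightarrow> cinner (S \<Omega>) (T \<Omega>) = cinner (S \<Omega>) x"
  shows "proj x t \<Omega> = T \<Omega>"
proof -
  let ?D = "\<lambda>v. proj x t v + (- 1) *\<^sub>C T v"
  have D: "?D \<in> E t" using t T by (intro E_add E_scale proj_closed)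
  have "cinner (?D \<Omega>) (proj x t \<Omega> - T \<Omega>) = 0"
    using proj_inner[OF t D, of x] eq[OF D] by (simp add: cinner_diff_right)
  then have "cinner (proj x t \<Omega> - T \<Omega>) (proj x t \<Omega> - T \<Omega>) = 0" by simp
  then show ?thesis by (simp add: cinner_self)
qed

lemma proj_add: "0 \<le> t \<Longrightarrow> proj (x + y) t \<Omega> = proj x t \<Omega> + proj y t \<Omega>"
  using proj_unique[of t "\<lambda>v. proj x t v + proj y t v" "x + y"]
  by (simp add: E_add proj_closed cinner_add_right proj_inner)

lemma proj_diff: "0 \<le> t \<Longrightarrow> proj (x - y) t \<Omega> = proj x t \<Omega> - proj y t \<Omega>"
  using proj_unique[of t "\<lambda>v. proj x t v + (- 1) *\<^sub>C proj y t v" "x - y"]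
    E_add[of t "proj x t" "\<lambda>v. (- 1) *\<^sub>C proj y t v"] E_scale[of t "proj y t" "- 1"]
  by (simp add: proj_closed cinner_diff_right proj_inner)

text \<open>Projections being self-adjoint and idempotent, \<open>y\<close> may be replaced by its
  projection; polarisation then leaves only norms of projections, the quantities accessible to
  semicontinuity.\<close>

lemma proj_polarise:
  assumes t: "0 \<le> t"
  shows "inner (proj x t \<Omega>) y = ((norm (proj (x + y) t \<Omega>))\<^sup>2 - (norm (proj (x - y) t \<Omega>))\<^sup>2) / 4"
proof -
  have "inner (proj x t \<Omega>) y = inner (proj x t \<Omega>) (proj y t \<Omega>)"
    unfolding Re_cinner[symmetric] using proj_inner[OF t proj_closed[OF t], of x y] by simp
  then show ?thesis
    unfolding proj_add[OF t] proj_diff[OF t]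
    by (simp add: power2_norm_eq_inner inner_add inner_diff inner_commute algebra_simps)
qed

text \<open>The norm of the projection is upper semicontinuous in \<open>t\<close>, by weak compactness of the unit
  balls of the fibres.\<close>

lemma proj_norm_superlevel_closed:
  assumes a: "a > 0"
  shows "closedin (top_of_set {0<..}) {t \<in> {0<..}. a \<le> norm (proj x t \<Omega>)}"
proof -
  \<comment> \<open>The norm of the projection is the largest real part of the pairing with
    \<open>x\<close> over the unit ball of the fibre, attained at the normalised projection. This
    form passes to weak limits, as the norm of a projection at varying times does not
    directly.\<close>
  define R where "R t \<longleftrightarrow> (\<exists>S\<in>E t. norm (S \<Omega>) \<le> 1 \<and> a \<le> Re (cinner (S \<Omega>) x))" for t
  have R: "a \<le> norm (proj x t \<Omega>) \<longleftrightarrow> R t" if t: "0 < t" for t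
  proof
    let ?P = "proj x t"
    have P: "?P \<in> E t" using t by (simp add: proj_closed)
    assume le: "a \<le> norm (?P \<Omega>)"
    let ?S = "\<lambda>v. complex_of_real (1 / norm (?P \<Omega>)) *\<^sub>C ?P v"
    have n: "norm (?P \<Omega>) > 0" using le a by linarith
    have S: "?S \<in> E t" using t P by (intro E_scale) auto
    have "norm (?S \<Omega>) = 1" using n by (simp add: norm_scaleC norm_divide)
    moreover have "cinner (?S \<Omega>) x = complex_of_real (norm (?P \<Omega>))"
    proof -
      have "cinner (?S \<Omega>) x = cinner (?S \<Omega>) (?P \<Omega>)"
        using proj_inner[OF _ S, of x] t by simp
      also have "\<dots> = complex_of_real (1 / norm (?P \<Omega>) * (norm (?P \<Omega>))\<^sup>2)"
        unfolding cinner_scaleC_left cinner_self of_real_mult ..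
      finally show ?thesis using n by (simp add: power2_eq_square)
    qed
    ultimately show "R t" unfolding R_def using S le by (intro bexI[of _ ?S]) simp_all
  next
    assume "R t"
    then obtain S where S: "S \<in> E t" "norm (S \<Omega>) \<le> 1" "a \<le> Re (cinner (S \<Omega>) x)"
      by (auto simp: R_def)
    have "a \<le> cmod (cinner (S \<Omega>) (proj x t \<Omega>))"
      using S(3) proj_inner[of t S x] S(1) t complex_Re_le_cmod[of "cinner (S \<Omega>) x"] by simp
    also have "\<dots> \<le> norm (S \<Omega>) * norm (proj x t \<Omega>)" by (rule cinner_Cauchy_Schwarz)
    also have "\<dots> \<le> 1 * norm (proj x t \<Omega>)" using S(2) by (rule mult_right_mono) simp
    finally show "a \<le> norm (proj x t \<Omega>)" by simp
  qed
  have set_eq: "{t \<in> {0<..}. a \<le> norm (proj x t \<Omega>)} = {t \<in> {0<..}. R t}" using R by auto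
  have limit: "R t" if t: "0 < t" and u: "\<And>n. 0 < u n \<and> R (u n)" "u \<longlonglongrightarrow> t" for u t
  proof -
    have "\<forall>n. \<exists>S. S \<in> E (u n) \<and> norm (S \<Omega>) \<le> 1 \<and> a \<le> Re (cinner (S \<Omega>) x)"
      using u(1) unfolding R_def by blast
    then obtain S where S: "\<And>n. S n \<in> E (u n)" "\<And>n. norm (S n \<Omega>) \<le> 1" "\<And>n. a \<le> Re (cinner (S n \<Omega>) x)"
      by metis
    obtain r T where T: "T \<in> E t" and weak: "\<And>x y. (\<lambda>n. cinner (S (r n) x) y) \<longlonglongrightarrow> cinner (T x) y"
      using E_weakly_compact[where S = S and u = u, OF _ u(2) S(1,2)] u(1) less_imp_le by metis
    have "a \<le> Re (cinner (T \<Omega>) x)"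
      by (rule LIMSEQ_le_const[OF tendsto_Re[OF weak]]) (use S(3) in auto)
    moreover have "norm (T \<Omega>) \<le> 1"
    proof -
      \<comment> \<open>Weak lower semicontinuity of the norm, by pairing the sequence with its own
        limit vector.\<close>
      have "cmod (cinner (S (r n) \<Omega>) (T \<Omega>)) \<le> norm (T \<Omega>)" for n
        using cinner_Cauchy_Schwarz[of "S (r n) \<Omega>" "T \<Omega>"]
          mult_right_mono[OF S(2)[of "r n"], of "norm (T \<Omega>)"] by simp
      then have "cmod (cinner (T \<Omega>) (T \<Omega>)) \<le> norm (T \<Omega>)"
        by (intro LIMSEQ_le_const2[OF tendsto_norm[OF weak]]) auto
      then have "norm (T \<Omega>) * norm (T \<Omega>) \<le> 1 * norm (T \<Omega>)"
        unfolding cinner_self norm_of_real by (simp add: power2_eq_square)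
      then show ?thesis by (cases "T \<Omega> = 0") auto
    qed
    ultimately show "R t" using T by (auto simp: R_def)
  qed
  have "{t \<in> {0<..}. R t} = {0<..} \<inter> closure {t \<in> {0<..}. R t}"
  proof
    show "{0<..} \<inter> closure {t \<in> {0<..}. R t} \<subseteq> {t \<in> {0<..}. R t}"
    proof
      fix t assume "t \<in> {0<..} \<inter> closure {t \<in> {0<..}. R t}"
      then obtain u where "0 < t" "\<And>n. 0 < u n \<and> R (u n)" "u \<longlonglongrightarrow> t"
        by (auto simp: closure_sequential)
      then show "t \<in> {t \<in> {0<..}. R t}" using limit[of t u] by simp
    qed
    show "{t \<in> {0<..}. R t} \<subseteq> {0<..} \<inter> closure {t \<in> {0<..}. R t}"
      using closure_subset[of "{t \<in> {0<..}. R t}"] by auto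
  qed
  then show ?thesis unfolding set_eq closedin_closed by blast
qed

lemma proj_norm_measurable:
  "(\<lambda>t. norm (proj x t \<Omega>)) \<in> borel_measurable (restrict_space borel {0<..})"
  unfolding borel_measurable_iff_ge
proof
  fix a
  show "{t \<in> space (restrict_space borel {0<..}). a \<le> norm (proj x t \<Omega>)} \<in> sets (restrict_space borel {0<..})"
  proof (cases "a > 0")
    case True
    obtain C where "closed C" "{t \<in> {0<..}. a \<le> norm (proj x t \<Omega>)} = {0<..} \<inter> C"
      using proj_norm_superlevel_closed[OF True, of x] by (auto simp: closedin_closed)
    then show ?thesis by (auto simp: sets_restrict_space space_restrict_space)
  next
    case False
    then have "{t \<in> space (restrict_space borel {0<..}). a \<le> norm (proj x t \<Omega>)} =
        space (restrict_space borel {0<..})"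
      by (auto simp: not_less intro: order_trans)
    then show ?thesis using sets.top by metis
  qed
qed

lemma proj_measurable: "(\<lambda>t. proj x t \<Omega>) \<in> borel_measurable (restrict_space borel {0<..})"
proof (rule borel_measurable_of_dist)
  fix z
  let ?B = "restrict_space borel {0::real<..}"
  note [measurable] = proj_norm_measurable
  have inner: "(\<lambda>t. inner (proj x t \<Omega>) z) \<in> borel_measurable ?B"
  proof (rule measurable_cong[THEN iffD2])
    show "inner (proj x t \<Omega>) z = ((norm (proj (x + z) t \<Omega>))\<^sup>2 - (norm (proj (x - z) t \<Omega>))\<^sup>2) / 4"
      if "t \<in> space ?B" for t
      using that by (intro proj_polarise) (simp add: space_restrict_space)
    show "(\<lambda>t. ((norm (proj (x + z) t \<Omega>))\<^sup>2 - (norm (proj (x - z) t \<Omega>))\<^sup>2) / 4) \<in> borel_measurable ?B"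
      by measurable
  qed
  \<comment> \<open>Expanding the square reduces distances to a norm and an inner product, both
    already measurable.\<close>
  have "dist (proj x t \<Omega>) z = sqrt ((norm (proj x t \<Omega>))\<^sup>2 - 2 * inner (proj x t \<Omega>) z + (norm z)\<^sup>2)" for t
    unfolding dist_norm norm_eq_sqrt_inner[of "_ - _"]
    by (simp add: power2_norm_eq_inner inner_diff inner_commute)
  then show "(\<lambda>t. dist (proj x t \<Omega>) z) \<in> borel_measurable ?B"
    using inner by simp
qed

lemma compatible_total_borel: "compatible_borel_structure fibre mult total_borel"
  unfolding compatible_borel_structure_def
proof (intro conjI)
  let ?R = "restrict_space (total_borel \<Otimes>\<^sub>M total_borel) {(v, w). fst v = fst w}"
  show "space total_borel = (SIGMA t:{0<..}. hcarrier (fibre t))" by (simp add: space_total_borel total_def)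
  show "standard_borel total_borel" by (rule standard_borel_total_borel)
  show "fst \<in> total_borel \<rightarrow>\<^sub>M borel" by (rule fst_measurable)
  note proj1 = measurable_compose[OF measurable_fst] and proj2 = measurable_compose[OF measurable_snd]
  show "(\<lambda>((t, x), (_, y)). (t, hadd (fibre t) x y)) \<in> ?R \<rightarrow>\<^sub>M total_borel"
  proof (rule measurable_into_total_borel)
    show "((\<lambda>((t, x), (_, y)). (t, hadd (fibre t) x y)) w) \<in> total"
      if "w \<in> space (?R)" for w
      using that by (auto simp: space_restrict_space space_pair_measure space_total_borel total_def E_add)
    have "(\<lambda>w. fst (fst w)) \<in> total_borel \<Otimes>\<^sub>M total_borel \<rightarrow>\<^sub>M borel" by (rule proj1[OF fst_measurable])
    from measurable_restrict_space1[OF this]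
    show "(\<lambda>w. fst ((\<lambda>((t, x), (_, y)). (t, hadd (fibre t) x y)) w))
        \<in> ?R \<rightarrow>\<^sub>M borel"
      by (simp add: split_beta)
    have "(\<lambda>w. snd (fst w) \<Omega> + snd (snd w) \<Omega>) \<in> total_borel \<Otimes>\<^sub>M total_borel \<rightarrow>\<^sub>M borel"
      by (intro borel_measurable_add proj1[OF snd_\<Omega>_measurable] proj2[OF snd_\<Omega>_measurable])
    from measurable_restrict_space1[OF this]
    show "(\<lambda>w. snd ((\<lambda>((t, x), (_, y)). (t, hadd (fibre t) x y)) w) \<Omega>)
        \<in> ?R \<rightarrow>\<^sub>M borel"
      by (simp add: split_beta)
  qed
  show "(\<lambda>(c, (t, x)). (t, hscale (fibre t) c x)) \<in> borel \<Otimes>\<^sub>M total_borel \<rightarrow>\<^sub>M total_borel"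
  proof (rule measurable_into_total_borel)
    show "((\<lambda>(c, (t, x)). (t, hscale (fibre t) c x)) w) \<in> total" if "w \<in> space (borel \<Otimes>\<^sub>M total_borel)" for w
      using that by (auto simp: space_pair_measure space_total_borel total_def E_scale)
    show "(\<lambda>w. fst ((\<lambda>(c, (t, x)). (t, hscale (fibre t) c x)) w)) \<in> borel \<Otimes>\<^sub>M total_borel \<rightarrow>\<^sub>M borel"
      using proj2[OF fst_measurable] by (simp add: split_beta)
    have "(\<lambda>w. (fst w :: complex, snd (snd w) \<Omega>)) \<in> borel \<Otimes>\<^sub>M total_borel \<rightarrow>\<^sub>M borel"
      by (intro borel_measurable_Pair measurable_fst proj2[OF snd_\<Omega>_measurable])
    then have "(\<lambda>w. (\<lambda>p. fst p *\<^sub>C snd p) (fst w :: complex, snd (snd w) \<Omega>)) \<in> borel \<Otimes>\<^sub>M total_borel \<rightarrow>\<^sub>M borel"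
      by (rule measurable_compose)
        (intro borel_measurable_continuous_onI continuous_on_scaleC continuous_intros)
    then show "(\<lambda>w. snd ((\<lambda>(c, (t, x)). (t, hscale (fibre t) c x)) w) \<Omega>) \<in> borel \<Otimes>\<^sub>M total_borel \<rightarrow>\<^sub>M borel"
      by (simp add: split_beta)
  qed
  show "(\<lambda>((t, x), (_, y)). hinner (fibre t) x y) \<in> ?R \<rightarrow>\<^sub>M borel"
  proof (rule measurable_cong[THEN iffD2])
    show "((\<lambda>((t, x), (_, y)). hinner (fibre t) x y) w) = cinner (snd (fst w) \<Omega>) (snd (snd w) \<Omega>)"
      if "w \<in> space (?R)" for w
      using that by (auto simp: space_restrict_space space_pair_measure space_total_borel total_def fibre_inner)
    have "(\<lambda>w. (snd (fst w) \<Omega>, snd (snd w) \<Omega>)) \<in> total_borel \<Otimes>\<^sub>M total_borel \<rightarrow>\<^sub>M borel"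
      by (intro borel_measurable_Pair proj1[OF snd_\<Omega>_measurable] proj2[OF snd_\<Omega>_measurable])
    then have "(\<lambda>w. (\<lambda>p. cinner (fst p) (snd p)) (snd (fst w) \<Omega>, snd (snd w) \<Omega>)) \<in> total_borel \<Otimes>\<^sub>M total_borel \<rightarrow>\<^sub>M borel"
      by (rule measurable_compose)
        (intro borel_measurable_continuous_onI continuous_on_cinner continuous_intros)
    from measurable_restrict_space1[OF this]
    show "(\<lambda>w. cinner (snd (fst w) \<Omega>) (snd (snd w) \<Omega>))
        \<in> ?R \<rightarrow>\<^sub>M borel" by simp
  qed
  show "(\<lambda>((s, x), (t, y)). (s + t, mult s t (tensor_elem (fibre s) (fibre t) x y))) \<in> total_borel \<Otimes>\<^sub>M total_borel \<rightarrow>\<^sub>M total_borel"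
  proof (rule measurable_cong[THEN iffD2])
    show "((\<lambda>((s, x), (t, y)). (s + t, mult s t (tensor_elem (fibre s) (fibre t) x y))) w) =
        (fst (fst w) + fst (snd w), snd (fst w) \<circ> snd (snd w))" if "w \<in> space (total_borel \<Otimes>\<^sub>M total_borel)" for w
      using that by (auto simp: space_pair_measure space_total_borel total_def mult_isometry(2))
    show "(\<lambda>w. (fst (fst w) + fst (snd w), snd (fst w) \<circ> snd (snd w))) \<in> total_borel \<Otimes>\<^sub>M total_borel \<rightarrow>\<^sub>M total_borel"
    proof (rule measurable_into_total_borel)
      show "(fst (fst w) + fst (snd w), snd (fst w) \<circ> snd (snd w)) \<in> total" if "w \<in> space (total_borel \<Otimes>\<^sub>M total_borel)" for w
        using that by (auto simp: space_pair_measure space_total_borel total_def E_comp)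
      show "(\<lambda>w. fst (fst (fst w) + fst (snd w), snd (fst w) \<circ> snd (snd w))) \<in> total_borel \<Otimes>\<^sub>M total_borel \<rightarrow>\<^sub>M borel"
        unfolding fst_conv
        by (intro borel_measurable_add proj1[OF fst_measurable] proj2[OF fst_measurable])
      show "(\<lambda>w. snd (fst (fst w) + fst (snd w), snd (fst w) \<circ> snd (snd w)) \<Omega>) \<in> total_borel \<Otimes>\<^sub>M total_borel \<rightarrow>\<^sub>M borel"
        using apply_measurable by simp
    qed
  qed
  obtain d :: "nat \<Rightarrow> 'h" where d: "closure (range d) = UNIV" by (rule dense_sequence)
  show "\<exists>e :: nat \<Rightarrow> real \<Rightarrow> 'h \<Rightarrow> 'h.
        (\<forall>n. (\<lambda>t. (t, e n t)) \<in> restrict_space borel {0<..} \<rightarrow>\<^sub>M total_borel) \<and>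
        (\<forall>t>0. \<forall>x\<in>hcarrier (fibre t). (\<forall>n. hinner (fibre t) x (e n t) = 0) \<longrightarrow> x = hzero (fibre t))"
  proof (intro exI[of _ "\<lambda>n. proj (d n)"] conjI allI ballI impI)
    fix n
    show "(\<lambda>t. (t, proj (d n) t)) \<in> restrict_space borel {0<..} \<rightarrow>\<^sub>M total_borel"
    proof (rule measurable_into_total_borel)
      show "(t, proj (d n) t) \<in> total" if "t \<in> space (restrict_space borel {0<..})" for t
        using that by (auto simp: total_def proj_closed space_restrict_space)
    qed (simp_all add: proj_measurable measurable_restrict_space1)
  next
    fix t :: real and T
    assume t: "0 < t" and T: "T \<in> hcarrier (fibre t)" and orth: "\<forall>n. hinner (fibre t) T (proj (d n) t) = 0"
    have TE: "T \<in> E t" and t': "0 \<le> t" using T t by simp_all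
    \<comment> \<open>Against a vector of the fibre, \<open>d n\<close> and its projection have the
      same inner product. Density of the \<open>d n\<close> then makes \<open>T \<Omega>\<close>
      orthogonal to itself.\<close>
    have "cinner (T \<Omega>) (d n) = 0" for n
      using orth fibre_inner[OF t' TE proj_closed[OF t']] proj_inner[OF t' TE] by simp
    then have "range d \<subseteq> {y. cinner (T \<Omega>) y = 0}" by auto
    moreover have "closed {y. cinner (T \<Omega>) y = 0}"
      by (intro closed_Collect_eq continuous_on_cinner continuous_intros)
    ultimately have "closure (range d) \<subseteq> {y. cinner (T \<Omega>) y = 0}" by (rule closure_minimal)
    then have "cinner (T \<Omega>) (T \<Omega>) = 0" using d by auto
    then have "T \<Omega> = 0" by (simp add: cinner_self)
    then show "T = hzero (fibre t)" using E_eqI[OF t' TE E_zero[OF t']] by simp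
  qed
qed

theorem super_product_system_fibre: "super_product_system fibre mult"
proof (unfold_locales, goal_cases)
  case (1 t)
  then show ?case by (intro separable_fibre) simp
next
  case (2 s t)
  then interpret hilbert_pair "fibre s" "fibre t" by (intro hilbert_pair_fibre) auto
  show ?case
    using 2 by (intro scaled_isometry_hisometry hilbert_space_tensor hilbert_space_fibre mult_isometry(1)) auto
next
  case (3 r s t w)
  then show ?case by (intro mult_associative) auto
next
  case 4
  show ?case using compatible_total_borel by blast
qed

end

section \<open>The super product system\<close>

locale E0_standard = standard_form M \<Omega>
  for M :: "('h::complex_hilbert \<Rightarrow> 'h) set" and \<Omega> +
  fixes \<alpha> :: "real \<Rightarrow> ('h \<Rightarrow> 'h) \<Rightarrow> ('h \<Rightarrow> 'h)"
  assumes E0: "E0_semigroup M \<alpha>"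
begin

lemma normal_endo: "0 \<le> t \<Longrightarrow> normal_endo M \<Omega> (\<alpha> t)"
  using E0 standard_form_axioms by (simp add: E0_semigroup_def normal_endo_def normal_endo_axioms_def)

lemmas \<alpha>_closed = normal_endo.endo_into[OF normal_endo]
lemmas \<alpha>_cadj = normal_endo.endo_cadj[OF normal_endo]

lemma \<alpha>_add: "\<lbrakk>0 \<le> s; 0 \<le> t; m \<in> M\<rbrakk> \<Longrightarrow> \<alpha> (s + t) m = \<alpha> s (\<alpha> t m)"
  using E0 by (simp add: E0_semigroup_def)

lemma \<alpha>_weakly_continuous:
  assumes m: "m \<in> M" and u: "\<And>n. 0 \<le> u n" "u \<longlonglongrightarrow> t"
  shows "(\<lambda>n. cinner (\<alpha> (u n) m x) y) \<longlonglongrightarrow> cinner (\<alpha> t m x) y"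
proof -
  have t: "0 \<le> t" using u by (meson LIMSEQ_le_const)
  have "\<forall>m\<in>M. \<forall>\<rho>\<in>predual M. continuous_on {0..} (\<lambda>t. \<rho> (\<alpha> t m))"
    using E0 by (simp add: E0_semigroup_def)
  from bspec[OF bspec[OF this m] vector_functional_in_predual[of x y]] show ?thesis
    by (rule continuous_on_tendsto_compose[OF _ u(2)]) (use t u(1) in auto)
qed

text \<open>At a fixed vector, weak convergence together with convergence of norms gives convergence
  in norm. The bound from contractivity is uniform in time and absorbs the moving vector.\<close>

lemma \<alpha>_tendsto:
  assumes m: "m \<in> M" and u: "\<And>n. 0 \<le> u n" "u \<longlonglongrightarrow> t" and v: "v \<longlonglongrightarrow> x"
  shows "(\<lambda>n. \<alpha> (u n) m (v n)) \<longlonglongrightarrow> \<alpha> t m x"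
proof -
  have t: "0 \<le> t" using u by (meson LIMSEQ_le_const)
  let ?a = "\<lambda>n. \<alpha> (u n) m x" and ?b = "\<alpha> t m x"
  \<comment> \<open>The squared norm is a matrix coefficient of the orbit of
    \<open>cadj m \<circ> m\<close>, so weak continuity also yields convergence of norms.\<close>
  have norm_square: "(norm (\<alpha> s m x))\<^sup>2 = Re (cinner (\<alpha> s (cadj m \<circ> m) x) x)" if "0 \<le> s" for s
    unfolding normal_endo.endo_norm_square[OF normal_endo[OF that] m, symmetric] by simp
  have "(\<lambda>n. Re (cinner (\<alpha> (u n) (cadj m \<circ> m) x) x) - 2 * Re (cinner (?a n) ?b) + (norm ?b)\<^sup>2)
      \<longlonglongrightarrow> Re (cinner (\<alpha> t (cadj m \<circ> m) x) x) - 2 * Re (cinner ?b ?b) + (norm ?b)\<^sup>2"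
    by (intro tendsto_intros \<alpha>_weakly_continuous u m M_comp M_cadj)
  moreover have "Re (cinner (\<alpha> t (cadj m \<circ> m) x) x) - 2 * Re (cinner ?b ?b) + (norm ?b)\<^sup>2 = 0"
    unfolding norm_square[OF t, symmetric] cinner_self by simp
  moreover have "(norm (?a n - ?b))\<^sup>2 =
      Re (cinner (\<alpha> (u n) (cadj m \<circ> m) x) x) - 2 * Re (cinner (?a n) ?b) + (norm ?b)\<^sup>2" for n
    unfolding norm_square[OF u(1), symmetric]
    by (simp add: Re_cinner power2_norm_eq_inner inner_diff inner_commute)
  ultimately have "(\<lambda>n. (norm (?a n - ?b))\<^sup>2) \<longlonglongrightarrow> 0" by simp
  then have "(\<lambda>n. norm (?a n - ?b)) \<longlonglongrightarrow> 0"
    using tendsto_real_sqrt[of "\<lambda>n. (norm (?a n - ?b))\<^sup>2" 0] by simp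
  then have a: "(\<lambda>n. ?a n - ?b) \<longlonglongrightarrow> 0" by (rule tendsto_norm_zero_cancel)
  obtain K where K: "K > 0" "\<And>y. norm (m y) \<le> K * norm y"
    using bounded_clinear_bound[OF M_bounded[OF m]] by blast
  have "(\<lambda>n. \<alpha> (u n) m (v n - x)) \<longlonglongrightarrow> 0"
  proof (rule Lim_null_comparison)
    show "\<forall>\<^sub>F n in sequentially. norm (\<alpha> (u n) m (v n - x)) \<le> K * norm (v n - x)"
      using normal_endo.endo_contractive[OF normal_endo[OF u(1)] m _ K(2)] K(1) by simp
    show "(\<lambda>n. K * norm (v n - x)) \<longlonglongrightarrow> 0"
      using tendsto_mult_left[OF tendsto_norm[OF LIM_zero[OF v]], of K] by simp
  qed
  from tendsto_add[OF this a] have "(\<lambda>n. \<alpha> (u n) m (v n) - ?b) \<longlonglongrightarrow> 0"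
    by (simp add: bounded_clinear_diff[OF M_bounded[OF \<alpha>_closed[OF u(1) m]]])
  then show ?thesis by (rule LIM_zero_cancel)
qed

lemma star_action_\<alpha>: "star_action M \<alpha>"
  by unfold_locales (simp_all add: M_bounded M_cadj \<alpha>_closed \<alpha>_cadj \<alpha>_add \<alpha>_tendsto)

lemma complementary_eq: "complementary M \<Omega> \<alpha> t x = J \<circ> \<alpha> t (J \<circ> x \<circ> J) \<circ> J"
  by (simp add: complementary_def Let_def)

lemma J_conj_conj: "J \<circ> (J \<circ> T \<circ> J) \<circ> J = T"
  by (simp add: fun_eq_iff)

text \<open>Conjugation by \<open>J\<close> exchanges \<open>M\<close> and its commutant and carries
  each property over; adjacent conjugations cancel, and continuity of \<open>J\<close> preserves
  limits.\<close>

lemma star_action_complementary: "star_action (commutant M) (complementary M \<Omega> \<alpha>)"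
proof
  fix x assume x: "x \<in> commutant M"
  show "bounded_clinear x" using x by (rule commutantD)
  show "cadj x \<in> commutant M" using x by (rule comm_cadj)
  fix t :: real assume t: "0 \<le> t"
  show "complementary M \<Omega> \<alpha> t x \<in> commutant M"
    unfolding complementary_eq using t x by (intro J_conj_M \<alpha>_closed J_conj_comm)
  show "complementary M \<Omega> \<alpha> t (cadj x) = cadj (complementary M \<Omega> \<alpha> t x)"
    unfolding complementary_eq J_conj_cadj[OF commutantD(1)[OF x], symmetric]
    using t x by (simp only: \<alpha>_cadj J_conj_comm J_conj_cadj M_bounded \<alpha>_closed)
  fix s :: real assume s: "0 \<le> s"
  show "complementary M \<Omega> \<alpha> (s + t) x = complementary M \<Omega> \<alpha> s (complementary M \<Omega> \<alpha> t x)"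
    unfolding complementary_eq J_conj_conj \<alpha>_add[OF s t J_conj_comm[OF x]] ..
next
  fix x t v and u :: "nat \<Rightarrow> real" and y :: 'h
  assume x: "x \<in> commutant M" and u: "\<And>n. 0 \<le> u n" "u \<longlonglongrightarrow> t" and v: "v \<longlonglongrightarrow> y"
  have J: "(\<lambda>n. J (w n)) \<longlonglongrightarrow> J z" if "w \<longlonglongrightarrow> z" for w z
    using continuous_on_tendsto_compose[OF J_continuous that] by simp
  have eq: "complementary M \<Omega> \<alpha> s x z = J (\<alpha> s (J \<circ> x \<circ> J) (J z))" for s z
    unfolding complementary_eq by simp
  show "(\<lambda>n. complementary M \<Omega> \<alpha> (u n) x (v n)) \<longlonglongrightarrow> complementary M \<Omega> \<alpha> t x y"
    unfolding eq by (rule J[OF \<alpha>_tendsto[OF J_conj_comm[OF x] u J[OF v]]])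
qed

end

theorem theorem8p9:
  fixes M :: "('h::{complex_hilbert, second_countable_topology} \<Rightarrow> 'h) set"
    and \<Omega> :: 'h
    and \<alpha> :: "real \<Rightarrow> ('h \<Rightarrow> 'h) \<Rightarrow> ('h \<Rightarrow> 'h)"
  assumes "II1_factor M"
    and "standard_trace_vector M \<Omega>"
    and "E0_semigroup M \<alpha>"
  shows "super_product_system (intertwiner_space M \<Omega> \<alpha>) (intertwiner_mult M \<Omega> \<alpha>)"
proof -
  have factor: "von_neumann_algebra M" "M \<inter> commutant M = range (\<lambda>c x. c *\<^sub>C x)"
    using assms(1) by (simp_all add: II1_factor_def factor_def)
  interpret E0_standard M \<Omega> \<alpha>
    using factor(1) assms(2,3) by unfold_locales
  interpret I: intertwining M "commutant M" \<alpha> "complementary M \<Omega> \<alpha>" \<Omega>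
  proof (intro intertwining.intro star_action_\<alpha> star_action_complementary, unfold_locales)
    fix T assume "T \<in> commutant M" "T \<in> commutant (commutant M)"
    \<comment> \<open>By the bicommutant property \<open>T\<close> lies in \<open>M\<close> as well
      as in its commutant, that is in the centre, which for a factor consists of scalars.\<close>
    then have "T \<in> range (\<lambda>c x. c *\<^sub>C x)" using factor(2) bicommutant by blast
    then show "\<exists>c. T = (\<lambda>x. c *\<^sub>C x)" by blast
  qed (rule cyclic norm_\<Omega>)+
  have "I.fibre = intertwiner_space M \<Omega> \<alpha>"
    by (rule ext) (simp add: I.fibre_def I.E_def intertwiner_space_def)
  moreover from this have "I.mult = intertwiner_mult M \<Omega> \<alpha>"
    by (intro ext) (simp add: I.mult_def intertwiner_mult_def)
  ultimately show ?thesis using I.super_product_system_fibre by simp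
qed

end
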